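(* Let $\lambda\neq 0$ and consider the real analytic system $\dot x=y+P(x,y,z)$, $\dot y=Q(x,y,z)$, $\dot z=-\lambda z+R(x,y,z)$, with $j^1P(0)=j^1Q(0)=j^1R(0)=0$, having a monodromic singular point at the origin such that its restriction to a center manifold satisfies the monodromy condition $\beta=n-1$. Then the system cannot admit a formal first integral.
   Context: $j^lG(0)$ denotes the $l$-jet of $G$ at $0$. A center manifold is an invariant surface $z=h(x,y)$ through the origin tangent to the $xy$-plane there, with $h$ of class $C^r$ ($r$ any finite integer as large as needed). The restricted planar $C^r$ system is $\dot x=y+p(x,y)$, $\dot y=q(x,y)$ with $p(x,y)=P(x,y,h(x,y))$, $q(x,y)=Q(x,y,h(x,y))$. For it let $y=F(x)$ solve $y+p(x,y)=0$ through the origin, $f(x)=q(x,F(x))$, $\Phi(x)=(\partial_xp+\partial_yq)(x,F(x))$. Write $f(x)=ax^\alpha+O(x^{\alpha+1})$, $a\neq0$, $\alpha<r$, and $\Phi(x)=bx^\beta+O(x^{\beta+1})$, $b\neq 0$ (if $\Phi$ has nonzero jet). The origin is monodromic on the center manifold (orbits turn around it, a first return map is defined) if and only if $a<0$, $\alpha=2n-1$, and either (i) $\beta>n-1$ or the jet of $\Phi$ vanishes, or (ii) $\beta=n-1$ and $b^2+4an<0$. "The monodromy condition $\beta=n-1$" is condition (ii). A formal first integral is a nonconstant formal power series $H(x,y,z)$ with $(y+P)\partial_xH+Q\,\partial_yH+(-\lambda z+R)\partial_zH=0$. *)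

theory Defs
  imports
    "HOL-Analysis.Analysis"
    "HOL-Computational_Algebra.Formal_Power_Series"
    "HOL-Library.Landau_Symbols"
begin

text \<open>
  The ring of formal power series in \<open>x, y, z\<close> is the iterated ring of series in \<open>z\<close> whose
  coefficients are series in \<open>y\<close> whose coefficients are series in \<open>x\<close>.
\<close>

type_synonym fps3 = "real fps fps fps"

text \<open>\<open>coeff3 G i j k\<close> is the coefficient of \<open>x^i * y^j * z^k\<close>; the outermost index is that of \<open>z\<close>.\<close>

definition coeff3 :: "fps3 \<Rightarrow> nat \<Rightarrow> nat \<Rightarrow> nat \<Rightarrow> real" where
  "coeff3 G i j k = fps_nth (fps_nth (fps_nth G k) j) i"

definition const3 :: "real \<Rightarrow> fps3" where
  "const3 c = fps_const (fps_const (fps_const c))"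

definition Y3 :: fps3 where "Y3 = fps_const fps_X"

definition Z3 :: fps3 where "Z3 = fps_X"

definition dx3 :: "fps3 \<Rightarrow> fps3" where
  "dx3 G = Abs_fps (\<lambda>k. Abs_fps (\<lambda>j. fps_deriv (fps_nth (fps_nth G k) j)))"

definition dy3 :: "fps3 \<Rightarrow> fps3" where
  "dy3 G = Abs_fps (\<lambda>k. fps_deriv (fps_nth G k))"

definition dz3 :: "fps3 \<Rightarrow> fps3" where
  "dz3 G = fps_deriv G"

definition jet3 :: "nat \<Rightarrow> fps3 \<Rightarrow> fps3" where
  "jet3 l G = Abs_fps (\<lambda>k. Abs_fps (\<lambda>j. Abs_fps (\<lambda>i.
     if i + j + k \<le> l then coeff3 G i j k else 0)))"

text \<open>
  Real analyticity at the origin: \<open>G\<close> is the sum of the power series on a neighbourhood of \<open>0\<close>.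
  The sum is unordered, hence absolutely convergent, and the series is the Taylor series of \<open>G\<close>.
\<close>

definition has_fps3_expansion :: "(real \<times> real \<times> real \<Rightarrow> real) \<Rightarrow> fps3 \<Rightarrow> bool" where
  "has_fps3_expansion G S \<longleftrightarrow>
     (\<forall>\<^sub>F (x, y, z) in nhds 0.
        ((\<lambda>(i, j, k). coeff3 S i j k * x ^ i * y ^ j * z ^ k) has_sum G (x, y, z)) UNIV)"

definition formal_first_integral :: "real \<Rightarrow> fps3 \<Rightarrow> fps3 \<Rightarrow> fps3 \<Rightarrow> fps3 \<Rightarrow> bool" where
  "formal_first_integral lam P Q R H \<longleftrightarrow>
     (\<nexists>c. H = const3 c) \<and>
     (Y3 + P) * dx3 H + Q * dy3 H + (- const3 lam * Z3 + R) * dz3 H = 0"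

definition solves_ode_on ::
    "('a::real_normed_vector \<Rightarrow> 'a) \<Rightarrow> (real \<Rightarrow> 'a) \<Rightarrow> real set \<Rightarrow> bool" where
  "solves_ode_on X u I \<longleftrightarrow> (\<forall>t\<in>I. (u has_vector_derivative X (u t)) (at t within I))"

text \<open>Functions of class \<open>C^r\<close> on a set; only used for open sets.\<close>

primrec class_C :: "nat \<Rightarrow> 'a::euclidean_space set \<Rightarrow> ('a \<Rightarrow> real) \<Rightarrow> bool" where
  "class_C 0 U g \<longleftrightarrow> continuous_on U g"
| "class_C (Suc r) U g \<longleftrightarrow>
     (\<forall>w\<in>U. g differentiable (at w)) \<and>
     (\<forall>b\<in>Basis. class_C r U (\<lambda>w. frechet_derivative g (at w) b))"

definition system_field ::
    "real \<Rightarrow> (real \<times> real \<times> real \<Rightarrow> real) \<Rightarrow> (real \<times> real \<times> real \<Rightarrow> real) \<Rightarrow>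
     (real \<times> real \<times> real \<Rightarrow> real) \<Rightarrow> real \<times> real \<times> real \<Rightarrow> real \<times> real \<times> real" where
  "system_field lam P Q R = (\<lambda>(x, y, z).
     (y + P (x, y, z), Q (x, y, z), - lam * z + R (x, y, z)))"

definition graph_pt :: "(real \<times> real \<Rightarrow> real) \<Rightarrow> real \<times> real \<Rightarrow> real \<times> real \<times> real" where
  "graph_pt h = (\<lambda>(x, y). (x, y, h (x, y)))"

text \<open>
  Invariance is local: the orbit through each point of the surface stays on the surface for
  small positive and negative times.
\<close>

definition center_manifold ::
    "nat \<Rightarrow> (real \<times> real \<times> real \<Rightarrow> real \<times> real \<times> real) \<Rightarrow> (real \<times> real \<Rightarrow> real) \<Rightarrow> bool" where
  "center_manifold r X h \<longleftrightarrow>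
     h 0 = 0 \<and> (h has_derivative (\<lambda>_. 0)) (at 0) \<and>
     (\<exists>U. open U \<and> 0 \<in> U \<and> class_C r U h \<and>
        (\<forall>w\<in>U. \<exists>\<epsilon>>0. \<exists>u.
           u 0 = graph_pt h w \<and> solves_ode_on X u {-\<epsilon><..<\<epsilon>} \<and>
           (\<forall>t\<in>{-\<epsilon><..<\<epsilon>}. u t \<in> graph_pt h ` U)))"

definition restricted ::
    "(real \<times> real \<times> real \<Rightarrow> real) \<Rightarrow> (real \<times> real \<Rightarrow> real) \<Rightarrow> real \<times> real \<Rightarrow> real" where
  "restricted G h w = G (graph_pt h w)"

definition planar_field ::
    "(real \<times> real \<Rightarrow> real) \<Rightarrow> (real \<times> real \<Rightarrow> real) \<Rightarrow> real \<times> real \<Rightarrow> real \<times> real" where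
  "planar_field p q = (\<lambda>(x, y). (y + p (x, y), q (x, y)))"

text \<open>
  Orbits turn around the origin: every orbit starting close enough to the origin makes, in forward
  time and without leaving a prescribed neighbourhood, one full turn, measured by a continuous
  determination \<open>\<theta>\<close> of the polar angle. In particular it returns to the ray it started from, so
  that each ray from the origin carries a first return map.
\<close>

definition monodromic :: "(real \<times> real \<Rightarrow> real \<times> real) \<Rightarrow> bool" where
  "monodromic X \<longleftrightarrow> X 0 = 0 \<and>
     (\<forall>\<epsilon>>0. \<exists>\<delta>>0. \<forall>w. 0 < norm w \<and> norm w < \<delta> \<longrightarrow>
        (\<exists>T>0. \<exists>u \<theta>.
           u 0 = w \<and> solves_ode_on X u {0..T} \<and> continuous_on {0..T} \<theta> \<and>
           (\<forall>t\<in>{0..T}. 0 < norm (u t) \<and> norm (u t) < \<epsilon> \<and>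
              u t = norm (u t) *\<^sub>R (cos (\<theta> t), sin (\<theta> t))) \<and>
           \<bar>\<theta> T - \<theta> 0\<bar> = 2 * pi))"

text \<open>
  Continuity of \<open>F\<close> selects the branch through the origin, which is locally unique by the implicit
  function theorem.
\<close>

definition solves_nullcline :: "(real \<times> real \<Rightarrow> real) \<Rightarrow> (real \<Rightarrow> real) \<Rightarrow> bool" where
  "solves_nullcline p F \<longleftrightarrow>
     F 0 = 0 \<and> (\<forall>\<^sub>F x in nhds 0. isCont F x \<and> F x + p (x, F x) = 0)"

definition f_fun :: "(real \<times> real \<Rightarrow> real) \<Rightarrow> (real \<Rightarrow> real) \<Rightarrow> real \<Rightarrow> real" where
  "f_fun q F x = q (x, F x)"

definition Phi_fun ::
    "(real \<times> real \<Rightarrow> real) \<Rightarrow> (real \<times> real \<Rightarrow> real) \<Rightarrow> (real \<Rightarrow> real) \<Rightarrow> real \<Rightarrow> real" where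
  "Phi_fun p q F x = deriv (\<lambda>s. p (s, F x)) x + deriv (\<lambda>t. q (x, t)) (F x)"

definition leading_term :: "(real \<Rightarrow> real) \<Rightarrow> real \<Rightarrow> nat \<Rightarrow> bool" where
  "leading_term g c m \<longleftrightarrow> c \<noteq> 0 \<and> (\<lambda>x. g x - c * x ^ m) \<in> O[at 0](\<lambda>x. x ^ (m + 1))"

end

theory Submission
  imports Defs
begin

text \<open>
  Put \<open>x = \<epsilon>\<close>, \<open>y = F(\<epsilon>) + \<epsilon>\<^sup>n u\<close>, \<open>z = T(\<epsilon>) + \<epsilon>\<^sup>n (S(\<epsilon>) u + v)\<close>, where \<open>F\<close>, \<open>T\<close> and \<open>S\<close> are jets of the
  curve \<open>y + p = 0\<close>, of \<open>h\<close> and of \<open>h\<^sub>y\<close> along it. In these coordinates a formal first integral becomes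
  a power series in \<open>\<epsilon>\<close> over the polynomials in \<open>u, v\<close>, and the system becomes
  \<open>\<epsilon>' = \<epsilon>\<^sup>n (u + \<dots>)\<close>, \<open>u' = \<epsilon>\<^sup>n\<^sup>-\<^sup>1 (a + b u - n u\<^sup>2) + \<dots>\<close>, \<open>v' = - \<lambda> v + \<dots>\<close>. Hence the lowest coefficient \<open>g\<close>
  of the integral, at \<open>\<epsilon>\<^sup>N\<close> with \<open>N > 0\<close>, depends on \<open>u\<close> only and satisfies
  \<open>N u g + (a + b u - n u\<^sup>2) g' = 0\<close>. Since the quadratic has no real root and \<open>b \<noteq> 0\<close>, no nonzero
  polynomial solves this equation. Only finite jets along the curve are needed; they are
  determined successively by the invariance equation of \<open>h\<close> and its first derivatives, which
  on the curve are algebraic up to terms of high order.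
\<close>

text \<open>The center manifold is only of class \<open>C^r\<close> and in general not unique, while
  the integral is only formal. So the integral is not restricted to the manifold; it is pulled back
  to coordinates adapted to finite jets, with \<open>u\<close> and \<open>v\<close> as polynomial
  parameters. The weight \<open>n\<close> comes from the normal form: after the shear
  \<open>Y = y - F\<close> the leading part is \<open>x' = Y\<close>,
  \<open>Y' = a * x ^ (2 * n - 1) + b * x ^ (n - 1) * Y\<close>, quasi-homogeneous for the weights 1
  and \<open>n\<close>. The term \<open>- n * u ^ 2\<close> arises because \<open>Y\<close> is
  divided by \<open>x ^ n\<close> while \<open>x\<close> moves. The tilt \<open>S * u\<close> makes
  \<open>v'\<close> vanish at \<open>v = 0\<close> up to order \<open>n\<close>, clear of the
  comparison at order \<open>n - 1\<close>. \<open>F\<close>, \<open>T\<close> and \<open>Q\<close>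
  are needed modulo \<open>x ^ (2 * n)\<close>, since \<open>a\<close> sits at
  \<open>2 * n - 1\<close> before division by \<open>x ^ n\<close>; \<open>S\<close> and
  \<open>U\<close> only modulo \<open>x ^ n\<close>, since they multiply displacements of order
  \<open>n\<close>. The sign condition alone would not finish the proof: for \<open>b = 0\<close>
  and \<open>N = 2 * m * n\<close> the power \<open>(n * u ^ 2 - a) ^ m\<close> solves the final
  equation.\<close>

unbundle no vec_syntax
unbundle fps_syntax

section \<open>Substitution into formal power series\<close>

text \<open>Truncation is expressed as divisibility throughout: congruences modulo
  \<open>fps_X ^ N\<close> combine by the rules for sums and products.\<close>

lemma fps_X_power_dvd_iff:
  fixes f :: "'a::comm_ring_1 fps"
  shows "fps_X ^ N dvd f \<longleftrightarrow> (\<forall>i<N. f $ i = 0)"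
proof
  assume "fps_X ^ N dvd f"
  then show "\<forall>i<N. f $ i = 0" by (auto simp: dvd_def fps_X_power_mult_nth)
next
  assume "\<forall>i<N. f $ i = 0"
  then have "f = fps_X ^ N * fps_shift N f"
    by (intro fps_ext) (auto simp: fps_X_power_mult_nth)
  then show "fps_X ^ N dvd f" by (rule dvdI)
qed

lemma fps_X_dvd_iff:
  fixes f :: "'a::comm_ring_1 fps"
  shows "fps_X dvd f \<longleftrightarrow> f $ 0 = 0"
  using fps_X_power_dvd_iff[of 1 f] by simp

lemma fps_X_power_dvd_power:
  fixes z :: "'a::comm_ring_1 fps"
  shows "z $ 0 = 0 \<Longrightarrow> fps_X ^ k dvd z ^ k"
  by (simp add: fps_X_dvd_iff dvd_power_same)

text \<open>The evaluation that extends \<open>\<phi>\<close> and sends the series variable to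
  \<open>z\<close>. No limit occurs: for \<open>z $ 0 = 0\<close> the terms beyond \<open>m\<close>
  do not reach coefficient \<open>m\<close>. Since \<open>\<phi>\<close> itself takes values in
  series, the construction can be iterated over nested series rings.\<close>

definition fps_subst ::
    "('b::comm_ring_1 \<Rightarrow> 'a::comm_ring_1 fps) \<Rightarrow> 'a fps \<Rightarrow> 'b fps \<Rightarrow> 'a fps" where
  "fps_subst \<phi> z G = Abs_fps (\<lambda>m. (\<Sum>k\<le>m. \<phi> (G $ k) * z ^ k) $ m)"

lemma fps_subst_nth:
  assumes "z $ 0 = 0" "m \<le> D"
  shows "fps_subst \<phi> z G $ m = (\<Sum>k\<le>D. \<phi> (G $ k) * z ^ k) $ m"
proof -
  have "(\<phi> (G $ k) * z ^ k) $ m = 0" if "m < k" for k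
    using fps_X_power_dvd_power[OF assms(1), of k] that
    by (meson dvd_mult fps_X_power_dvd_iff)
  then have "(\<Sum>k\<le>m. (\<phi> (G $ k) * z ^ k) $ m) = (\<Sum>k\<le>D. (\<phi> (G $ k) * z ^ k) $ m)"
    using assms(2) by (intro sum.mono_neutral_left) auto
  then show ?thesis by (simp add: fps_subst_def fps_sum_nth)
qed

lemma fps_subst_dvd:
  assumes "z $ 0 = 0"
  shows "fps_X ^ Suc D dvd fps_subst \<phi> z G - (\<Sum>k\<le>D. \<phi> (G $ k) * z ^ k)"
  unfolding fps_X_power_dvd_iff using fps_subst_nth[OF assms, of _ D]
  by (auto simp: less_Suc_eq_le)

text \<open>Reduces identities between substituted series to congruences, in which every
  substitution may be replaced by a finite sum; \<open>Suc N\<close> matches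
  \<open>fps_subst_dvd\<close>.\<close>

lemma fps_eqI_dvd:
  fixes f g :: "'a::comm_ring_1 fps"
  assumes "\<And>N. fps_X ^ Suc N dvd f - g"
  shows "f = g"
  using assms by (intro fps_ext) (metis fps_X_power_dvd_iff fps_sub_nth lessI eq_iff_diff_eq_0)

section \<open>Ring homomorphisms, derivations and the chain rule\<close>

definition is_ring_hom :: "('b::comm_ring_1 \<Rightarrow> 'a::comm_ring_1) \<Rightarrow> bool" where
  "is_ring_hom \<phi> \<longleftrightarrow>
     (\<forall>a b. \<phi> (a + b) = \<phi> a + \<phi> b) \<and> (\<forall>a b. \<phi> (a * b) = \<phi> a * \<phi> b) \<and> \<phi> 1 = 1"

lemma
  assumes "is_ring_hom \<phi>"
  shows is_ring_hom_add: "\<phi> (a + b) = \<phi> a + \<phi> b"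
    and is_ring_hom_mult: "\<phi> (a * b) = \<phi> a * \<phi> b"
    and is_ring_hom_1: "\<phi> 1 = 1"
    and is_ring_hom_0: "\<phi> 0 = 0"
    and is_ring_hom_minus: "\<phi> (- a) = - \<phi> a"
    and is_ring_hom_diff: "\<phi> (a - b) = \<phi> a - \<phi> b"
    and is_ring_hom_of_nat: "\<phi> (of_nat n) = of_nat n"
    and is_ring_hom_power: "\<phi> (a ^ n) = \<phi> a ^ n"
    and is_ring_hom_sum: "\<phi> (sum f A) = (\<Sum>x\<in>A. \<phi> (f x))"
proof -
  show add: "\<phi> (a + b) = \<phi> a + \<phi> b" and mult: "\<phi> (a * b) = \<phi> a * \<phi> b" and one: "\<phi> 1 = 1" for a b
    using assms by (auto simp: is_ring_hom_def)
  show zero: "\<phi> 0 = 0" using add[of 0 0] by simp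
  show minus: "\<phi> (- a) = - \<phi> a" for a using add[of a "- a"] zero by (simp add: minus_unique)
  show "\<phi> (a - b) = \<phi> a - \<phi> b" using add[of a "- b"] minus[of b] by simp
  show "\<phi> (of_nat n) = of_nat n" by (induction n) (simp_all add: add one zero)
  show "\<phi> (a ^ n) = \<phi> a ^ n" by (induction n) (simp_all add: mult one)
  show "\<phi> (sum f A) = (\<Sum>x\<in>A. \<phi> (f x))"
    by (induction A rule: infinite_finite_induct) (simp_all add: add zero)
qed

lemma fps_subst_add:
  assumes "is_ring_hom \<phi>"
  shows "fps_subst \<phi> z (G + H) = fps_subst \<phi> z G + fps_subst \<phi> z H"
  by (rule fps_ext) (simp add: fps_subst_def is_ring_hom_add[OF assms] distrib_right sum.distrib)

text \<open>Beyond the truncated product, the product of two truncations has only terms with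
  \<open>i + j > D\<close>, and for these \<open>z ^ (i + j)\<close> is divisible by
  \<open>fps_X ^ Suc D\<close>.\<close>

lemma fps_subst_mult:
  assumes "is_ring_hom \<phi>" and z: "z $ 0 = 0"
  shows "fps_subst \<phi> z (G * H) = fps_subst \<phi> z G * fps_subst \<phi> z H"
proof (rule fps_eqI_dvd)
  fix D
  let ?S = "\<lambda>F. \<Sum>k\<le>D. \<phi> (F $ k) * z ^ k"
  let ?t = "\<lambda>(i, j). \<phi> (G $ i) * \<phi> (H $ j) * z ^ (i + j)"
  have "?S (G * H) = (\<Sum>k\<le>D. \<Sum>i\<le>k. ?t (i, k - i))"
    by (intro sum.cong refl)
      (simp add: fps_mult_nth is_ring_hom_sum[OF assms(1)] is_ring_hom_mult[OF assms(1)]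
         sum_distrib_right atLeast0AtMost)
  also have "\<dots> = sum ?t {(i, j). i + j \<le> D}"
    by (subst sum.triangle_reindex_eq) simp
  finally have tri: "?S (G * H) = sum ?t {(i, j). i + j \<le> D}" .
  have "?S G * ?S H = sum ?t ({..D} \<times> {..D})"
    by (simp add: sum_product sum.cartesian_product power_add mult_ac)
  also have "\<dots> = sum ?t {(i, j). i + j \<le> D} + sum ?t ({..D} \<times> {..D} - {(i, j). i + j \<le> D})"
    by (subst sum.subset_diff[of "{(i, j). i + j \<le> D}"]) (auto simp: add.commute)
  finally have "?S G * ?S H - ?S (G * H) = sum ?t ({..D} \<times> {..D} - {(i, j). i + j \<le> D})"
    using tri by simp
  moreover have "fps_X ^ Suc D dvd sum ?t ({..D} \<times> {..D} - {(i, j). i + j \<le> D})"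
  proof (intro dvd_sum)
    fix ij assume "ij \<in> {..D} \<times> {..D} - {(i, j). i + j \<le> D}"
    then obtain i j where ij: "ij = (i, j)" "Suc D \<le> i + j" by auto
    have "fps_X ^ Suc D dvd z ^ (i + j)"
      using dvd_trans[OF le_imp_power_dvd[OF ij(2)] fps_X_power_dvd_power[OF z]] .
    then show "fps_X ^ Suc D dvd ?t ij" unfolding ij(1) prod.case by (rule dvd_mult)
  qed
  ultimately have 1: "fps_X ^ Suc D dvd ?S G * ?S H - ?S (G * H)" by simp
  let ?s = "fps_subst \<phi> z"
  have s: "fps_X ^ Suc D dvd ?s F - ?S F" for F by (rule fps_subst_dvd[OF z])
  have "?s (G * H) - ?s G * ?s H = (?s (G * H) - ?S (G * H)) - (?S G * ?S H - ?S (G * H))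
      - (?s G - ?S G) * ?S H - ?s G * (?s H - ?S H)"
    by (simp add: algebra_simps)
  then show "fps_X ^ Suc D dvd ?s (G * H) - ?s G * ?s H"
    using dvd_diff[OF dvd_diff[OF dvd_diff[OF s[of "G * H"] 1] dvd_mult2[OF s[of G]]] dvd_mult[OF s[of H]]]
    by (simp only:)
qed

lemma fps_subst_const:
  assumes "is_ring_hom \<phi>"
  shows "fps_subst \<phi> z (fps_const b) = \<phi> b"
proof (rule fps_ext)
  fix m
  have "(\<Sum>k\<le>m. \<phi> (fps_const b $ k) * z ^ k) = (\<Sum>k\<le>m. if k = 0 then \<phi> b else 0)"
    by (intro sum.cong) (auto simp: is_ring_hom_0[OF assms])
  then show "fps_subst \<phi> z (fps_const b) $ m = \<phi> b $ m"
    by (simp add: fps_subst_def)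
qed

lemma fps_subst_X:
  assumes "is_ring_hom \<phi>" and z: "z $ 0 = 0"
  shows "fps_subst \<phi> z fps_X = z"
proof (rule fps_ext)
  fix m
  have "(\<Sum>k\<le>Suc m. \<phi> (fps_X $ k) * z ^ k) = (\<Sum>k\<le>Suc m. if k = 1 then z else 0)"
    by (intro sum.cong) (auto simp: is_ring_hom_0[OF assms(1)] is_ring_hom_1[OF assms(1)])
  then have "(\<Sum>k\<le>Suc m. \<phi> (fps_X $ k) * z ^ k) = z"
    by simp
  moreover have "fps_subst \<phi> z fps_X $ m = (\<Sum>k\<le>Suc m. \<phi> (fps_X $ k) * z ^ k) $ m"
    using z by (rule fps_subst_nth) simp
  ultimately show "fps_subst \<phi> z fps_X $ m = z $ m"
    by metis
qed

lemma is_ring_hom_fps_subst: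
  assumes "is_ring_hom \<phi>" and z: "z $ 0 = 0"
  shows "is_ring_hom (fps_subst \<phi> z)"
  unfolding is_ring_hom_def
  using fps_subst_add[OF assms(1)] fps_subst_mult[OF assms] fps_subst_const[OF assms(1), of z 1]
  by (simp add: is_ring_hom_1[OF assms(1)])

text \<open>The last clause is continuity in the adic topology with a loss of at most one order; it
  lets \<open>D\<close> pass through truncated substitutions. The loss occurs for
  \<open>fps_deriv\<close>, while derivatives of the coefficients lose nothing.\<close>

definition fps_derivation :: "('a::comm_ring_1 fps \<Rightarrow> 'a fps) \<Rightarrow> bool" where
  "fps_derivation D \<longleftrightarrow>
     (\<forall>f g. D (f + g) = D f + D g) \<and> (\<forall>f g. D (f * g) = D f * g + f * D g) \<and>
     (\<forall>f N. fps_X ^ Suc N dvd f \<longrightarrow> fps_X ^ N dvd D f)"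

lemma
  assumes "fps_derivation D"
  shows fps_derivation_add: "D (f + g) = D f + D g"
    and fps_derivation_mult: "D (f * g) = D f * g + f * D g"
    and fps_derivation_0: "D 0 = 0"
    and fps_derivation_diff: "D (f - g) = D f - D g"
    and fps_derivation_power: "D (f ^ k) = of_nat k * f ^ (k - 1) * D f"
    and fps_derivation_sum: "D (sum F A) = (\<Sum>x\<in>A. D (F x))"
    and fps_derivation_dvd: "fps_X ^ Suc N dvd f \<Longrightarrow> fps_X ^ N dvd D f"
proof -
  show add: "D (f + g) = D f + D g" and mult: "D (f * g) = D f * g + f * D g" for f g
    using assms by (auto simp: fps_derivation_def)
  show zero: "D 0 = 0" using add[of 0 0] by simp
  show "D (f - g) = D f - D g" using add[of "f - g" g] by (simp add: algebra_simps)
  have one: "D 1 = 0" using mult[of 1 1] by simp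
  show "D (f ^ k) = of_nat k * f ^ (k - 1) * D f"
  proof (induction k)
    case (Suc k)
    then show ?case by (cases k) (simp_all add: mult algebra_simps)
  qed (simp add: one)
  show "D (sum F A) = (\<Sum>x\<in>A. D (F x))"
    by (induction A rule: infinite_finite_induct) (simp_all add: add zero)
  show "fps_X ^ Suc N dvd f \<Longrightarrow> fps_X ^ N dvd D f"
    using assms by (auto simp: fps_derivation_def)
qed

definition fps_map :: "('b \<Rightarrow> 'a) \<Rightarrow> 'b fps \<Rightarrow> 'a fps" where
  "fps_map f G = Abs_fps (\<lambda>k. f (G $ k))"

lemma fps_map_nth [simp]: "fps_map f G $ k = f (G $ k)"
  by (simp add: fps_map_def)

lemma fps_map_id [simp]: "fps_map (\<lambda>x. x) G = G"
  by (rule fps_ext) simp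

lemma is_ring_hom_fps_map:
  assumes "is_ring_hom c"
  shows "is_ring_hom (fps_map c)"
  unfolding is_ring_hom_def
  by (auto simp: fps_eq_iff fps_mult_nth is_ring_hom_add[OF assms] is_ring_hom_mult[OF assms]
      is_ring_hom_1[OF assms] is_ring_hom_0[OF assms] is_ring_hom_sum[OF assms])

lemma fps_map_const:
  "is_ring_hom c \<Longrightarrow> fps_map c (fps_const r) = fps_const (c r)"
  by (rule fps_ext) (simp add: is_ring_hom_0)

lemma fps_map_X: "is_ring_hom c \<Longrightarrow> fps_map c fps_X = fps_X"
  by (rule fps_ext) (simp add: is_ring_hom_0 is_ring_hom_1 fps_X_def)

lemma fps_map_deriv:
  "is_ring_hom c \<Longrightarrow> fps_map c (fps_deriv G) = fps_deriv (fps_map c G)"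
  by (rule fps_ext) (simp add: is_ring_hom_mult is_ring_hom_add is_ring_hom_1 is_ring_hom_of_nat)

text \<open>
  The chain rule, in a form that can be iterated over the variables: \<open>\<delta>1\<close> and \<open>\<delta>2\<close> are the
  partial derivatives of the coefficients and \<open>e1\<close> and \<open>e2\<close> the images of the inner variables
  under \<open>D\<close>.
\<close>

lemma fps_derivation_subst:
  assumes D: "fps_derivation D" and hom: "is_ring_hom \<phi>" and z: "z $ 0 = 0"
    and \<phi>: "\<And>b. D (\<phi> b) = \<phi> (\<delta>1 b) * e1 + \<phi> (\<delta>2 b) * e2"
  shows "D (fps_subst \<phi> z G) = fps_subst \<phi> z (fps_map \<delta>1 G) * e1
     + fps_subst \<phi> z (fps_map \<delta>2 G) * e2 + fps_subst \<phi> z (fps_deriv G) * D z"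
proof (rule fps_eqI_dvd)
  fix N
  let ?S = "\<lambda>N F. \<Sum>k\<le>N. \<phi> (F $ k) * z ^ k"
  let ?s = "fps_subst \<phi> z"
  \<comment> \<open>When the powers of \<open>z\<close> are differentiated, the term
    \<open>k = 0\<close> drops out and an index shift produces the coefficients of
    \<open>fps_deriv G\<close>; hence one side is cut at \<open>Suc N\<close> and the other at
    \<open>N\<close>.\<close>
  have sh: "(\<Sum>k\<le>Suc N. of_nat k * \<phi> (G $ k) * z ^ (k - 1)) = ?S N (fps_deriv G)"
    by (subst sum.atMost_Suc_shift)
      (simp add: is_ring_hom_mult[OF hom] is_ring_hom_add[OF hom] is_ring_hom_1[OF hom]
        is_ring_hom_of_nat[OF hom] del: of_nat_Suc sum.atMost_Suc)
  have "D (?S (Suc N) G) = (\<Sum>k\<le>Suc N. D (\<phi> (G $ k)) * z ^ k + \<phi> (G $ k) * (of_nat k * z ^ (k - 1) * D z))"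
    by (simp add: fps_derivation_sum[OF D] fps_derivation_mult[OF D] fps_derivation_power[OF D]
        del: sum.atMost_Suc)
  also have "\<dots> = (\<Sum>k\<le>Suc N. \<phi> (\<delta>1 (G $ k)) * z ^ k * e1) + (\<Sum>k\<le>Suc N. \<phi> (\<delta>2 (G $ k)) * z ^ k * e2)
     + (\<Sum>k\<le>Suc N. of_nat k * \<phi> (G $ k) * z ^ (k - 1) * D z)"
    unfolding sum.distrib[symmetric] by (intro sum.cong) (simp_all add: \<phi> algebra_simps)
  also have "\<dots> = ?S (Suc N) (fps_map \<delta>1 G) * e1 + ?S (Suc N) (fps_map \<delta>2 G) * e2
      + ?S N (fps_deriv G) * D z"
    unfolding sh[symmetric] by (simp only: sum_distrib_right fps_map_nth)
  finally have eq: "D (?S (Suc N) G) = ?S (Suc N) (fps_map \<delta>1 G) * e1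
    + ?S (Suc N) (fps_map \<delta>2 G) * e2 + ?S N (fps_deriv G) * D z" .
  have a: "fps_X ^ Suc N dvd D (?s G) - D (?S (Suc N) G)"
    using fps_derivation_dvd[OF D fps_subst_dvd[OF z, of "Suc N" \<phi> G]]
    by (simp add: fps_derivation_diff[OF D] del: sum.atMost_Suc)
  have b: "fps_X ^ Suc N dvd ?s F - ?S (Suc N) F" for F
    by (rule dvd_trans[OF _ fps_subst_dvd[OF z]]) (rule le_imp_power_dvd, simp)
  have eq2: "D (?s G) - (?s (fps_map \<delta>1 G) * e1 + ?s (fps_map \<delta>2 G) * e2 + ?s (fps_deriv G) * D z)
    = (D (?s G) - D (?S (Suc N) G)) - (?s (fps_map \<delta>1 G) - ?S (Suc N) (fps_map \<delta>1 G)) * e1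
      - (?s (fps_map \<delta>2 G) - ?S (Suc N) (fps_map \<delta>2 G)) * e2
      - (?s (fps_deriv G) - ?S N (fps_deriv G)) * D z"
    unfolding eq by (simp add: algebra_simps del: sum.atMost_Suc)
  show "fps_X ^ Suc N dvd D (?s G) - (?s (fps_map \<delta>1 G) * e1 + ?s (fps_map \<delta>2 G) * e2 + ?s (fps_deriv G) * D z)"
    unfolding eq2 by (intro dvd_diff dvd_mult2 a b fps_subst_dvd[OF z])
qed

text \<open>First-order Taylor formula: \<open>e\<close> displaces the outer variable, while
  \<open>d\<close> and \<open>\<delta>\<close> are displacement and derivative for an inner one, so
  that the lemma can be fed with its own conclusion. The products \<open>e * e\<close> and
  \<open>d * e\<close> have order \<open>2 * s\<close>, where the remainder starts.\<close>

lemma fps_subst_taylor: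
  assumes hom: "is_ring_hom \<phi>" and hom': "is_ring_hom \<phi>'"
    and z: "z $ 0 = 0" and d: "fps_X ^ s dvd d" and e: "fps_X ^ s dvd e" and s: "s \<ge> 1"
    and \<phi>: "\<And>b. fps_X ^ (2 * s) dvd \<phi>' b - (\<phi> b + d * \<phi> (\<delta> b))"
  shows "fps_X ^ (2 * s) dvd fps_subst \<phi>' (z + e) G -
     (fps_subst \<phi> z G + d * fps_subst \<phi> z (fps_map \<delta> G) + e * fps_subst \<phi> z (fps_deriv G))"
proof -
  obtain N where N: "2 * s = Suc N" using s by (metis Suc_pred' mult_pos_pos pos2 less_le_trans zero_less_one)
  have e0: "e $ 0 = 0" using e s by (auto simp: fps_X_power_dvd_iff)
  have ze: "(z + e) $ 0 = 0" using z e0 by simp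
  let ?S = "\<lambda>N F. \<Sum>k\<le>N. \<phi> (F $ k) * z ^ k"
  let ?s = "fps_subst \<phi> z"
  have ee: "fps_X ^ (2 * s) dvd e * e" and de: "fps_X ^ (2 * s) dvd d * e"
    using mult_dvd_mono[OF e e] mult_dvd_mono[OF d e] by (simp_all add: power_add[symmetric] mult_2)
  have pow: "fps_X ^ (2 * s) dvd (z + e) ^ k - (z ^ k + of_nat k * z ^ (k - 1) * e)" for k
  proof (induction k)
    case (Suc k)
    have zz: "of_nat k * z ^ k = of_nat k * (z ^ (k - 1) * z)" by (cases k) (simp_all add: mult.commute)
    have "(z + e) ^ Suc k - (z ^ Suc k + of_nat (Suc k) * z ^ (Suc k - 1) * e)
      = ((z + e) ^ k - (z ^ k + of_nat k * z ^ (k - 1) * e)) * (z + e)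
        + of_nat k * z ^ (k - 1) * (e * e) + e * (of_nat k * (z ^ (k - 1) * z) - of_nat k * z ^ k)"
      by (simp add: algebra_simps)
    then show ?case using Suc ee zz by simp
  qed simp
  have tm: "fps_X ^ (2 * s) dvd \<phi>' b * (z + e) ^ k
     - (\<phi> b * z ^ k + d * (\<phi> (\<delta> b) * z ^ k) + e * (of_nat k * \<phi> b * z ^ (k - 1)))" for b k
  proof -
    have "\<phi>' b * (z + e) ^ k
     - (\<phi> b * z ^ k + d * (\<phi> (\<delta> b) * z ^ k) + e * (of_nat k * \<phi> b * z ^ (k - 1)))
     = (\<phi>' b - (\<phi> b + d * \<phi> (\<delta> b))) * (z + e) ^ k
      + (\<phi> b + d * \<phi> (\<delta> b)) * ((z + e) ^ k - (z ^ k + of_nat k * z ^ (k - 1) * e))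
      + (d * e) * (\<phi> (\<delta> b) * of_nat k * z ^ (k - 1))"
      by (simp add: algebra_simps)
    then show ?thesis using \<phi>[of b] pow[of k] de by simp
  qed
  have sh: "(\<Sum>k\<le>Suc N. of_nat k * \<phi> (G $ k) * z ^ (k - 1)) = ?S N (fps_deriv G)"
    by (subst sum.atMost_Suc_shift)
      (simp add: is_ring_hom_mult[OF hom] is_ring_hom_add[OF hom] is_ring_hom_1[OF hom]
        is_ring_hom_of_nat[OF hom] del: of_nat_Suc sum.atMost_Suc)
  have "fps_X ^ (2 * s) dvd (\<Sum>k\<le>Suc N. \<phi>' (G $ k) * (z + e) ^ k
     - (\<phi> (G $ k) * z ^ k + d * (\<phi> (\<delta> (G $ k)) * z ^ k) + e * (of_nat k * \<phi> (G $ k) * z ^ (k - 1))))"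
    by (intro dvd_sum tm)
  also have "(\<Sum>k\<le>Suc N. \<phi>' (G $ k) * (z + e) ^ k
     - (\<phi> (G $ k) * z ^ k + d * (\<phi> (\<delta> (G $ k)) * z ^ k) + e * (of_nat k * \<phi> (G $ k) * z ^ (k - 1))))
    = (\<Sum>k\<le>Suc N. \<phi>' (G $ k) * (z + e) ^ k) - (?S (Suc N) G + d * ?S (Suc N) (fps_map \<delta> G) + e * ?S N (fps_deriv G))"
    unfolding sh[symmetric] by (simp only: sum_subtractf sum.distrib sum_distrib_left fps_map_nth)
  finally have main: "fps_X ^ (2 * s) dvd (\<Sum>k\<le>Suc N. \<phi>' (G $ k) * (z + e) ^ k)
     - (?S (Suc N) G + d * ?S (Suc N) (fps_map \<delta> G) + e * ?S N (fps_deriv G))" .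
  have c: "fps_X ^ (2 * s) dvd fps_subst \<phi>' (z + e) G - (\<Sum>k\<le>Suc N. \<phi>' (G $ k) * (z + e) ^ k)"
    unfolding N by (rule dvd_trans[OF _ fps_subst_dvd[OF ze]]) (rule le_imp_power_dvd, simp)
  have b: "fps_X ^ (2 * s) dvd ?s F - ?S (Suc N) F" for F
    unfolding N by (rule dvd_trans[OF _ fps_subst_dvd[OF z]]) (rule le_imp_power_dvd, simp)
  have b': "fps_X ^ (2 * s) dvd ?s F - ?S N F" for F
    unfolding N by (rule fps_subst_dvd[OF z])
  have "fps_subst \<phi>' (z + e) G - (?s G + d * ?s (fps_map \<delta> G) + e * ?s (fps_deriv G))
    = (fps_subst \<phi>' (z + e) G - (\<Sum>k\<le>Suc N. \<phi>' (G $ k) * (z + e) ^ k))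
      + ((\<Sum>k\<le>Suc N. \<phi>' (G $ k) * (z + e) ^ k)
     - (?S (Suc N) G + d * ?S (Suc N) (fps_map \<delta> G) + e * ?S N (fps_deriv G)))
     - (?s G - ?S (Suc N) G) - d * (?s (fps_map \<delta> G) - ?S (Suc N) (fps_map \<delta> G))
     - e * (?s (fps_deriv G) - ?S N (fps_deriv G))"
    by (simp add: algebra_simps del: sum.atMost_Suc)
  moreover have "fps_X ^ (2 * s) dvd \<dots>"
    by (intro dvd_add dvd_diff dvd_mult main b b' c)
  ultimately show ?thesis by (simp only:)
qed

text \<open>The variable \<open>x\<close> stays \<open>fps_X\<close> and only coefficients are
  mapped by \<open>c\<close>: the identity gives series along a curve
  \<open>(x, y(x), z(x))\<close>, and \<open>cemb\<close> gives series whose coefficients are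
  polynomials in the blow-up parameters.\<close>

definition subst3 :: "(real \<Rightarrow> 'a::comm_ring_1) \<Rightarrow> 'a fps \<Rightarrow> 'a fps \<Rightarrow> fps3 \<Rightarrow> 'a fps" where
  "subst3 c y z = fps_subst (fps_subst (fps_map c) y) z"

lemma coeff3_dx3: "coeff3 (dx3 G) i j k = real (Suc i) * coeff3 G (Suc i) j k"
  and coeff3_dy3: "coeff3 (dy3 G) i j k = real (Suc j) * coeff3 G i (Suc j) k"
  and coeff3_dz3: "coeff3 (dz3 G) i j k = real (Suc k) * coeff3 G i j (Suc k)"
proof -
  have of_nat_nth: "(of_nat m * f) $ l = of_nat m * f $ l" for m l and f :: "'b::comm_ring_1 fps"
    by (metis fps_mult_left_const_nth fps_of_nat)
  show "coeff3 (dx3 G) i j k = real (Suc i) * coeff3 G (Suc i) j k"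
    by (simp add: coeff3_def dx3_def)
  show "coeff3 (dy3 G) i j k = real (Suc j) * coeff3 G i (Suc j) k"
    by (simp add: coeff3_def dy3_def of_nat_nth del: of_nat_Suc)
  show "coeff3 (dz3 G) i j k = real (Suc k) * coeff3 G i j (Suc k)"
    by (simp add: coeff3_def dz3_def of_nat_nth del: of_nat_Suc)
qed

lemma fps3_eqI: "(\<And>i j k. coeff3 G i j k = coeff3 H i j k) \<Longrightarrow> G = H"
  by (intro fps_ext) (simp add: coeff3_def)

lemma dx3_conv: "dx3 G = fps_map (fps_map fps_deriv) G"
  and dy3_conv: "dy3 G = fps_map fps_deriv G"
  by (rule fps3_eqI, simp add: dx3_def dy3_def coeff3_def)+

locale subst3_ring_hom =
  fixes c :: "real \<Rightarrow> 'a::comm_ring_1" and y z :: "'a fps"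
  assumes hom: "is_ring_hom c" and y0: "y $ 0 = 0" and z0: "z $ 0 = 0"
begin

lemma hom1: "is_ring_hom (fps_map c)"
  using hom by (rule is_ring_hom_fps_map)

lemma hom2: "is_ring_hom (fps_subst (fps_map c) y)"
  using hom1 y0 by (rule is_ring_hom_fps_subst)

lemma hom3: "is_ring_hom (subst3 c y z)"
  unfolding subst3_def using hom2 z0 by (rule is_ring_hom_fps_subst)

lemmas add = is_ring_hom_add[OF hom3] and mult = is_ring_hom_mult[OF hom3]
  and minus = is_ring_hom_minus[OF hom3] and diff = is_ring_hom_diff[OF hom3]
  and zero = is_ring_hom_0[OF hom3]

lemma const: "subst3 c y z (const3 r) = fps_const (c r)"
  by (simp add: subst3_def const3_def fps_subst_const[OF hom2] fps_subst_const[OF hom1] fps_map_const hom)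

lemma Y: "subst3 c y z Y3 = y"
  by (simp add: subst3_def Y3_def fps_subst_const[OF hom2] fps_subst_X[OF hom1 y0])

lemma Z: "subst3 c y z Z3 = z"
  by (simp add: subst3_def Z3_def fps_subst_X[OF hom2 z0])

lemma nth_0: "subst3 c y z G $ 0 = c (coeff3 G 0 0 0)"
  by (simp add: subst3_def fps_subst_def coeff3_def)

text \<open>Two passes of \<open>fps_derivation_subst\<close>, for \<open>y\<close> and then for
  \<open>z\<close>. The derivative \<open>e\<close> of \<open>x\<close> is 1 for
  \<open>fps_deriv\<close> and 0 for the derivatives in the parameters.\<close>

lemma derivation:
  assumes D: "fps_derivation D" and c: "\<And>g. D (fps_map c g) = fps_map c (fps_deriv g) * e"
  shows "D (subst3 c y z G) =
    subst3 c y z (dx3 G) * e + subst3 c y z (dy3 G) * D y + subst3 c y z (dz3 G) * D z"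
proof -
  have 1: "D (fps_subst (fps_map c) y g) =
      fps_subst (fps_map c) y (fps_map fps_deriv g) * e
    + fps_subst (fps_map c) y (fps_deriv g) * D y" for g
    using fps_derivation_subst[OF D hom1 y0, of fps_deriv e "\<lambda>_. 0" 0 g] c by simp
  show ?thesis
    using fps_derivation_subst[OF D hom2 z0, of "fps_map fps_deriv" e fps_deriv "D y" G] 1
    by (simp add: subst3_def dx3_conv dy3_conv dz3_def)
qed

lemma taylor:
  assumes "fps_X ^ s dvd d" "fps_X ^ s dvd e" "s \<ge> 1"
  shows "fps_X ^ (2 * s) dvd subst3 c (y + d) (z + e) G
    - (subst3 c y z G + d * subst3 c y z (dy3 G) + e * subst3 c y z (dz3 G))"
proof -
  have d0: "(y + d) $ 0 = 0" using y0 assms by (auto simp: fps_X_power_dvd_iff)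
  have hom2': "is_ring_hom (fps_subst (fps_map c) (y + d))"
    using hom1 d0 by (rule is_ring_hom_fps_subst)
  \<comment> \<open>\<open>x\<close> is not displaced, so the inner increment of this pass is
    0.\<close>
  have 1: "fps_X ^ (2 * s) dvd fps_subst (fps_map c) (y + d) b
    - (fps_subst (fps_map c) y b + d * fps_subst (fps_map c) y (fps_deriv b))" for b
    using fps_subst_taylor[OF hom1 hom1 y0 _ assms(1) assms(3), of 0 "\<lambda>_. 0" b] by simp
  show ?thesis
    using fps_subst_taylor[OF hom2 hom2' z0 assms(1,2,3) 1, of G]
    by (simp add: subst3_def dy3_conv dz3_def)
qed

end

lemma fps_map_subst:
  assumes c: "is_ring_hom c" and z: "z $ 0 = 0"
  shows "fps_map c (fps_subst \<phi> z G) = fps_subst (\<lambda>b. fps_map c (\<phi> b)) (fps_map c z) G"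
proof (rule fps_ext)
  fix m
  note h = is_ring_hom_fps_map[OF c]
  have "fps_map c (fps_subst \<phi> z G) $ m = fps_map c (\<Sum>k\<le>m. \<phi> (G $ k) * z ^ k) $ m"
    by (simp add: fps_subst_def)
  then show "fps_map c (fps_subst \<phi> z G) $ m = fps_subst (\<lambda>b. fps_map c (\<phi> b)) (fps_map c z) G $ m"
    by (simp add: fps_subst_def is_ring_hom_sum[OF h] is_ring_hom_mult[OF h] is_ring_hom_power[OF h]
        del: fps_map_nth)
qed

text \<open>Lets the base curve be substituted over the reals, where its jets are known, and the
  result be embedded afterwards.\<close>

lemma fps_map_subst3:
  assumes c: "is_ring_hom c" and "y $ 0 = 0" "z $ 0 = 0"
  shows "fps_map c (subst3 (\<lambda>x. x) y z G) = subst3 c (fps_map c y) (fps_map c z) G"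
  by (simp add: subst3_def fps_map_subst assms)

text \<open>The cube of exponents is the one of \<open>fps3_remainder\<close>, so that the formal
  and the analytic truncations coincide.\<close>

lemma (in subst3_ring_hom) nth_expand:
  assumes "m < D"
  shows "subst3 c y z G $ m = (\<Sum>k\<le>D. \<Sum>j\<le>D. \<Sum>i\<le>D.
    fps_const (c (coeff3 G i j k)) * fps_X ^ i * y ^ j * z ^ k) $ m"
proof -
  let ?h2 = "fps_subst (fps_map c) y"
  have le: "D = Suc (D - 1)" using assms by simp
  have X: "fps_X ^ D dvd fps_map c g - (\<Sum>i\<le>D. fps_const (c (g $ i)) * fps_X ^ i)" for g
    unfolding fps_X_power_dvd_iff
    by (auto simp: fps_sum_nth fps_X_power_nth if_distrib[of "\<lambda>x. _ * x"] cong: if_cong)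
  have Y: "fps_X ^ D dvd ?h2 g - (\<Sum>j\<le>D. (\<Sum>i\<le>D. fps_const (c (g $ j $ i)) * fps_X ^ i) * y ^ j)" for g
  proof -
    have "fps_X ^ D dvd (?h2 g - (\<Sum>j\<le>D. fps_map c (g $ j) * y ^ j))
      + (\<Sum>j\<le>D. (fps_map c (g $ j) - (\<Sum>i\<le>D. fps_const (c (g $ j $ i)) * fps_X ^ i)) * y ^ j)"
      by (intro dvd_add dvd_sum dvd_mult2 X dvd_trans[OF _ fps_subst_dvd[OF y0]] le_imp_power_dvd) simp
    then show ?thesis by (simp add: left_diff_distrib sum_subtractf)
  qed
  have "fps_X ^ D dvd (subst3 c y z G - (\<Sum>k\<le>D. ?h2 (G $ k) * z ^ k))
      + (\<Sum>k\<le>D. (?h2 (G $ k)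
          - (\<Sum>j\<le>D. (\<Sum>i\<le>D. fps_const (c (G $ k $ j $ i)) * fps_X ^ i) * y ^ j)) * z ^ k)"
    unfolding subst3_def
    by (intro dvd_add dvd_sum dvd_mult2 Y dvd_trans[OF _ fps_subst_dvd[OF z0]] le_imp_power_dvd) simp
  then have "fps_X ^ D dvd subst3 c y z G
      - (\<Sum>k\<le>D. \<Sum>j\<le>D. \<Sum>i\<le>D. fps_const (c (coeff3 G i j k)) * fps_X ^ i * y ^ j * z ^ k)"
    by (simp add: left_diff_distrib sum_subtractf sum_distrib_right coeff3_def)
  then show ?thesis
    unfolding fps_X_power_dvd_iff using assms by (auto simp del: fps_sum_nth)
qed

lemma fps_derivation_deriv: "fps_derivation (fps_deriv :: 'a::comm_ring_1 fps \<Rightarrow> _)"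
  unfolding fps_derivation_def fps_X_power_dvd_iff by (auto simp: algebra_simps)

lemma fps_derivation_map:
  fixes d :: "'a::comm_ring_1 \<Rightarrow> 'a"
  assumes "\<And>a b. d (a + b) = d a + d b" "\<And>a b. d (a * b) = d a * b + a * d b"
  shows "fps_derivation (fps_map d)"
proof -
  have 0: "d 0 = 0" using assms(1)[of 0 0] by simp
  have s: "d (sum f A) = (\<Sum>x\<in>A. d (f x))" for f and A :: "nat set"
    by (induction A rule: infinite_finite_induct) (simp_all add: assms(1) 0)
  have "fps_map d (f * g) = fps_map d f * g + f * fps_map d g" for f g :: "'a fps"
    by (rule fps_ext) (simp add: fps_mult_nth s assms(2) sum.distrib)
  then show ?thesis
    unfolding fps_derivation_def fps_X_power_dvd_iff by (auto simp: fps_eq_iff assms(1) 0)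
qed

section \<open>Blowing up a formal first integral\<close>

text \<open>
  The discriminant condition makes \<open>D = n u\<^sup>2 - b u - a\<close> have no real root. Comparing the powers
  of \<open>D\<close> dividing both terms shows that \<open>D\<close> divides a polynomial of degree at most one, which
  vanishes only for \<open>b = 0\<close>.
\<close>

lemma quasi_homogeneous_integral_zero:
  fixes g :: "real poly" and a b :: real and n N :: nat
  assumes eq: "of_nat N * [:0, 1:] * g + [:a, b, - real n:] * pderiv g = 0"
    and N: "N > 0" and n: "n > 0" and b: "b \<noteq> 0" and disc: "b\<^sup>2 + 4 * a * real n < 0"
  shows "g = 0"
proof (rule ccontr)
  assume g: "g \<noteq> 0"
  define D where "D = [:- a, - b, real n:]"
  have deg: "degree D = 2" using n by (simp add: D_def)
  then have D0: "D \<noteq> 0" by auto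
  \<comment> \<open>Completing the square: at a root \<open>t\<close> of \<open>D\<close>, the
    square of \<open>2 * n * t - b\<close> equals the negative discriminant.\<close>
  have pos: "poly D t \<noteq> 0" for t
  proof
    assume "poly D t = 0"
    then have "a = t * (t * real n - b)" by (simp add: D_def)
    moreover have "(2 * real n * t - b)\<^sup>2 = b\<^sup>2 + 4 * (t * (t * real n - b)) * real n"
      by (simp add: power2_eq_square algebra_simps)
    ultimately have "(2 * real n * t - b)\<^sup>2 = b\<^sup>2 + 4 * a * real n" by simp
    with disc show False by (metis not_less zero_le_power2)
  qed
  \<comment> \<open>The largest power of \<open>D\<close> is split off by descent on the degree, as
    \<open>degree D = 2\<close>.\<close>
  have "\<exists>m k. f = D ^ m * k \<and> \<not> D dvd k" if "f \<noteq> 0" for f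
    using that
  proof (induction "degree f" arbitrary: f rule: less_induct)
    case less
    show ?case
    proof (cases "D dvd f")
      case True
      then obtain f' where f': "f = D * f'" by (elim dvdE)
      with less.prems have "f' \<noteq> 0" "degree f' < degree f"
        using deg D0 by (auto simp: degree_mult_eq)
      then obtain m k where "f' = D ^ m * k \<and> \<not> D dvd k" using less.hyps by blast
      then show ?thesis unfolding f' by (intro exI[of _ "Suc m"] exI[of _ k]) (simp add: mult.assoc)
    next
      case False
      then show ?thesis by (intro exI[of _ 0] exI[of _ f]) simp
    qed
  qed
  then obtain m k where k: "g = D ^ m * k" "\<not> D dvd k" using g by blast
  define l where "l = of_nat N * [:0, 1:] - of_nat m * pderiv D"
  have D': "[:a, b, - real n:] = - D" by (simp add: D_def)
  have pm: "D * pderiv (D ^ m) = of_nat m * D ^ m * pderiv D"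
    by (induction m) (simp_all add: pderiv_mult algebra_simps)
  have "of_nat N * [:0, 1:] * g + [:a, b, - real n:] * pderiv g
      = of_nat N * [:0, 1:] * D ^ m * k - (D * pderiv (D ^ m)) * k - D * D ^ m * pderiv k"
    unfolding D' k(1) pderiv_mult minus_mult_left[symmetric] by algebra
  also have "\<dots> = D ^ m * (l * k - D * pderiv k)"
    unfolding pm l_def by algebra
  finally have "D ^ m * (l * k - D * pderiv k) = 0" using eq by simp
  then have "l * k = D * pderiv k"
    using D0 by simp
  then have dvd: "D dvd l * k" by simp
  have l: "l = [:real m * b, real N - 2 * real m * real n:]"
    by (simp add: l_def D_def pderiv_pCons of_nat_poly)
  show False
  \<comment> \<open>If the slope of \<open>l\<close> vanishes, \<open>N = 2 * m * n\<close> forces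
    \<open>m \<noteq> 0\<close>, and \<open>l\<close> is the nonzero constant \<open>m * b\<close>.
    Otherwise \<open>l\<close> has a single root \<open>t\<close>.\<close>
  proof (cases "real N - 2 * real m * real n = 0")
    case True
    then have "m \<noteq> 0" using N by (cases m) auto
    then have "is_unit l" using b True by (simp add: l is_unit_pCons_iff)
    then show False using dvd k(2) by (metis dvd_mult_unit_iff' )
  next
    case False
    define q where "q = real N - 2 * real m * real n"
    define t where "t = - (real m * b) / q"
    have lq: "l = [:q:] * [:- t, 1:]" using False by (simp add: l q_def t_def)
    \<comment> \<open>Modulo the factor \<open>u - t\<close> of \<open>l\<close>, the polynomial
      \<open>D\<close> is the nonzero constant \<open>D(t)\<close>; so \<open>D dvd l * k\<close>
      passes to \<open>D dvd k\<close>.\<close>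
    have "[:- t, 1:] dvd D - [:poly D t:]" by (simp add: poly_eq_0_iff_dvd[symmetric])
    then obtain w where w: "D - [:poly D t:] = [:- t, 1:] * w" by (elim dvdE)
    have "[:q:] * [:poly D t:] * k = [:q:] * D * k - [:q:] * (D - [:poly D t:]) * k"
      by (simp only: algebra_simps)
    also have "\<dots> = D * ([:q:] * k) - l * k * w"
      unfolding w lq by (simp only: algebra_simps)
    finally have "smult (q * poly D t) k = D * ([:q:] * k) - l * k * w" by (simp add: mult.commute)
    moreover have "D dvd D * ([:q:] * k) - l * k * w"
      using dvd by (metis dvd_diff dvd_mult2 dvd_triv_left)
    ultimately have "D dvd smult (q * poly D t) k" by simp
    then show False using k(2) False pos[of t] by (simp add: q_def dvd_smult_iff)
  qed
qed

text \<open>In \<open>real poly poly\<close> the outer variable is \<open>v\<close> and the inner one is \<open>u\<close>.\<close>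

abbreviation cemb :: "real \<Rightarrow> real poly poly" where "cemb r \<equiv> [:[:r:]:]"

abbreviation Uc :: "real poly poly" where "Uc \<equiv> [:[:0, 1:]:]"

abbreviation Vc :: "real poly poly" where "Vc \<equiv> [:0, 1:]"

lemma is_ring_hom_cemb: "is_ring_hom cemb"
  by (simp add: is_ring_hom_def one_pCons)

lemma is_ring_hom_coeff_0: "is_ring_hom (\<lambda>p :: 'a::comm_ring_1 poly. coeff p 0)"
  by (simp add: is_ring_hom_def coeff_mult)

lemma map_poly_pderiv_add: "map_poly pderiv (p + q) = map_poly pderiv p + map_poly pderiv q"
  for p q :: "real poly poly"
  by (rule poly_eqI) (simp add: coeff_map_poly pderiv_add)

lemma map_poly_pderiv_mult: "map_poly pderiv (p * q) = map_poly pderiv p * q + p * map_poly pderiv q"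
  for p q :: "real poly poly"
  by (rule poly_eqI)
    (simp add: coeff_map_poly coeff_mult higher_pderiv_sum[of 1, simplified] pderiv_mult sum.distrib,
      simp add: ac_simps)

lemma fps_derivation_du: "fps_derivation (fps_map (map_poly (pderiv :: real poly \<Rightarrow> _)))"
  by (rule fps_derivation_map[OF map_poly_pderiv_add map_poly_pderiv_mult])

lemma fps_derivation_dv: "fps_derivation (fps_map (pderiv :: real poly poly \<Rightarrow> _))"
  by (rule fps_derivation_map) (simp_all add: pderiv_add pderiv_mult mult.commute)

text \<open>
  The lowest coefficient of \<open>K\<close> does not depend on \<open>v\<close>, because \<open>vd = - lam * v + \<dots>\<close>. Setting
  \<open>v = 0\<close> and comparing coefficients \<open>n - 1\<close> orders higher gives the equation of a quasi-homogeneous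
  first integral.
\<close>

lemma blown_up_integral_zero:
  fixes K xd ud vd :: "real poly poly fps" and a b lam :: real
  assumes n: "n \<ge> 2" and lam: "lam \<noteq> 0" and b: "b \<noteq> 0" and disc: "b\<^sup>2 + 4 * a * real n < 0"
    and K0: "K $ 0 = 0"
    and eq: "fps_X ^ n * xd * fps_deriv K + ud * fps_map (map_poly pderiv) K
      + vd * fps_map pderiv K = 0"
    and xd: "xd = fps_const Uc + fps_X * q1 + fps_const Vc * q2"
    and ud: "ud = fps_X ^ (n - 1) * fps_const [:[:a, b, - real n:]:]
      + fps_X ^ n * q3 + fps_X * fps_const Vc * q4"
    and vd: "vd = - fps_const (cemb lam * Vc) + fps_X * fps_const Vc * q5 + fps_X ^ n * q6"
  shows "K = 0"
proof (rule ccontr)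
  assume K: "K \<noteq> 0"
  define N where "N = subdegree K"
  have KN: "K $ N \<noteq> 0" using K by (simp add: N_def)
  have N: "N > 0" using KN K0 by (cases N) auto
  obtain N' where N': "N = Suc N'" using N by (cases N) auto
  obtain n' where n': "n = Suc (Suc n')" using n by (metis add_2_eq_Suc le_Suc_ex)
  have ord: "fps_X ^ N dvd K" by (auto simp: fps_X_power_dvd_iff N_def nth_less_subdegree_zero)
  then obtain L where L: "K = fps_X ^ N * L" by (elim dvdE)
  have L0: "L $ 0 = K $ N" by (simp add: L fps_X_power_mult_nth)
  let ?du = "fps_map (map_poly pderiv) :: real poly poly fps \<Rightarrow> _"
  let ?dv = "fps_map pderiv :: real poly poly fps \<Rightarrow> _"
  have duL: "?du K = fps_X ^ N * ?du L" and dvL: "?dv K = fps_X ^ N * ?dv L"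
    by (auto simp: L fps_eq_iff fps_X_power_mult_nth)
  \<comment> \<open>The weight \<open>N\<close> of the final equation enters here, from
    differentiating \<open>fps_X ^ N\<close>.\<close>
  have dL: "fps_deriv K = fps_X ^ N' * (of_nat N * L + fps_X * fps_deriv L)"
    unfolding L N' fps_deriv_mult fps_deriv_power' by (simp add: algebra_simps del: of_nat_Suc)
  have Xn: "fps_X ^ n = fps_X * fps_X * fps_X ^ n'" "fps_X ^ (n - 1) = fps_X * fps_X ^ n'"
    and XN: "fps_X ^ N = fps_X * fps_X ^ N'"
    by (simp_all add: n' N' mult.assoc)
  have "fps_X ^ N * (fps_X * fps_X ^ n' * xd * (of_nat N * L + fps_X * fps_deriv L)
      + ud * ?du L + vd * ?dv L) = 0"
    using eq unfolding duL dvL dL Xn XN by (simp add: algebra_simps)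
  then have eqL: "fps_X * fps_X ^ n' * xd * (of_nat N * L + fps_X * fps_deriv L)
      + ud * ?du L + vd * ?dv L = 0"
    by simp
  \<comment> \<open>As \<open>n \<ge> 2\<close>, only \<open>- lam * v\<close> survives at order
    zero.\<close>
  have "ud $ 0 = 0" "vd $ 0 = - (cemb lam * Vc)"
    unfolding ud vd Xn by (simp_all add: mult.assoc)
  with arg_cong[OF eqL, of "\<lambda>f. f $ 0"] have "cemb lam * Vc * pderiv (L $ 0) = 0"
    by (simp add: mult.assoc)
  with lam have "pderiv (L $ 0) = 0" by simp
  then have deg: "degree (L $ 0) = 0" by (simp add: pderiv_eq_0_iff)
  then obtain g where g: "L $ 0 = [:g:]" by (rule degree_eq_zeroE)
  have g0: "g \<noteq> 0" using KN g L0 by auto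
  have dv0: "fps_X dvd ?dv L" by (simp add: fps_X_dvd_iff g pderiv_pCons)
  then obtain M where M: "?dv L = fps_X * M" by (elim dvdE)
  \<comment> \<open>Setting \<open>v = 0\<close> removes the terms with \<open>q2\<close>,
    \<open>q4\<close> and \<open>q5\<close>. The \<open>q4\<close> term has only a factor
    \<open>fps_X\<close> and could otherwise enter at or below order \<open>n - 1\<close>.\<close>
  let ?e = "fps_map (\<lambda>p :: real poly poly. coeff p 0)"
  note e = is_ring_hom_fps_map[OF is_ring_hom_coeff_0, where 'b = "real poly"]
  have eX: "?e fps_X = fps_X" by (rule fps_map_X[OF is_ring_hom_coeff_0])
  have eC: "?e (fps_const p) = fps_const (coeff p 0)" for p
    by (rule fps_map_const[OF is_ring_hom_coeff_0])
  note es = is_ring_hom_add[OF e] is_ring_hom_mult[OF e] is_ring_hom_power[OF e]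
    is_ring_hom_minus[OF e] is_ring_hom_of_nat[OF e] is_ring_hom_0[OF e] eX eC
  have exd: "?e xd = fps_const [:0, 1:] + fps_X * ?e q1"
    unfolding xd by (simp add: es)
  have eud: "?e ud = fps_X * fps_X ^ n' * (fps_const [:a, b, - real n:] + fps_X * ?e q3)"
    unfolding ud Xn by (simp add: es algebra_simps)
  have evd: "?e vd = fps_X * fps_X * fps_X ^ n' * ?e q6"
    unfolding vd Xn by (simp add: es coeff_mult)
  have "fps_X * fps_X ^ n' * ((fps_const [:0, 1:] + fps_X * ?e q1) * (of_nat N * ?e L + fps_X * ?e (fps_deriv L))
    + (fps_const [:a, b, - real n:] + fps_X * ?e q3) * ?e (?du L) + fps_X * ?e q6 * (fps_X * ?e M)) = 0"
    using arg_cong[OF eqL, of ?e] unfolding M es exd eud evd by (simp add: algebra_simps)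
  then have "(fps_const [:0, 1:] + fps_X * ?e q1) * (of_nat N * ?e L + fps_X * ?e (fps_deriv L))
    + (fps_const [:a, b, - real n:] + fps_X * ?e q3) * ?e (?du L) + fps_X * ?e q6 * (fps_X * ?e M) = 0"
    by simp
  from arg_cong[OF this, of "\<lambda>f. f $ 0"]
  have "[:0, 1:] * (of_nat N * g) + [:a, b, - real n:] * pderiv g = 0"
    by (simp add: mult.assoc g coeff_map_poly fps_of_nat[symmetric] del: fps_of_nat)
  then have "of_nat N * [:0, 1:] * g + [:a, b, - real n:] * pderiv g = 0"
    by (simp add: mult_ac)
  from quasi_homogeneous_integral_zero[OF this N _ b disc] n g0 show False by simp
qed

section \<open>Blow-up coordinates around the curve\<close>

lemma is_ring_hom_id: "is_ring_hom (\<lambda>x. x)"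
  by (simp add: is_ring_hom_def)

lemma jet3_1_zeroD:
  assumes "jet3 1 G = 0" "i + j + k \<le> 1"
  shows "coeff3 G i j k = 0"
proof -
  have "coeff3 (jet3 1 G) i j k = 0" using assms(1) by (simp add: coeff3_def)
  then show ?thesis using assms(2) by (simp add: jet3_def coeff3_def)
qed

text \<open>\<open>F\<close> and \<open>T\<close> locate the base curve; the tilt \<open>S\<close>
  is arbitrary here. The Jacobian in \<open>u\<close>, \<open>v\<close> is triangular with diagonal
  entries \<open>fps_X ^ n\<close>, so all partial derivatives can be recovered from the pull-back,
  and displacements of order \<open>n\<close> leave a Taylor remainder of order
  \<open>2 * n\<close>.\<close>

lemma blow_up:
  fixes F T S :: "real fps" and G :: fps3 and n :: nat
  defines "emb \<equiv> fps_map cemb" and "u \<equiv> fps_const Uc" and "v \<equiv> fps_const Vc"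
  defines "y \<equiv> emb F + fps_X ^ n * u" and "z \<equiv> emb T + fps_X ^ n * (emb S * u + v)"
  assumes F: "F $ 0 = 0" and T: "T $ 0 = 0" and n: "n \<ge> 1"
  shows blow_up_hom: "subst3_ring_hom cemb y z"
    and blow_up_deriv: "fps_deriv (subst3 cemb y z G) = subst3 cemb y z (dx3 G)
      + subst3 cemb y z (dy3 G) * (emb (fps_deriv F) + of_nat n * fps_X ^ (n - 1) * u)
      + subst3 cemb y z (dz3 G) * (emb (fps_deriv T)
          + of_nat n * fps_X ^ (n - 1) * (emb S * u + v) + fps_X ^ n * (emb (fps_deriv S) * u))"
    and blow_up_du: "fps_map (map_poly pderiv) (subst3 cemb y z G) =
      fps_X ^ n * (subst3 cemb y z (dy3 G) + emb S * subst3 cemb y z (dz3 G))"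
    and blow_up_dv: "fps_map pderiv (subst3 cemb y z G) = fps_X ^ n * subst3 cemb y z (dz3 G)"
    and blow_up_taylor: "fps_X ^ (2 * n) dvd subst3 cemb y z G
      - (emb (subst3 (\<lambda>x. x) F T G) + fps_X ^ n * u * emb (subst3 (\<lambda>x. x) F T (dy3 G))
          + fps_X ^ n * (emb S * u + v) * emb (subst3 (\<lambda>x. x) F T (dz3 G)))"
proof -
  interpret base: subst3_ring_hom cemb "emb F" "emb T"
    by standard (simp_all add: is_ring_hom_cemb emb_def F T)
  show "subst3_ring_hom cemb y z"
    using n by unfold_locales (simp_all add: is_ring_hom_cemb y_def z_def emb_def F T)
  then interpret subst3_ring_hom cemb y z .
  note der = fps_map_deriv[OF is_ring_hom_cemb, folded emb_def]
  note D = fps_derivation_deriv[where 'a = "real poly poly"]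
  show "fps_deriv (subst3 cemb y z G) = subst3 cemb y z (dx3 G)
      + subst3 cemb y z (dy3 G) * (emb (fps_deriv F) + of_nat n * fps_X ^ (n - 1) * u)
      + subst3 cemb y z (dz3 G) * (emb (fps_deriv T)
          + of_nat n * fps_X ^ (n - 1) * (emb S * u + v) + fps_X ^ n * (emb (fps_deriv S) * u))"
    by (subst derivation[OF D, of 1])
      (simp_all add: y_def z_def u_def v_def der fps_map_deriv[OF is_ring_hom_cemb] fps_deriv_power algebra_simps
         fps_of_nat del: fps_const_mult)
  \<comment> \<open>Powers of \<open>fps_X\<close> are written as embedded series, since the
    parameter derivatives kill everything embedded.\<close>
  have Xe: "fps_X ^ n = emb (fps_X ^ n)"
    unfolding emb_def
    by (simp add: is_ring_hom_power[OF is_ring_hom_fps_map[OF is_ring_hom_cemb]] fps_map_X[OF is_ring_hom_cemb])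
  have du0: "fps_map (map_poly pderiv) (emb g) = 0" for g
    by (simp add: emb_def fps_eq_iff map_poly_pCons pderiv_pCons)
  have dv0: "fps_map pderiv (emb g) = 0" for g
    by (simp add: emb_def fps_eq_iff pderiv_pCons)
  have duc: "fps_map (map_poly pderiv) u = 1" "fps_map (map_poly pderiv) v = 0"
    by (auto simp: u_def v_def fps_eq_iff map_poly_pCons pderiv_pCons one_pCons)
  have dvc: "fps_map pderiv u = 0" "fps_map pderiv v = 1"
    by (auto simp: u_def v_def fps_eq_iff pderiv_pCons one_pCons)
  note du = fps_derivation_du and dv = fps_derivation_dv
  have "fps_map (map_poly pderiv) y = fps_X ^ n" "fps_map (map_poly pderiv) z = fps_X ^ n * emb S"
    unfolding y_def z_def Xe
    by (simp_all add: fps_derivation_add[OF du] fps_derivation_mult[OF du] du0 duc)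
  then show "fps_map (map_poly pderiv) (subst3 cemb y z G) =
      fps_X ^ n * (subst3 cemb y z (dy3 G) + emb S * subst3 cemb y z (dz3 G))"
    by (subst derivation[OF du, of 0]) (simp_all add: du0[unfolded emb_def] algebra_simps)
  have "fps_map pderiv y = 0" "fps_map pderiv z = fps_X ^ n"
    unfolding y_def z_def Xe
    by (simp_all add: fps_derivation_add[OF dv] fps_derivation_mult[OF dv] dv0 dvc)
  then show "fps_map pderiv (subst3 cemb y z G) = fps_X ^ n * subst3 cemb y z (dz3 G)"
    by (subst derivation[OF dv, of 0]) (simp_all add: dv0[unfolded emb_def] algebra_simps)
  have "emb (subst3 (\<lambda>x. x) F T G) = subst3 cemb (emb F) (emb T) G" for G
    unfolding emb_def by (rule fps_map_subst3[OF is_ring_hom_cemb F T])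
  then show "fps_X ^ (2 * n) dvd subst3 cemb y z G
      - (emb (subst3 (\<lambda>x. x) F T G) + fps_X ^ n * u * emb (subst3 (\<lambda>x. x) F T (dy3 G))
          + fps_X ^ n * (emb S * u + v) * emb (subst3 (\<lambda>x. x) F T (dz3 G)))"
    using base.taylor[of n "fps_X ^ n * u" "fps_X ^ n * (emb S * u + v)" G] n
    unfolding y_def z_def by simp
qed

text \<open>A zero pull-back has zero derivatives; cancelling \<open>fps_X ^ n\<close> shows, in the
  order \<open>dz3\<close>, \<open>dy3\<close>, \<open>dx3\<close>, that the partial derivatives
  have zero pull-back too. By iteration the constant terms of all higher derivatives vanish, and
  these are the coefficients of \<open>H\<close> up to factorials.\<close>

lemma subst3_blow_up_eq_0:
  fixes F T S :: "real fps" and H :: fps3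
  assumes F: "F $ 0 = 0" and T: "T $ 0 = 0" and n: "n \<ge> 1"
  assumes 0: "subst3 cemb (fps_map cemb F + fps_X ^ n * fps_const Uc)
      (fps_map cemb T + fps_X ^ n * (fps_map cemb S * fps_const Uc + fps_const Vc)) H = 0"
  shows "H = 0"
proof -
  let ?s = "subst3 cemb (fps_map cemb F + fps_X ^ n * fps_const Uc)
      (fps_map cemb T + fps_X ^ n * (fps_map cemb S * fps_const Uc + fps_const Vc))"
  interpret subst3_ring_hom cemb "fps_map cemb F + fps_X ^ n * fps_const Uc"
      "fps_map cemb T + fps_X ^ n * (fps_map cemb S * fps_const Uc + fps_const Vc)"
    by (rule blow_up_hom[OF F T n])
  have m0: "fps_map (map_poly pderiv) 0 = (0 :: real poly poly fps)"
     "fps_map pderiv 0 = (0 :: real poly poly fps)" by (simp_all add: fps_eq_iff)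
  have z: "?s (dz3 G) = 0" if "?s G = 0" for G
    using blow_up_dv[OF F T n, of S G] that by (simp add: m0)
  have y: "?s (dy3 G) = 0" if "?s G = 0" for G
    using blow_up_du[OF F T n, of S G] that by (simp add: m0 z)
  have x: "?s (dx3 G) = 0" if "?s G = 0" for G
    using blow_up_deriv[OF F T n, of S G] that by (simp add: z y)
  have 1: "coeff3 G i 0 0 = 0" if "?s G = 0" for G i
    using that
  proof (induction i arbitrary: G)
    case 0
    then show ?case using nth_0[of G] by simp
  next
    case (Suc i)
    then show ?case using Suc.IH[OF x[OF Suc.prems]] by (simp add: coeff3_dx3 del: of_nat_Suc)
  qed
  have 2: "coeff3 G i j 0 = 0" if "?s G = 0" for G i j
    using that
  proof (induction j arbitrary: G)
    case (Suc j)
    then show ?case using Suc.IH[OF y[OF Suc.prems]] by (simp add: coeff3_dy3 del: of_nat_Suc)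
  qed (rule 1)
  have "coeff3 G i j k = 0" if "?s G = 0" for G i j k
    using that
  proof (induction k arbitrary: G)
    case (Suc k)
    then show ?case using Suc.IH[OF z[OF Suc.prems]] by (simp add: coeff3_dz3 del: of_nat_Suc)
  qed (rule 2)
  with 0 show ?thesis by (intro fps3_eqI) (simp add: coeff3_def)
qed

text \<open>
  \<open>F\<close> and \<open>T\<close> are the jets of the curve \<open>y + P = 0\<close> on the center manifold, \<open>S\<close> and \<open>U\<close> those of
  \<open>h\<^sub>y\<close> and \<open>h\<^sub>x\<close> along it.
\<close>

theorem no_formal_first_integral:
  fixes F T S U :: "real fps" and P Q R :: fps3 and a b lam :: real and n :: nat
  defines "s \<equiv> subst3 (\<lambda>x. x) F T"
  assumes n: "n \<ge> 2" and lam: "lam \<noteq> 0" and b: "b \<noteq> 0" and disc: "b\<^sup>2 + 4 * a * real n < 0"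
    and jets: "jet3 1 P = 0" "jet3 1 Q = 0" "jet3 1 R = 0"
    and F: "F $ 0 = 0" and T: "T $ 0 = 0" and S: "S $ 0 = 0"
    and e1: "fps_X ^ (2 * n) dvd F + s P"
    and e2: "fps_X ^ (2 * n) dvd - fps_const lam * T + s R"
    and e3: "fps_X ^ n dvd - fps_const lam * S + s (dy3 R) + s (dz3 R) * S
      - U * (1 + s (dy3 P) + s (dz3 P) * S) - S * (s (dy3 Q) + s (dz3 Q) * S)"
    and e4: "fps_X ^ n dvd - fps_const lam * U + s (dx3 R) + s (dz3 R) * U
      - U * (s (dx3 P) + s (dz3 P) * U) - S * (s (dx3 Q) + s (dz3 Q) * U)"
    and e5: "fps_X ^ (2 * n) dvd s Q - fps_const a * fps_X ^ (2 * n - 1)"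
    and e6: "fps_X ^ n dvd s (dx3 P) + s (dz3 P) * U + s (dy3 Q) + s (dz3 Q) * S
      - fps_const b * fps_X ^ (n - 1)"
  shows "\<not> formal_first_integral lam P Q R H"
proof
  assume H: "formal_first_integral lam P Q R H"
  interpret s: subst3_ring_hom "\<lambda>x. x" F T
    by standard (simp_all add: is_ring_hom_id F T)
  define F' T' S' where "F' = fps_deriv F" and "T' = fps_deriv T" and "S' = fps_deriv S"
  have chain: "fps_deriv (s G) = s (dx3 G) + s (dy3 G) * F' + s (dz3 G) * T'" for G
    using s.derivation[OF fps_derivation_deriv, of 1 G] by (simp add: s_def F'_def T'_def)
  have low: "s (dy3 P) $ 0 = 0" "s (dz3 P) $ 0 = 0" "s (dz3 Q) $ 0 = 0" "s (dz3 R) $ 0 = 0"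
    using jets by (simp_all add: s_def s.nth_0 coeff3_dy3 coeff3_dz3 jet3_1_zeroD)
  note dvd_der = fps_derivation_dvd[OF fps_derivation_deriv]
  obtain n' where n': "n = Suc (Suc n')" using n by (metis add_2_eq_Suc le_Suc_ex)
  have nn: "2 * n = Suc (Suc (n + n'))" by (simp add: n')
  have le: "fps_X ^ n dvd (fps_X ^ Suc (n + n') :: real fps)" "fps_X ^ n dvd (fps_X ^ (n + n') :: real fps)"
    by (simp_all add: le_imp_power_dvd del: power_Suc)
  have d1: "fps_X ^ n dvd F' + (s (dx3 P) + s (dy3 P) * F' + s (dz3 P) * T')"
    using dvd_trans[OF le(1) dvd_der[OF e1[unfolded nn]]] by (simp add: chain F'_def)
  have d2: "fps_X ^ n dvd - fps_const lam * T' + (s (dx3 R) + s (dy3 R) * F' + s (dz3 R) * T')"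
    using dvd_trans[OF le(1) dvd_der[OF e2[unfolded nn]]] by (simp add: chain T'_def)
  \<comment> \<open>\<open>Q\<close> has order \<open>2 * n - 1\<close> on the curve, so its
    derivative has order at least \<open>2 * n - 2\<close>, which is at least \<open>n\<close>
    because \<open>n \<ge> 2\<close>.\<close>
  have "fps_X ^ Suc (n + n') dvd s Q"
  proof -
    have "fps_X ^ Suc (n + n') dvd s Q - fps_const a * fps_X ^ (2 * n - 1)"
      using e5 unfolding nn by (rule dvd_trans[rotated]) (simp add: le_imp_power_dvd del: power_Suc)
    moreover have "fps_X ^ Suc (n + n') dvd fps_const a * fps_X ^ (2 * n - 1)"
      by (simp add: n' mult_2)
    ultimately have "fps_X ^ Suc (n + n') dvd s Q - fps_const a * fps_X ^ (2 * n - 1) + fps_const a * fps_X ^ (2 * n - 1)"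
      by (rule dvd_add)
    then show ?thesis by simp
  qed
  then have d5: "fps_X ^ n dvd s (dx3 Q) + s (dy3 Q) * F' + s (dz3 Q) * T'"
    using dvd_trans[OF le(2) dvd_der[of "n + n'" "s Q"]] by (simp add: chain)
  \<comment> \<open>Formally \<open>T' = h_x + h_y * F'\<close>, so \<open>W\<close> should be the
    jet of \<open>h_x\<close>. Asymptotic expansions cannot be differentiated term by term, so this
    has to come from the algebraic relations.\<close>
  define W where "W = T' - S * F'"
  \<comment> \<open>\<open>U\<close> agrees with \<open>T' - S * F'\<close> up to order \<open>n\<close>: a combination of the equations and
    their derivatives is a unit times the difference \<open>\<rho>\<close>.\<close>
  define \<rho> where "\<rho> = W - U"
  have TW: "T' = \<rho> + U + S * F'" by (simp add: \<rho>_def W_def)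
  have "(- fps_const lam + s (dz3 R) - U * s (dz3 P) - S * s (dz3 Q)) * \<rho>
    = (- fps_const lam * T' + (s (dx3 R) + s (dy3 R) * F' + s (dz3 R) * T'))
     - F' * (- fps_const lam * S + s (dy3 R) + s (dz3 R) * S
      - U * (1 + s (dy3 P) + s (dz3 P) * S) - S * (s (dy3 Q) + s (dz3 Q) * S))
     - (- fps_const lam * U + s (dx3 R) + s (dz3 R) * U
      - U * (s (dx3 P) + s (dz3 P) * U) - S * (s (dx3 Q) + s (dz3 Q) * U))
     - U * (F' + (s (dx3 P) + s (dy3 P) * F' + s (dz3 P) * T'))
     - S * (s (dx3 Q) + s (dy3 Q) * F' + s (dz3 Q) * T')"
    unfolding TW by (simp add: algebra_simps)
  moreover have "fps_X ^ n dvd \<dots>"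
    by (intro dvd_diff[OF dvd_diff[OF dvd_diff[OF dvd_diff]]] dvd_mult d1 d2 e3 e4 d5)
  \<comment> \<open>The constant term is \<open>- lam\<close>: every other summand contains a first
    derivative of \<open>P\<close>, \<open>Q\<close> or \<open>R\<close>, which vanishes at the
    origin.\<close>
  moreover have "is_unit (- fps_const lam + s (dz3 R) - U * s (dz3 P) - S * s (dz3 Q))"
    using lam S by (simp add: low)
  ultimately have \<rho>: "fps_X ^ n dvd \<rho>" by (metis dvd_mult_unit_iff')
  have "- fps_const lam * S + s (dy3 R) + s (dz3 R) * S
      - W * (1 + s (dy3 P) + s (dz3 P) * S) - S * (s (dy3 Q) + s (dz3 Q) * S)
    = (- fps_const lam * S + s (dy3 R) + s (dz3 R) * S
      - U * (1 + s (dy3 P) + s (dz3 P) * S) - S * (s (dy3 Q) + s (dz3 Q) * S))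
      - \<rho> * (1 + s (dy3 P) + s (dz3 P) * S)"
    by (simp add: \<rho>_def algebra_simps)
  moreover have "fps_X ^ n dvd \<dots>" by (rule dvd_diff[OF e3 dvd_mult2[OF \<rho>]])
  ultimately obtain r3 where r3: "- fps_const lam * S + s (dy3 R) + s (dz3 R) * S
      - W * (1 + s (dy3 P) + s (dz3 P) * S) - S * (s (dy3 Q) + s (dz3 Q) * S) = fps_X ^ n * r3"
    by (metis dvdE)
  \<comment> \<open>Apart from the \<open>b\<close> term this is the leading coefficient of
    \<open>u\<close> in \<open>ud\<close>. Differentiating \<open>F + p(x, F) = 0\<close> gives
    \<open>F' * (1 + p_y) = - p_x\<close>, which turns it into the divergence
    \<open>\<Phi>\<close>.\<close>
  have "s (dy3 Q) + S * s (dz3 Q) - F' * (1 + s (dy3 P) + S * s (dz3 P)) - fps_const b * fps_X ^ (n - 1)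
    = (s (dx3 P) + s (dz3 P) * U + s (dy3 Q) + s (dz3 Q) * S - fps_const b * fps_X ^ (n - 1))
     - (F' + (s (dx3 P) + s (dy3 P) * F' + s (dz3 P) * T')) + s (dz3 P) * \<rho>"
    unfolding TW by (simp add: algebra_simps)
  moreover have "fps_X ^ n dvd \<dots>" by (rule dvd_add[OF dvd_diff[OF e6 d1] dvd_mult[OF \<rho>]])
  ultimately obtain r6 where r6: "s (dy3 Q) + S * s (dz3 Q) - F' * (1 + s (dy3 P) + S * s (dz3 P))
      - fps_const b * fps_X ^ (n - 1) = fps_X ^ n * r6"
    by (metis dvdE)
  obtain r1 where r1: "F + s P = fps_X ^ (2 * n) * r1" using e1 by (elim dvdE)
  obtain r2 where r2: "- fps_const lam * T + s R = fps_X ^ (2 * n) * r2" using e2 by (elim dvdE)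
  obtain r5 where r5: "s Q - fps_const a * fps_X ^ (2 * n - 1) = fps_X ^ (2 * n) * r5"
    using e5 by (elim dvdE)
  obtain py pz qz rz S1 where low': "s (dy3 P) = fps_X * py" "s (dz3 P) = fps_X * pz"
      "s (dz3 Q) = fps_X * qz" "s (dz3 R) = fps_X * rz" "S = fps_X * S1"
    using low S unfolding fps_X_dvd_iff[symmetric] by (elim dvdE) blast

  let ?e = "fps_map cemb"
  note he = is_ring_hom_fps_map[OF is_ring_hom_cemb]
  note hs = is_ring_hom_add[OF he] is_ring_hom_diff[OF he] is_ring_hom_minus[OF he]
     is_ring_hom_mult[OF he] is_ring_hom_power[OF he] is_ring_hom_1[OF he]
     fps_map_X[OF is_ring_hom_cemb] fps_map_const[OF is_ring_hom_cemb]
  \<comment> \<open>With \<open>E = fps_X ^ (n - 2)\<close> every power that occurs becomes a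
    product of \<open>X\<close> and \<open>E\<close>, and the remaining identities are
    polynomial.\<close>
  define X E u v where "X = (fps_X :: real poly poly fps)" and "E = X ^ n'"
    and "u = fps_const Uc" and "v = fps_const Vc"
  have En: "fps_X ^ n = X * X * E" and En1: "fps_X ^ (n - 1) = X * E"
    by (simp_all add: n' X_def E_def mult.assoc)
  have E2n: "fps_X ^ (2 * n) = X * X * E * (X * X * E)"
    unfolding mult_2 power_add En ..
  have "2 * n - 1 = n + (n - 1)" using n by simp
  then have E2n1: "fps_X ^ (2 * n - 1) = X * X * E * (X * E)"
    by (simp only: power_add En En1)
  define al bb aa where "al = fps_const (cemb lam)" and "bb = fps_const (cemb b)" and "aa = fps_const (cemb a)"
  let ?y = "?e F + fps_X ^ n * u" and ?z = "?e T + fps_X ^ n * (?e S * u + v)"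
  let ?h = "subst3 cemb ?y ?z"
  have n1: "n \<ge> 1" using n by simp
  interpret h: subst3_ring_hom cemb ?y ?z
    unfolding u_def v_def by (rule blow_up_hom[OF F T n1])
  have tay: "\<exists>t. ?h G = ?e (s G) + X * X * E * u * ?e (s (dy3 G))
      + X * X * E * (?e S * u + v) * ?e (s (dz3 G)) + X * X * E * (X * X * E) * t" for G
  proof -
    obtain t where "?h G - (?e (s G) + X * X * E * u * ?e (s (dy3 G))
      + X * X * E * (?e S * u + v) * ?e (s (dz3 G))) = X * X * E * (X * X * E) * t"
      using blow_up_taylor[OF F T n1, of S G] unfolding s_def[symmetric] u_def[symmetric] v_def[symmetric] E2n En
      by (elim dvdE)
    then show ?thesis by (intro exI[of _ t]) (simp add: algebra_simps)
  qed
  obtain t1 t2 t3 where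
    t1: "?h P = ?e (s P) + X * X * E * u * ?e (s (dy3 P))
      + X * X * E * (?e S * u + v) * ?e (s (dz3 P)) + X * X * E * (X * X * E) * t1" and
    t2: "?h Q = ?e (s Q) + X * X * E * u * ?e (s (dy3 Q))
      + X * X * E * (?e S * u + v) * ?e (s (dz3 Q)) + X * X * E * (X * X * E) * t2" and
    t3: "?h R = ?e (s R) + X * X * E * u * ?e (s (dy3 R))
      + X * X * E * (?e S * u + v) * ?e (s (dz3 R)) + X * X * E * (X * X * E) * t3"
    using tay by metis
  have m1: "?e F + ?e (s P) = X * X * E * (X * X * E) * ?e r1"
    using arg_cong[OF r1, of ?e] by (simp only: hs E2n)
  have m2: "?e (s R) = al * ?e T + X * X * E * (X * X * E) * ?e r2"
  proof -
    have "X * X * E * (X * X * E) * ?e r2 = - al * ?e T + ?e (s R)"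
      using arg_cong[OF r2, of ?e] by (simp only: hs E2n al_def)
    then show ?thesis by algebra
  qed
  have m5: "?e (s Q) = aa * (X * X * E * (X * E)) + X * X * E * (X * X * E) * ?e r5"
  proof -
    have "X * X * E * (X * X * E) * ?e r5 = ?e (s Q) - aa * (X * X * E * (X * E))"
      using arg_cong[OF r5, of ?e] by (simp only: hs E2n E2n1 aa_def)
    then show ?thesis by algebra
  qed
  have m3: "?e (s (dy3 R)) = al * ?e S - ?e (s (dz3 R)) * ?e S
      + ?e W * (1 + ?e (s (dy3 P)) + ?e (s (dz3 P)) * ?e S)
      + ?e S * (?e (s (dy3 Q)) + ?e (s (dz3 Q)) * ?e S) + X * X * E * ?e r3"
  proof -
    have "X * X * E * ?e r3 = - al * ?e S + ?e (s (dy3 R)) + ?e (s (dz3 R)) * ?e S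
      - ?e W * (1 + ?e (s (dy3 P)) + ?e (s (dz3 P)) * ?e S)
      - ?e S * (?e (s (dy3 Q)) + ?e (s (dz3 Q)) * ?e S)"
      using arg_cong[OF r3, of ?e] by (simp only: hs En al_def)
    then show ?thesis by algebra
  qed
  have m6: "?e (s (dy3 Q)) = ?e F' * (1 + ?e (s (dy3 P)) + ?e S * ?e (s (dz3 P)))
      - ?e S * ?e (s (dz3 Q)) + bb * (X * E) + X * X * E * ?e r6"
  proof -
    have "X * X * E * ?e r6 = ?e (s (dy3 Q)) + ?e S * ?e (s (dz3 Q))
      - ?e F' * (1 + ?e (s (dy3 P)) + ?e S * ?e (s (dz3 P))) - bb * (X * E)"
      using arg_cong[OF r6, of ?e] by (simp only: hs En En1 bb_def)
    then show ?thesis by algebra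
  qed
  have m7: "?e (s (dy3 P)) = X * ?e py" "?e (s (dz3 P)) = X * ?e pz"
      "?e (s (dz3 Q)) = X * ?e qz" "?e (s (dz3 R)) = X * ?e rz" "?e S = X * ?e S1"
    by (simp_all only: low' hs X_def)
  have m8: "?e T' = ?e W + ?e S * ?e F'"
    by (simp add: W_def hs)
  \<comment> \<open>The constant is removed so that the lowest order \<open>N\<close> is
    positive.\<close>
  define K where "K = ?h (H - const3 (coeff3 H 0 0 0))"
  define nn where "nn = (of_nat n :: real poly poly fps)"
  \<comment> \<open>The vector field in the new coordinates: \<open>x' = fps_X ^ n * xd\<close>,
    \<open>u' = ud\<close>, \<open>v' = vd\<close>. The differentiated coordinate formulas are
    solved for \<open>u'\<close> and \<open>v'\<close> and \<open>fps_X ^ n\<close> is cancelled; in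
    \<open>vd\<close> the combination \<open>T' - S * F'\<close> has become
    \<open>W\<close>.\<close>
  define xd where "xd = u + u * ?e (s (dy3 P)) + (?e S * u + v) * ?e (s (dz3 P)) + X * X * E * (?e r1 + t1)"
  define ud where "ud = aa * (X * E) + X * X * E * ?e r5 + u * ?e (s (dy3 Q)) + (?e S * u + v) * ?e (s (dz3 Q))
     + X * X * E * t2 - xd * (?e F' + nn * (X * E) * u)"
  define vd where "vd = - al * (?e S * u + v) + u * ?e (s (dy3 R)) + (?e S * u + v) * ?e (s (dz3 R))
     + X * X * E * (?e r2 + t3) - xd * (?e W + X * X * E * ?e S' * u + nn * (X * E) * v)
     - ?e S * (aa * (X * E) + X * X * E * ?e r5 + u * ?e (s (dy3 Q)) + (?e S * u + v) * ?e (s (dz3 Q))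
     + X * X * E * t2)"
  have xd: "?y + ?h P = X * X * E * xd"
  proof -
    have "?y + ?h P = (?e F + ?e (s P)) + X * X * E * u + X * X * E * u * ?e (s (dy3 P))
      + X * X * E * (?e S * u + v) * ?e (s (dz3 P)) + X * X * E * (X * X * E) * t1"
      unfolding t1 unfolding En by (simp add: algebra_simps)
    then show ?thesis unfolding m1 xd_def by (simp add: algebra_simps)
  qed
  have ud: "?h Q = X * X * E * (ud + xd * (?e F' + nn * (X * E) * u))"
    unfolding t2 m5 ud_def by (simp add: algebra_simps)
  have vd: "- al * ?z + ?h R = X * X * E * (vd + ?e S * ud
     + xd * (?e T' + nn * (X * E) * (?e S * u + v) + X * X * E * (?e S' * u)))"
    unfolding t3 m2 vd_def ud_def m8 unfolding En by (simp add: algebra_simps)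
  have pde: "X * X * E * xd * ?h (dx3 H) + ?h Q * ?h (dy3 H) + (- al * ?z + ?h R) * ?h (dz3 H) = 0"
  proof -
    have "?h ((Y3 + P) * dx3 H + Q * dy3 H + (- const3 lam * Z3 + R) * dz3 H) = 0"
      using H h.zero by (simp add: formal_first_integral_def)
    then show ?thesis unfolding xd[symmetric]
      by (simp only: h.add h.mult h.minus h.const h.Y h.Z al_def)
  qed
  have dH: "dx3 (H - const3 r) = dx3 H" "dy3 (H - const3 r) = dy3 H" "dz3 (H - const3 r) = dz3 H" for r
    by (rule fps3_eqI, simp add: coeff3_dx3 coeff3_dy3 coeff3_dz3 del: of_nat_Suc,
        simp add: coeff3_def const3_def)+
  have K1: "fps_deriv K = ?h (dx3 H) + ?h (dy3 H) * (?e F' + nn * (X * E) * u)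
     + ?h (dz3 H) * (?e T' + nn * (X * E) * (?e S * u + v) + X * X * E * (?e S' * u))"
    using blow_up_deriv[OF F T n1, of S "H - const3 (coeff3 H 0 0 0)"]
    unfolding K_def u_def v_def dH F'_def T'_def S'_def nn_def En1 En .
  have K2: "fps_map (map_poly pderiv) K = X * X * E * (?h (dy3 H) + ?e S * ?h (dz3 H))"
    using blow_up_du[OF F T n1, of S "H - const3 (coeff3 H 0 0 0)"]
    unfolding K_def u_def v_def dH En .
  have K3: "fps_map pderiv K = X * X * E * ?h (dz3 H)"
    using blow_up_dv[OF F T n1, of S "H - const3 (coeff3 H 0 0 0)"]
    unfolding K_def u_def v_def dH En .
  have eq: "fps_X ^ n * xd * fps_deriv K + ud * fps_map (map_poly pderiv) K + vd * fps_map pderiv K = 0"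
  proof -
    have "fps_X ^ n * xd * fps_deriv K + ud * fps_map (map_poly pderiv) K + vd * fps_map pderiv K
      = X * X * E * xd * ?h (dx3 H) + ?h Q * ?h (dy3 H) + (- al * ?z + ?h R) * ?h (dz3 H)"
      unfolding K1 K2 K3 ud vd unfolding En by (simp add: algebra_simps)
    then show ?thesis using pde by simp
  qed
  have xd': "xd = fps_const Uc + fps_X * (u * ?e py + ?e S * u * ?e pz + X * E * (?e r1 + t1)) + fps_const Vc * (X * ?e pz)"
    unfolding xd_def m7(1-4) u_def[symmetric] v_def[symmetric] X_def[symmetric] by (simp add: algebra_simps)
  have abn: "fps_const [:[:a, b, - real n:]:] = aa + bb * u - nn * u * u"
    by (simp add: aa_def bb_def nn_def u_def fps_of_nat[symmetric] of_nat_poly del: fps_of_nat)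
  have ud': "ud = fps_X ^ (n - 1) * fps_const [:[:a, b, - real n:]:]
      + fps_X ^ n * (?e r5 + t2 + u * ?e r6 - (?e r1 + t1) * (?e F' + nn * (X * E) * u)
           - nn * u * (u * ?e py + (?e S * u + v) * ?e pz))
      + fps_X * fps_const Vc * (?e qz - ?e pz * ?e F')"
    unfolding ud_def xd_def m6 abn En En1 m7(1-4) unfolding u_def[symmetric] v_def[symmetric] X_def[symmetric]
    by (simp add: algebra_simps)
  \<comment> \<open>The low-order part of the coefficient of \<open>u\<close> is the left-hand side
    of \<open>r3\<close>, hence of order \<open>n\<close>: this is what \<open>S\<close> was chosen
    for. In \<open>S * aa * X * E\<close> the missing factor \<open>X\<close> comes from
    \<open>S $ 0 = 0\<close>.\<close>
  have vd': "vd = - fps_const (cemb lam * Vc)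
      + fps_X * fps_const Vc * (?e rz - ?e pz * ?e W - ?e S * ?e qz - nn * E * xd)
      + fps_X ^ n * (?e r2 + t3 - (?e r1 + t1) * ?e W - xd * ?e S' * u - ?e S1 * aa - ?e S * ?e r5
          - ?e S * t2 + u * ?e r3)"
  proof -
    have xW: "xd * ?e W = (u + u * ?e (s (dy3 P)) + (?e S * u + v) * ?e (s (dz3 P))
        + X * X * E * (?e r1 + t1)) * ?e W"
      by (simp only: xd_def)
    have lv: "fps_const (cemb lam * Vc) = al * v" by (simp add: al_def v_def)
    have "vd = u * (- al * ?e S + ?e (s (dy3 R)) + ?e (s (dz3 R)) * ?e S
        - ?e W * (1 + ?e (s (dy3 P)) + ?e (s (dz3 P)) * ?e S) - ?e S * (?e (s (dy3 Q)) + ?e (s (dz3 Q)) * ?e S))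
      + v * (- al + ?e (s (dz3 R)) - ?e (s (dz3 P)) * ?e W - ?e S * ?e (s (dz3 Q)) - nn * (X * E) * xd)
      + X * X * E * (?e r2 + t3 - (?e r1 + t1) * ?e W - xd * ?e S' * u - ?e S * ?e r5 - ?e S * t2)
      - ?e S * (aa * (X * E))"
      unfolding vd_def distrib_left[of xd] xW by (simp add: algebra_simps)
    also have "\<dots> = u * (X * X * E * ?e r3)
      + v * (- al + X * ?e rz - X * ?e pz * ?e W - ?e S * (X * ?e qz) - nn * (X * E) * xd)
      + X * X * E * (?e r2 + t3 - (?e r1 + t1) * ?e W - xd * ?e S' * u - ?e S * ?e r5 - ?e S * t2)
      - X * ?e S1 * (aa * (X * E))"
      unfolding m3 m7(2-4) by (simp add: m7(5) algebra_simps)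
    finally show ?thesis
      unfolding lv En unfolding u_def[symmetric] v_def[symmetric] X_def[symmetric] by (simp add: algebra_simps)
  qed
  have "K $ 0 = 0"
    unfolding K_def h.nth_0 by (simp add: coeff3_def const3_def)
  from blown_up_integral_zero[OF n lam b disc this eq xd' ud' vd'] have "K = 0" .
  then have "H - const3 (coeff3 H 0 0 0) = 0"
    unfolding K_def u_def v_def by (rule subst3_blow_up_eq_0[OF F T n1])
  then show False using H by (auto simp: formal_first_integral_def)
qed

section \<open>Convergent power series in three variables\<close>

text \<open>Weierstrass test for termwise differentiation: enumerating the countable index type
  turns unordered sums into series, and the tail of \<open>M\<close> bounds the error uniformly on
  \<open>S\<close>.\<close>

lemma has_derivative_has_sum:
  fixes f :: "'i::countable \<Rightarrow> 'a::real_normed_vector \<Rightarrow> real"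
  assumes inf: "infinite (UNIV :: 'i set)" and S: "convex S" "open S"
    and der: "\<And>t w. w \<in> S \<Longrightarrow> (f t has_derivative f' t w) (at w)"
    and bound: "\<And>t w v. w \<in> S \<Longrightarrow> \<bar>f' t w v\<bar> \<le> M t * norm v"
    and M: "M summable_on UNIV"
    and g': "\<And>w v. w \<in> S \<Longrightarrow> ((\<lambda>t. f' t w v) has_sum g' w v) UNIV"
    and g: "\<And>w. w \<in> S \<Longrightarrow> ((\<lambda>t. f t w) has_sum g w) UNIV"
    and w: "w \<in> S"
  shows "(g has_derivative g' w) (at w)"
proof -
  define e where "e = from_nat_into (UNIV :: 'i set)"
  have e: "bij_betw e UNIV UNIV"
    unfolding e_def using inf by (intro bij_betw_from_nat_into) auto
  have sums: "(\<lambda>n. F (e n)) sums s" if "(F has_sum s) UNIV" for F :: "'i \<Rightarrow> real" and s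
    using that has_sum_reindex_bij_betw[OF e, of F s] by (intro has_sum_imp_sums) simp
  obtain m where m: "(M has_sum m) UNIV" using M by (auto simp: summable_on_def)
  have Ms: "(\<lambda>n. M (e n)) sums m" by (rule sums[OF m])
  have "\<exists>h. \<forall>x\<in>S. (\<lambda>n. f (e n) x) sums h x \<and> (h has_derivative g' x) (at x within S)"
  proof (rule has_derivative_series[OF S(1)])
    show "(f (e n) has_derivative f' (e n) x) (at x within S)" if "x \<in> S" for n x
      using der[OF that] by (rule has_derivative_at_withinI)
    show "(\<lambda>n. f (e n) w) sums g w" by (rule sums[OF g[OF w]])
    fix r :: real assume r: "r > 0"
    have "(\<lambda>n. m - (\<Sum>i<n. M (e i))) \<longlonglongrightarrow> m - m"
      using Ms by (intro tendsto_diff tendsto_const) (simp add: sums_def)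
    then have "\<forall>\<^sub>F n in sequentially. m - (\<Sum>i<n. M (e i)) < r"
      using r by (auto dest: order_tendstoD)
    then show "\<forall>\<^sub>F n in sequentially. \<forall>x\<in>S. \<forall>h. norm ((\<Sum>i<n. f' (e i) x h) - g' x h) \<le> r * norm h"
    proof eventually_elim
      case (elim n)
      show ?case
      proof (intro ballI allI)
        fix x h assume x: "x \<in> S"
        have s1: "(\<lambda>i. f' (e (i + n)) x h) sums (g' x h - (\<Sum>i<n. f' (e i) x h))"
          using sums[OF g'[OF x, of h]] by (rule sums_split_initial_segment)
        have s2: "(\<lambda>i. M (e (i + n)) * norm h) sums ((m - (\<Sum>i<n. M (e i))) * norm h)"
          by (intro sums_mult2 sums_split_initial_segment Ms)
        have "\<bar>g' x h - (\<Sum>i<n. f' (e i) x h)\<bar> \<le> (m - (\<Sum>i<n. M (e i))) * norm h"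
          using norm_sums_le[OF s1 s2] bound[OF x]
          by simp
        also have "\<dots> \<le> r * norm h" using elim by (intro mult_right_mono) auto
        finally show "norm ((\<Sum>i<n. f' (e i) x h) - g' x h) \<le> r * norm h" by simp
      qed
    qed
  qed (use w in auto)
  then obtain h where h: "\<And>x. x \<in> S \<Longrightarrow> (\<lambda>n. f (e n) x) sums h x"
      "\<And>x. x \<in> S \<Longrightarrow> (h has_derivative g' x) (at x within S)" by blast
  have "h x = g x" if "x \<in> S" for x
    using h(1)[OF that] sums[OF g[OF that]] by (rule sums_unique2)
  moreover have "(h has_derivative g' w) (at w)"
    using h(2)[OF w] at_within_open[OF w S(2)] by simp
  ultimately show ?thesis
    using has_derivative_transform_within_open[OF _ S(2) w] by blast
qed

section \<open>Absolute convergence and remainders on boxes\<close>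

definition term3 :: "fps3 \<Rightarrow> real \<times> real \<times> real \<Rightarrow> nat \<times> nat \<times> nat \<Rightarrow> real" where
  "term3 S = (\<lambda>(x, y, z) (i, j, k). coeff3 S i j k * x ^ i * y ^ j * z ^ k)"

definition eval3 :: "fps3 \<Rightarrow> real \<times> real \<times> real \<Rightarrow> real" where
  "eval3 S w = infsum (term3 S w) UNIV"

definition box3 :: "real \<Rightarrow> (real \<times> real \<times> real) set" where
  "box3 \<rho> = {(x, y, z). \<bar>x\<bar> < \<rho> \<and> \<bar>y\<bar> < \<rho> \<and> \<bar>z\<bar> < \<rho>}"

lemma box3_eq: "box3 \<rho> = {-\<rho><..<\<rho>} \<times> {-\<rho><..<\<rho>} \<times> {-\<rho><..<\<rho>}"
  by (auto simp: box3_def)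

lemma open_box3: "open (box3 \<rho>)" and convex_box3: "convex (box3 \<rho>)"
  unfolding box3_eq by (auto intro!: open_Times convex_Times)

text \<open>Absolute summability at the corner of the box, which dominates the series on the whole
  closed box.\<close>

definition summable3 :: "real \<Rightarrow> fps3 \<Rightarrow> bool" where
  "summable3 \<rho> S \<longleftrightarrow> (\<lambda>(i, j, k). \<bar>coeff3 S i j k\<bar> * \<rho> ^ (i + j + k)) summable_on UNIV"

lemma abs_term3_le:
  assumes "\<bar>x\<bar> \<le> \<rho>" "\<bar>y\<bar> \<le> \<rho>" "\<bar>z\<bar> \<le> \<rho>"
  shows "\<bar>term3 S (x, y, z) (i, j, k)\<bar> \<le> \<bar>coeff3 S i j k\<bar> * \<rho> ^ (i + j + k)"
  unfolding term3_def prod.case abs_mult power_abs power_add mult.assoc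
  using assms by (intro mult_left_mono mult_mono power_mono) (auto intro: order_trans[OF abs_ge_zero])

lemma term3_has_sum:
  assumes "summable3 \<rho> S" "\<bar>x\<bar> \<le> \<rho>" "\<bar>y\<bar> \<le> \<rho>" "\<bar>z\<bar> \<le> \<rho>"
  shows "(term3 S (x, y, z) has_sum eval3 S (x, y, z)) UNIV"
  unfolding eval3_def
proof (rule has_sum_infsum, rule abs_summable_summable, rule Infinite_Sum.abs_summable_on_comparison_test')
  show "(\<lambda>(i, j, k). \<bar>coeff3 S i j k\<bar> * \<rho> ^ (i + j + k)) summable_on UNIV"
    using assms(1) by (simp add: summable3_def)
qed (use abs_term3_le[OF assms(2-4)] in auto)

lemma has_fps3_expansion_eval3:
  assumes "\<rho> > 0" "summable3 \<rho> S"
  shows "has_fps3_expansion (eval3 S) S"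
proof -
  have "\<forall>\<^sub>F w in nhds 0. w \<in> box3 \<rho>"
    using assms(1) open_box3 by (intro eventually_nhds_in_open) (auto simp: box3_def zero_prod_def)
  then show ?thesis unfolding has_fps3_expansion_def
  proof eventually_elim
    case (elim w)
    then show ?case
      using term3_has_sum[OF assms(2), of "fst w" "fst (snd w)" "snd (snd w)"]
      by (cases w) (auto simp: box3_def term3_def)
  qed
qed

text \<open>Over the reals unordered summability is absolute, so the single point
  \<open>(d / 4, d / 4, d / 4)\<close> suffices. Coordinates bounded by \<open>d / 4\<close> have
  norm at most \<open>3 * d / 4 < d\<close>.\<close>

lemma has_fps3_expansion_imp_eval3:
  assumes "has_fps3_expansion G S"
  obtains \<rho> where "\<rho> > 0" "summable3 \<rho> S" "\<And>w. w \<in> box3 \<rho> \<Longrightarrow> G w = eval3 S w"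
proof -
  obtain d where d: "d > 0" "\<And>x y z. norm (x, y, z) < d \<Longrightarrow> (term3 S (x, y, z) has_sum G (x, y, z)) UNIV"
    using assms unfolding has_fps3_expansion_def eventually_nhds_metric
    by (auto simp: term3_def dist_norm)
  have n: "norm (x, y, z) \<le> \<bar>x\<bar> + (\<bar>y\<bar> + \<bar>z\<bar>)" for x y z :: real
    using norm_Pair_le[of x "(y, z)"] norm_Pair_le[of y z] by simp
  have box: "norm (x, y, z) < d" if "\<bar>x\<bar> \<le> d / 4" "\<bar>y\<bar> \<le> d / 4" "\<bar>z\<bar> \<le> d / 4" for x y z :: real
    using n[of x y z] that d(1) by linarith
  have "term3 S (d / 4, d / 4, d / 4) summable_on UNIV"
    using d(2)[OF box, of "d/4" "d/4" "d/4"] d(1) by (auto simp: summable_on_def)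
  then have "(\<lambda>e. norm (term3 S (d / 4, d / 4, d / 4) e)) summable_on UNIV"
    by (rule summable_on_iff_abs_summable_on_real[THEN iffD1])
  moreover have "norm (term3 S (d / 4, d / 4, d / 4) e) =
      (case e of (i, j, k) \<Rightarrow> \<bar>coeff3 S i j k\<bar> * (d / 4) ^ (i + j + k))" for e
    using d(1) by (cases e) (simp add: term3_def abs_mult power_add)
  ultimately have s: "summable3 (d / 4) S"
    unfolding summable3_def by simp
  show ?thesis
  proof
    show "G w = eval3 S w" if "w \<in> box3 (d / 4)" for w
    proof -
      obtain x y z where w: "w = (x, y, z)" by (cases w) auto
      then show ?thesis
        using that d(2)[OF box, of x y z] term3_has_sum[OF s, of x y z]
        by (auto simp: box3_def intro: has_sum_unique)
    qed
  qed (use d s in auto)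
qed

text \<open>Scaling from the corner: outside \<open>A\<close> each term is bounded by its corner
  value times \<open>(t / \<rho>) ^ m\<close>, as \<open>t < \<rho>\<close> and its degree is at
  least \<open>m\<close>. Hence \<open>C = b / \<rho> ^ m\<close>.\<close>

lemma fps3_remainder_gen:
  assumes "has_fps3_expansion G S" and fin: "finite A"
    and A: "\<And>i j k. (i, j, k) \<notin> A \<Longrightarrow> coeff3 S i j k \<noteq> 0 \<Longrightarrow> m \<le> i + j + k"
  obtains \<rho> C where "\<rho> > 0"
    "\<And>t x y z. t < \<rho> \<Longrightarrow> \<bar>x\<bar> \<le> t \<Longrightarrow> \<bar>y\<bar> \<le> t \<Longrightarrow> \<bar>z\<bar> \<le> t \<Longrightarrow>
      \<bar>G (x, y, z) - sum (term3 S (x, y, z)) A\<bar> \<le> C * t ^ m"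
proof -
  obtain \<rho> where \<rho>: "\<rho> > 0" "summable3 \<rho> S" "\<And>w. w \<in> box3 \<rho> \<Longrightarrow> G w = eval3 S w"
    using has_fps3_expansion_imp_eval3[OF assms(1)] by blast
  let ?B = "\<lambda>(i, j, k). \<bar>coeff3 S i j k\<bar> * \<rho> ^ (i + j + k)"
  have B: "?B summable_on - A"
    using \<rho>(2) unfolding summable3_def by (rule summable_on_subset_banach) simp
  obtain b where b: "(?B has_sum b) (- A)" using B by (auto simp: summable_on_def)
  show ?thesis
  proof
    fix t x y z :: real
    assume t: "t < \<rho>" "\<bar>x\<bar> \<le> t" "\<bar>y\<bar> \<le> t" "\<bar>z\<bar> \<le> t"
    have t0: "0 \<le> t" using t(2) by linarith
    have G: "(term3 S (x, y, z) has_sum G (x, y, z)) UNIV"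
      using term3_has_sum[OF \<rho>(2), of x y z] t \<rho>(3)[of "(x, y, z)"] by (auto simp: box3_def)
    have "(term3 S (x, y, z) has_sum (G (x, y, z) - sum (term3 S (x, y, z)) A)) (UNIV - A)"
      using has_sum_Diff[OF G has_sum_finite[OF fin]] by simp
    then have r: "(term3 S (x, y, z) has_sum (G (x, y, z) - sum (term3 S (x, y, z)) A)) (- A)"
      by (simp add: Compl_eq_Diff_UNIV)
    have le: "\<bar>term3 S (x, y, z) e\<bar> \<le> ?B e * (t / \<rho>) ^ m" if "e \<in> - A" for e
    proof -
      obtain i j k where e: "e = (i, j, k)" by (cases e) auto
      have "\<bar>coeff3 S i j k\<bar> * \<rho> ^ (i + j + k) * (t / \<rho>) ^ (i + j + k)
        \<le> \<bar>coeff3 S i j k\<bar> * \<rho> ^ (i + j + k) * (t / \<rho>) ^ m"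
      proof (cases "coeff3 S i j k = 0")
        case False
        then have "m \<le> i + j + k" using A that by (simp add: e)
        then have "(t / \<rho>) ^ (i + j + k) \<le> (t / \<rho>) ^ m"
          using t t0 \<rho>(1) by (intro power_decreasing) auto
        then show ?thesis using \<rho>(1) by (intro mult_left_mono) auto
      qed simp
      then show ?thesis
        using abs_term3_le[OF t(2-4), of S i j k] \<rho>(1) unfolding e by (simp add: power_divide)
    qed
    have r': "((\<lambda>e. - term3 S (x, y, z) e) has_sum - (G (x, y, z) - sum (term3 S (x, y, z)) A)) (- A)"
      using r by (simp only: has_sum_uminus minus_minus)
    have "\<bar>G (x, y, z) - sum (term3 S (x, y, z)) A\<bar> \<le> b * (t / \<rho>) ^ m"
    proof (rule abs_leI)
      show "G (x, y, z) - sum (term3 S (x, y, z)) A \<le> b * (t / \<rho>) ^ m"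
        by (rule has_sum_mono[OF r has_sum_cmult_left[OF b]]) (use le in fastforce)
      show "- (G (x, y, z) - sum (term3 S (x, y, z)) A) \<le> b * (t / \<rho>) ^ m"
        by (rule has_sum_mono[OF r' has_sum_cmult_left[OF b]]) (use le in fastforce)
    qed
    then show "\<bar>G (x, y, z) - sum (term3 S (x, y, z)) A\<bar> \<le> (b / \<rho> ^ m) * t ^ m"
      by (simp add: power_divide)
  qed (use \<rho> in auto)
qed

lemma fps3_remainder:
  assumes G: "has_fps3_expansion G S"
  obtains \<rho> C where "\<rho> > 0"
    "\<And>t x y z. t < \<rho> \<Longrightarrow> \<bar>x\<bar> \<le> t \<Longrightarrow> \<bar>y\<bar> \<le> t \<Longrightarrow> \<bar>z\<bar> \<le> t \<Longrightarrow>
      \<bar>G (x, y, z) - (\<Sum>k\<le>D. \<Sum>j\<le>D. \<Sum>i\<le>D. coeff3 S i j k * x ^ i * y ^ j * z ^ k)\<bar> \<le> C * t ^ Suc D"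
proof -
  define A where "A = {..D} \<times> {..D} \<times> {..D}"
  have A: "finite A" "\<And>i j k. (i, j, k) \<notin> A \<Longrightarrow> coeff3 S i j k \<noteq> 0 \<Longrightarrow> Suc D \<le> i + j + k"
    by (auto simp: A_def)
    have eq: "sum (term3 S (x, y, z)) A
      = (\<Sum>k\<le>D. \<Sum>j\<le>D. \<Sum>i\<le>D. coeff3 S i j k * x ^ i * y ^ j * z ^ k)" for x y z
    proof -
      have "sum (term3 S (x, y, z)) A = (\<Sum>i\<le>D. \<Sum>j\<le>D. \<Sum>k\<le>D. coeff3 S i j k * x ^ i * y ^ j * z ^ k)"
        unfolding A_def by (simp add: sum.cartesian_product term3_def)
      also have "\<dots> = (\<Sum>i\<le>D. \<Sum>k\<le>D. \<Sum>j\<le>D. coeff3 S i j k * x ^ i * y ^ j * z ^ k)"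
        by (rule sum.cong[OF refl]) (rule sum.swap)
      also have "\<dots> = (\<Sum>k\<le>D. \<Sum>i\<le>D. \<Sum>j\<le>D. coeff3 S i j k * x ^ i * y ^ j * z ^ k)"
        by (rule sum.swap)
      also have "\<dots> = (\<Sum>k\<le>D. \<Sum>j\<le>D. \<Sum>i\<le>D. coeff3 S i j k * x ^ i * y ^ j * z ^ k)"
        by (rule sum.cong[OF refl]) (rule sum.swap)
      finally show ?thesis .
    qed
  show ?thesis
    by (rule fps3_remainder_gen[OF G A(1), of "Suc D"], erule (1) A(2), rule that, assumption)
      (simp only: eq[symmetric])
qed

section \<open>Partial derivatives of convergent series\<close>

lemma Suc_le_two_power: "real (Suc i) \<le> 2 ^ i"
  by (induction i) simp_all

text \<open>Lowers an exponent after termwise differentiation: terms outside the range of the shift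
  have exponent zero in that variable, hence zero derivative.\<close>

lemma has_sum_shift:
  fixes f :: "'i \<Rightarrow> real"
  assumes "inj \<sigma>" "\<And>t. t \<notin> range \<sigma> \<Longrightarrow> f t = 0" "((\<lambda>t. f (\<sigma> t)) has_sum s) UNIV"
  shows "(f has_sum s) UNIV"
proof -
  have "(f has_sum s) (range \<sigma>)"
    using assms(3) has_sum_reindex[OF assms(1), of f s] by (simp add: o_def)
  then show ?thesis
    by (rule has_sum_cong_neutral[THEN iffD1, rotated -1]) (use assms(2) in auto)
qed

definition shift_x :: "nat \<times> nat \<times> nat \<Rightarrow> nat \<times> nat \<times> nat" where "shift_x = (\<lambda>(i, j, k). (Suc i, j, k))"
definition shift_y :: "nat \<times> nat \<times> nat \<Rightarrow> nat \<times> nat \<times> nat" where "shift_y = (\<lambda>(i, j, k). (i, Suc j, k))"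
definition shift_z :: "nat \<times> nat \<times> nat \<Rightarrow> nat \<times> nat \<times> nat" where "shift_z = (\<lambda>(i, j, k). (i, j, Suc k))"

lemma inj_shift: "inj shift_x" "inj shift_y" "inj shift_z"
  by (auto simp: shift_x_def shift_y_def shift_z_def inj_on_def)

lemma range_shift:
  "(i, j, k) \<notin> range shift_x \<longleftrightarrow> i = 0" "(i, j, k) \<notin> range shift_y \<longleftrightarrow> j = 0"
  "(i, j, k) \<notin> range shift_z \<longleftrightarrow> k = 0"
  by (auto simp: shift_x_def shift_y_def shift_z_def image_iff dest: not0_implies_Suc)

text \<open>Halving the radius pays for the factor produced by differentiation:
  \<open>Suc m \<le> 2 ^ l\<close> whenever \<open>m \<le> l\<close>.\<close>

lemma summable3_deriv:
  assumes \<rho>: "\<rho> > 0" and S: "summable3 \<rho> S"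
  shows "summable3 (\<rho> / 2) (dx3 S)" "summable3 (\<rho> / 2) (dy3 S)" "summable3 (\<rho> / 2) (dz3 S)"
proof -
  let ?B = "\<lambda>(i, j, k). \<bar>coeff3 S i j k\<bar> * \<rho> ^ (i + j + k)"
  have sum: "(\<lambda>t. ?B (\<sigma> t) * (1 / \<rho>)) summable_on UNIV" if "inj \<sigma>" for \<sigma> :: "nat \<times> nat \<times> nat \<Rightarrow> nat \<times> nat \<times> nat"
    using S summable_on_reindex[OF that, of ?B] summable_on_subset_banach[of ?B UNIV "range \<sigma>"]
    unfolding summable3_def by (intro summable_on_cmult_left) (auto simp: o_def)
  have le: "real (Suc m) * \<bar>c\<bar> * (\<rho> / 2) ^ l \<le> \<bar>c\<bar> * \<rho> ^ Suc l * (1 / \<rho>)" if "m \<le> l" for c m l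
  proof -
    have "real (Suc m) \<le> real (Suc l)" using that by simp
    also have "\<dots> \<le> 2 ^ l" by (rule Suc_le_two_power)
    finally have "real (Suc m) \<le> 2 ^ l" .
    then have "real (Suc m) * (\<bar>c\<bar> * \<rho> ^ l) \<le> 2 ^ l * (\<bar>c\<bar> * \<rho> ^ l)"
      using \<rho> by (intro mult_right_mono) auto
    then show ?thesis using \<rho> by (simp add: power_divide field_simps del: of_nat_Suc)
  qed
  have le': "real (Suc m) * \<bar>c\<bar> * (\<rho> / 2) ^ l \<le> \<bar>c\<bar> * \<rho> ^ l" if "m \<le> l" for c m l
    using le[OF that, of c] \<rho> by simp
  show "summable3 (\<rho> / 2) (dx3 S)" unfolding summable3_def
    by (rule summable_on_comparison_test[OF sum[OF inj_shift(1)]])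
      (use \<rho> in \<open>auto simp: shift_x_def coeff3_dx3 abs_mult intro!: le' simp del: of_nat_Suc\<close>)
  show "summable3 (\<rho> / 2) (dy3 S)" unfolding summable3_def
    by (rule summable_on_comparison_test[OF sum[OF inj_shift(2)]])
      (use \<rho> in \<open>auto simp: shift_y_def coeff3_dy3 abs_mult intro!: le' simp del: of_nat_Suc\<close>)
  show "summable3 (\<rho> / 2) (dz3 S)" unfolding summable3_def
    by (rule summable_on_comparison_test[OF sum[OF inj_shift(3)]])
      (use \<rho> in \<open>auto simp: shift_z_def coeff3_dz3 abs_mult intro!: le' simp del: of_nat_Suc\<close>)
qed


lemma has_derivative_eval3:
  assumes \<rho>: "\<rho> > 0" and S: "summable3 \<rho> S" and w: "w \<in> box3 (\<rho> / 2)"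
  shows "(eval3 S has_derivative (\<lambda>v. eval3 (dx3 S) w * fst v + eval3 (dy3 S) w * fst (snd v)
     + eval3 (dz3 S) w * snd (snd v))) (at w)"
proof -
  \<comment> \<open>Each of the three partial derivatives is bounded by the corner term divided by
    \<open>\<rho>\<close>, because
    \<open>i * (\<rho> / 2) ^ (i - 1) \<le> \<rho> ^ (i - 1)\<close>.\<close>
  define M where "M = (\<lambda>(i, j, k). 3 * (\<bar>coeff3 S i j k\<bar> * \<rho> ^ (i + j + k) * (1 / \<rho>)))"
  define Dx Dy Dz :: "nat \<times> nat \<times> nat \<Rightarrow> real \<times> real \<times> real \<Rightarrow> real"
    where "Dx = (\<lambda>(i, j, k) (x, y, z). coeff3 S i j k * (real i * x ^ (i - 1)) * y ^ j * z ^ k)"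
      and "Dy = (\<lambda>(i, j, k) (x, y, z). coeff3 S i j k * x ^ i * (real j * y ^ (j - 1)) * z ^ k)"
      and "Dz = (\<lambda>(i, j, k) (x, y, z). coeff3 S i j k * x ^ i * y ^ j * (real k * z ^ (k - 1)))"
  note D_defs = Dx_def Dy_def Dz_def
  have pw: "real i * \<bar>x\<bar> ^ (i - 1) \<le> \<rho> ^ i * (1 / \<rho>)" if "\<bar>x\<bar> < \<rho> / 2" for i x
  proof (cases i)
    case (Suc m)
    have "real i * \<bar>x\<bar> ^ m \<le> 2 ^ m * (\<rho> / 2) ^ m"
      unfolding Suc using that by (intro mult_mono Suc_le_two_power power_mono) auto
    then show ?thesis using \<rho> Suc by (simp add: power_divide)
  qed (use \<rho> in simp)
  have pw': "\<bar>x\<bar> ^ i \<le> \<rho> ^ i" if "\<bar>x\<bar> < \<rho> / 2" for i and x :: real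
    using that \<rho> by (intro power_mono) auto
  have bd: "\<bar>Dx (i, j, k) (x, y, z)\<bar> \<le> \<bar>coeff3 S i j k\<bar> * \<rho> ^ (i + j + k) * (1 / \<rho>)"
    "\<bar>Dy (i, j, k) (x, y, z)\<bar> \<le> \<bar>coeff3 S i j k\<bar> * \<rho> ^ (i + j + k) * (1 / \<rho>)"
    "\<bar>Dz (i, j, k) (x, y, z)\<bar> \<le> \<bar>coeff3 S i j k\<bar> * \<rho> ^ (i + j + k) * (1 / \<rho>)"
    if "(x, y, z) \<in> box3 (\<rho> / 2)" for i j k x y z
  proof -
    from that have b: "\<bar>x\<bar> < \<rho> / 2" "\<bar>y\<bar> < \<rho> / 2" "\<bar>z\<bar> < \<rho> / 2" by (auto simp: box3_def)
    have "\<bar>coeff3 S i j k\<bar> * (real i * \<bar>x\<bar> ^ (i - 1)) * \<bar>y\<bar> ^ j * \<bar>z\<bar> ^ k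
        \<le> \<bar>coeff3 S i j k\<bar> * (\<rho> ^ i * (1 / \<rho>)) * \<rho> ^ j * \<rho> ^ k"
      using \<rho> by (intro mult_mono pw pw' b order_refl) auto
    then show "\<bar>Dx (i, j, k) (x, y, z)\<bar> \<le> \<bar>coeff3 S i j k\<bar> * \<rho> ^ (i + j + k) * (1 / \<rho>)"
      by (simp add: Dx_def abs_mult power_abs power_add)
    have "\<bar>coeff3 S i j k\<bar> * \<bar>x\<bar> ^ i * (real j * \<bar>y\<bar> ^ (j - 1)) * \<bar>z\<bar> ^ k
        \<le> \<bar>coeff3 S i j k\<bar> * \<rho> ^ i * (\<rho> ^ j * (1 / \<rho>)) * \<rho> ^ k"
      using \<rho> by (intro mult_mono pw pw' b order_refl) auto
    then show "\<bar>Dy (i, j, k) (x, y, z)\<bar> \<le> \<bar>coeff3 S i j k\<bar> * \<rho> ^ (i + j + k) * (1 / \<rho>)"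
      by (simp add: Dy_def abs_mult power_abs power_add)
    have "\<bar>coeff3 S i j k\<bar> * \<bar>x\<bar> ^ i * \<bar>y\<bar> ^ j * (real k * \<bar>z\<bar> ^ (k - 1))
        \<le> \<bar>coeff3 S i j k\<bar> * \<rho> ^ i * \<rho> ^ j * (\<rho> ^ k * (1 / \<rho>))"
      using \<rho> by (intro mult_mono pw pw' b order_refl) auto
    then show "\<bar>Dz (i, j, k) (x, y, z)\<bar> \<le> \<bar>coeff3 S i j k\<bar> * \<rho> ^ (i + j + k) * (1 / \<rho>)"
      by (simp add: Dz_def abs_mult power_abs power_add)
  qed
  note S' = summable3_deriv[OF \<rho> S]
  have hs: "((\<lambda>t. Dx t w) has_sum eval3 (dx3 S) w) UNIV"
    "((\<lambda>t. Dy t w) has_sum eval3 (dy3 S) w) UNIV"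
    "((\<lambda>t. Dz t w) has_sum eval3 (dz3 S) w) UNIV"
    if w: "w \<in> box3 (\<rho> / 2)" for w
  proof -
    obtain x y z where xyz: "w = (x, y, z)" by (cases w) auto
    with w have b: "\<bar>x\<bar> \<le> \<rho> / 2" "\<bar>y\<bar> \<le> \<rho> / 2" "\<bar>z\<bar> \<le> \<rho> / 2" by (auto simp: box3_def)
    have nx: "Dx t w = 0" if "t \<notin> range shift_x" for t
      using that by (cases t) (simp add: range_shift xyz Dx_def)
    have ex: "(\<lambda>t. Dx (shift_x t) w) = term3 (dx3 S) w"
      by (rule ext) (auto simp: xyz Dx_def shift_x_def term3_def coeff3_dx3)
    have "((\<lambda>t. Dx (shift_x t) w) has_sum eval3 (dx3 S) w) UNIV"
      unfolding ex using term3_has_sum[OF S'(1) b] unfolding xyz .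
    then show "((\<lambda>t. Dx t w) has_sum eval3 (dx3 S) w) UNIV"
      by (rule has_sum_shift[where f = "\<lambda>t. Dx t w", OF inj_shift(1), rotated]) (rule nx)
    have ny: "Dy t w = 0" if "t \<notin> range shift_y" for t
      using that by (cases t) (simp add: range_shift xyz Dy_def)
    have ey: "(\<lambda>t. Dy (shift_y t) w) = term3 (dy3 S) w"
      by (rule ext) (auto simp: xyz Dy_def shift_y_def term3_def coeff3_dy3)
    have "((\<lambda>t. Dy (shift_y t) w) has_sum eval3 (dy3 S) w) UNIV"
      unfolding ey using term3_has_sum[OF S'(2) b] unfolding xyz .
    then show "((\<lambda>t. Dy t w) has_sum eval3 (dy3 S) w) UNIV"
      by (rule has_sum_shift[where f = "\<lambda>t. Dy t w", OF inj_shift(2), rotated]) (rule ny)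
    have nz: "Dz t w = 0" if "t \<notin> range shift_z" for t
      using that by (cases t) (simp add: range_shift xyz Dz_def)
    have ez: "(\<lambda>t. Dz (shift_z t) w) = term3 (dz3 S) w"
      by (rule ext) (auto simp: xyz Dz_def shift_z_def term3_def coeff3_dz3)
    have "((\<lambda>t. Dz (shift_z t) w) has_sum eval3 (dz3 S) w) UNIV"
      unfolding ez using term3_has_sum[OF S'(3) b] unfolding xyz .
    then show "((\<lambda>t. Dz t w) has_sum eval3 (dz3 S) w) UNIV"
      by (rule has_sum_shift[where f = "\<lambda>t. Dz t w", OF inj_shift(3), rotated]) (rule nz)
  qed
  have inf: "infinite (UNIV :: (nat \<times> nat \<times> nat) set)"
    by (simp add: finite_prod)
  show ?thesis
  proof (rule has_derivative_has_sum[OF inf convex_box3 open_box3 _ _ _ _ _ w])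
    show "((\<lambda>w. term3 S w t) has_derivative
        (\<lambda>v. Dx t w * fst v + Dy t w * fst (snd v) + Dz t w * snd (snd v))) (at w)" for t w
    proof -
      obtain i j k where t: "t = (i, j, k)" by (cases t) auto
      have "((\<lambda>w. coeff3 S i j k * fst w ^ i * fst (snd w) ^ j * snd (snd w) ^ k) has_derivative
        (\<lambda>v. Dx t w * fst v + Dy t w * fst (snd v) + Dz t w * snd (snd v))) (at w)"
        by (rule has_derivative_eq_rhs, (rule derivative_intros)+)
          (auto simp: t D_defs fun_eq_iff algebra_simps split: prod.splits)
      then show ?thesis by (simp add: term3_def t case_prod_unfold)
    qed
    show "\<bar>Dx t w * fst v + Dy t w * fst (snd v) + Dz t w * snd (snd v)\<bar> \<le> M t * norm v"
      if w: "w \<in> box3 (\<rho> / 2)" for t w v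
    proof -
      obtain i j k where t: "t = (i, j, k)" by (cases t) auto
      obtain x y z where xyz: "w = (x, y, z)" by (cases w) auto
      define m where "m = \<bar>coeff3 S i j k\<bar> * \<rho> ^ (i + j + k) * (1 / \<rho>)"
      have n: "\<bar>fst v\<bar> \<le> norm v" "\<bar>fst (snd v)\<bar> \<le> norm v" "\<bar>snd (snd v)\<bar> \<le> norm v"
        using norm_fst_le[of "fst v" "snd v"] norm_snd_le[of "snd v" "fst v"]
          norm_fst_le[of "fst (snd v)" "snd (snd v)"] norm_snd_le[of "snd (snd v)" "fst (snd v)"]
        by auto
      have m: "\<bar>Dx t w\<bar> \<le> m" "\<bar>Dy t w\<bar> \<le> m" "\<bar>Dz t w\<bar> \<le> m"
        using bd[OF w[unfolded xyz], of i j k] unfolding t xyz m_def by auto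
      have "\<bar>Dx t w * fst v\<bar> \<le> m * norm v" "\<bar>Dy t w * fst (snd v)\<bar> \<le> m * norm v"
         "\<bar>Dz t w * snd (snd v)\<bar> \<le> m * norm v"
        unfolding abs_mult using m n by (auto intro!: mult_mono intro: order_trans[OF abs_ge_zero])
      moreover have "M t * norm v = 3 * (m * norm v)" by (simp add: M_def t m_def)
      ultimately show ?thesis by linarith
    qed
    show "M summable_on UNIV"
      using S summable_on_cmult_left[of "\<lambda>(i, j, k). \<bar>coeff3 S i j k\<bar> * \<rho> ^ (i + j + k)" UNIV "3 / \<rho>"]
      unfolding summable3_def M_def by (simp add: case_prod_unfold mult_ac)
    show "((\<lambda>t. Dx t w * fst v + Dy t w * fst (snd v) + Dz t w * snd (snd v)) has_sum
      (eval3 (dx3 S) w * fst v + eval3 (dy3 S) w * fst (snd v) + eval3 (dz3 S) w * snd (snd v))) UNIV"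
      if "w \<in> box3 (\<rho> / 2)" for w v
      using hs[OF that] by (intro has_sum_add has_sum_cmult_left)
    show "(term3 S w has_sum eval3 S w) UNIV" if "w \<in> box3 (\<rho> / 2)" for w
      using that \<rho> term3_has_sum[OF S, of "fst w" "fst (snd w)" "snd (snd w)"]
      by (cases w) (auto simp: box3_def)
  qed
qed

lemma has_fps3_expansion_derivative:
  assumes "has_fps3_expansion G S"
  obtains Gx Gy Gz where "has_fps3_expansion Gx (dx3 S)" "has_fps3_expansion Gy (dy3 S)"
    "has_fps3_expansion Gz (dz3 S)"
    "\<forall>\<^sub>F w in nhds 0. (G has_derivative (\<lambda>v. Gx w * fst v + Gy w * fst (snd v) + Gz w * snd (snd v))) (at w)"
proof -
  obtain \<rho> where \<rho>: "\<rho> > 0" "summable3 \<rho> S" "\<And>w. w \<in> box3 \<rho> \<Longrightarrow> G w = eval3 S w"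
    using has_fps3_expansion_imp_eval3[OF assms] by blast
  have \<rho>2: "\<rho> / 2 > 0" using \<rho>(1) by simp
  have "\<forall>\<^sub>F w in nhds 0. w \<in> box3 (\<rho> / 2)"
    using \<rho>(1) by (intro eventually_nhds_in_open open_box3) (auto simp: box3_def zero_prod_def)
  then have "\<forall>\<^sub>F w in nhds 0. (G has_derivative (\<lambda>v. eval3 (dx3 S) w * fst v + eval3 (dy3 S) w * fst (snd v)
     + eval3 (dz3 S) w * snd (snd v))) (at w)"
  proof eventually_elim
    case (elim w)
    have "eval3 S w' = G w'" if "w' \<in> box3 (\<rho> / 2)" for w'
      using that \<rho>(1) by (intro \<rho>(3)[symmetric]) (auto simp: box3_def)
    then show ?case
      by (rule has_derivative_transform_within_open[OF has_derivative_eval3[OF \<rho>(1,2) elim] open_box3 elim])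
  qed
  then show ?thesis
    by (rule that[OF summable3_deriv[OF \<rho>(1,2), THEN has_fps3_expansion_eval3[OF \<rho>2]]])
qed

section \<open>Finite expansions at the origin\<close>

text \<open>Peano expansion modulo \<open>x ^ k\<close>; only the class of \<open>S\<close> modulo
  \<open>fps_X ^ k\<close> matters. Being an estimate on values, it is stable under ring operations
  but not under differentiation.\<close>

definition expands :: "nat \<Rightarrow> (real \<Rightarrow> real) \<Rightarrow> real fps \<Rightarrow> bool" where
  "expands k f S \<longleftrightarrow>
     (\<exists>p. fps_X ^ k dvd fps_of_poly p - S \<and> (\<lambda>x. f x - poly p x) \<in> O[at 0](\<lambda>x. x ^ k))"

lemma power_bigo_at_0: "l \<le> k \<Longrightarrow> (\<lambda>x::real. x ^ k) \<in> O[at 0](\<lambda>x. x ^ l)"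
proof (rule bigoI[of _ 1])
  assume "l \<le> k"
  have "\<forall>\<^sub>F x :: real in at 0. \<bar>x\<bar> < 1"
    using eventually_at_ball[of 1 "0::real" UNIV] by (simp add: eventually_mono dist_norm)
  then show "\<forall>\<^sub>F x :: real in at 0. norm (x ^ k) \<le> 1 * norm (x ^ l)"
    by eventually_elim (use \<open>l \<le> k\<close> in \<open>auto simp: power_abs intro: power_decreasing\<close>)
qed

lemma poly_bigo_at_0:
  fixes p :: "real poly"
  assumes "fps_X ^ k dvd fps_of_poly p"
  shows "(\<lambda>x. poly p x) \<in> O[at 0](\<lambda>x. x ^ k)"
proof -
  have "monom 1 k dvd p"
    unfolding monom_1_dvd_iff' using assms by (auto simp: fps_X_power_dvd_iff)
  then obtain q where q: "p = monom 1 k * q" by (elim dvdE)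
  have "(\<lambda>x. poly q x) \<in> O[at 0](\<lambda>_. 1)"
    by (rule bigoI_tendsto[of _ _ "poly q 0"]) (auto intro!: tendsto_eq_intros)
  from landau_o.big_mult[OF landau_o.big_refl[of "\<lambda>x. x ^ k" "at 0"] this]
  show ?thesis by (simp add: q poly_monom)
qed

lemma expands_0_iff: "expands k f 0 \<longleftrightarrow> f \<in> O[at 0](\<lambda>x. x ^ k)"
proof
  assume "expands k f 0"
  then obtain p where p: "fps_X ^ k dvd fps_of_poly p" "(\<lambda>x. f x - poly p x) \<in> O[at 0](\<lambda>x. x ^ k)"
    by (auto simp: expands_def)
  show "f \<in> O[at 0](\<lambda>x. x ^ k)"
    using sum_in_bigo(1)[OF p(2) poly_bigo_at_0[OF p(1)]] by simp
next
  assume "f \<in> O[at 0](\<lambda>x. x ^ k)"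
  then show "expands k f 0" unfolding expands_def by (intro exI[of _ 0]) simp
qed

lemma expands_poly: "expands k (poly p) (fps_of_poly p)"
  unfolding expands_def by (intro exI[of _ p]) simp

lemma expands_const: "expands k (\<lambda>_. c) (fps_const c)"
proof -
  have "poly [:c:] = (\<lambda>_. c)" by auto
  with expands_poly[of k "[:c:]"] show ?thesis by (simp add: fps_of_poly_const)
qed

lemma expands_ident: "expands k (\<lambda>x. x) fps_X"
proof -
  have "poly [:0, 1:] = (\<lambda>x::real. x)" by auto
  with expands_poly[of k "[:0, 1:]"] show ?thesis by simp
qed

lemma expands_cong:
  assumes "expands k f S" "\<forall>\<^sub>F x in at 0. f x = g x"
  shows "expands k g S"
proof -
  obtain p where p: "fps_X ^ k dvd fps_of_poly p - S" "(\<lambda>x. f x - poly p x) \<in> O[at 0](\<lambda>x. x ^ k)"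
    using assms(1) by (auto simp: expands_def)
  have "\<forall>\<^sub>F x in at 0. f x - poly p x = g x - poly p x"
    using assms(2) by eventually_elim simp
  from landau_o.big.in_cong[OF this] p show ?thesis
    unfolding expands_def by (intro exI[of _ p]) simp
qed

lemma expands_cong_fps:
  assumes "expands k f S" "fps_X ^ k dvd S - T"
  shows "expands k f T"
proof -
  obtain p where p: "fps_X ^ k dvd fps_of_poly p - S" "(\<lambda>x. f x - poly p x) \<in> O[at 0](\<lambda>x. x ^ k)"
    using assms(1) by (auto simp: expands_def)
  have "fps_X ^ k dvd fps_of_poly p - T"
    using dvd_add[OF p(1) assms(2)] by simp
  with p(2) show ?thesis unfolding expands_def by blast
qed

lemma expands_mono: "expands k f S \<Longrightarrow> l \<le> k \<Longrightarrow> expands l f S"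
proof -
  assume l: "l \<le> k" and "expands k f S"
  then obtain p where p: "fps_X ^ k dvd fps_of_poly p - S" "(\<lambda>x. f x - poly p x) \<in> O[at 0](\<lambda>x. x ^ k)"
    unfolding expands_def by blast
  have "fps_X ^ l dvd fps_of_poly p - S"
    by (rule dvd_trans[OF le_imp_power_dvd[OF l] p(1)])
  moreover have "(\<lambda>x. f x - poly p x) \<in> O[at 0](\<lambda>x. x ^ l)"
    by (rule landau_o.big_trans[OF p(2) power_bigo_at_0[OF l]])
  ultimately show "expands l f S" unfolding expands_def by blast
qed

lemma expands_add:
  assumes "expands k f S" "expands k g T"
  shows "expands k (\<lambda>x. f x + g x) (S + T)"
proof -
  obtain p q where p: "fps_X ^ k dvd fps_of_poly p - S" "(\<lambda>x. f x - poly p x) \<in> O[at 0](\<lambda>x. x ^ k)"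
    and q: "fps_X ^ k dvd fps_of_poly q - T" "(\<lambda>x. g x - poly q x) \<in> O[at 0](\<lambda>x. x ^ k)"
    using assms by (auto simp: expands_def)
  have "fps_X ^ k dvd fps_of_poly (p + q) - (S + T)"
    using dvd_add[OF p(1) q(1)] by (simp add: fps_of_poly_add algebra_simps)
  moreover have "(\<lambda>x. f x + g x - poly (p + q) x) \<in> O[at 0](\<lambda>x. x ^ k)"
    using sum_in_bigo(1)[OF p(2) q(2)] by (simp add: algebra_simps)
  ultimately show ?thesis unfolding expands_def by blast
qed

text \<open>The error of one factor is multiplied by the size \<open>O(x ^ e)\<close> of the other.
  The gain \<open>e = 1\<close> for factors vanishing at the origin drives the inductions on
  jets.\<close>

lemma expands_mult_gen:
  assumes f: "expands k f S" and g: "expands k g T" and e: "e \<le> k"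
    and S: "fps_X ^ e dvd S" and T: "fps_X ^ e dvd T"
  shows "expands (k + e) (\<lambda>x. f x * g x) (S * T)"
proof -
  obtain p q where p: "fps_X ^ k dvd fps_of_poly p - S" "(\<lambda>x. f x - poly p x) \<in> O[at 0](\<lambda>x. x ^ k)"
    and q: "fps_X ^ k dvd fps_of_poly q - T" "(\<lambda>x. g x - poly q x) \<in> O[at 0](\<lambda>x. x ^ k)"
    using f g by (auto simp: expands_def)
  have ek: "(fps_X :: real fps) ^ e dvd fps_X ^ k" by (rule le_imp_power_dvd[OF e])
  have pe: "fps_X ^ e dvd fps_of_poly p" using dvd_add[OF dvd_trans[OF ek p(1)] S] by simp
  have qe: "fps_X ^ e dvd fps_of_poly q" using dvd_add[OF dvd_trans[OF ek q(1)] T] by simp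
  have ge: "g \<in> O[at 0](\<lambda>x. x ^ e)"
    using sum_in_bigo(1)[OF landau_o.big_trans[OF q(2) power_bigo_at_0[OF e]] poly_bigo_at_0[OF qe]] by simp
  have "fps_X ^ (k + e) dvd (fps_of_poly p - S) * fps_of_poly q + (fps_of_poly q - T) * S"
    unfolding power_add by (intro dvd_add mult_dvd_mono p q qe S)
  then have 1: "fps_X ^ (k + e) dvd fps_of_poly (p * q) - S * T"
    by (simp add: fps_of_poly_mult algebra_simps)
  have "(\<lambda>x. (f x - poly p x) * g x + (g x - poly q x) * poly p x) \<in> O[at 0](\<lambda>x. x ^ (k + e))"
    unfolding power_add by (intro sum_in_bigo landau_o.big_mult p q ge poly_bigo_at_0 pe)
  then have "(\<lambda>x. f x * g x - poly (p * q) x) \<in> O[at 0](\<lambda>x. x ^ (k + e))"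
    by (simp add: algebra_simps)
  with 1 show ?thesis unfolding expands_def by blast
qed

lemma expands_mult: "expands k f S \<Longrightarrow> expands k g T \<Longrightarrow> expands k (\<lambda>x. f x * g x) (S * T)"
  using expands_mult_gen[of k f S g T 0] by simp

lemma expands_mult_Suc:
  "expands k f S \<Longrightarrow> expands k g T \<Longrightarrow> k \<ge> 1 \<Longrightarrow> S $ 0 = 0 \<Longrightarrow> T $ 0 = 0 \<Longrightarrow>
    expands (Suc k) (\<lambda>x. f x * g x) (S * T)"
  using expands_mult_gen[of k f S g T 1] by (simp add: fps_X_dvd_iff)

lemma expands_cmult: "expands k f S \<Longrightarrow> expands k (\<lambda>x. c * f x) (fps_const c * S)"
  by (rule expands_mult[OF expands_const])

lemma expands_uminus: "expands k f S \<Longrightarrow> expands k (\<lambda>x. - f x) (- S)"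
  using expands_cmult[of k f S "-1"] by (simp add: fps_const_neg[symmetric] del: fps_const_neg)

lemma expands_diff:
  "expands k f S \<Longrightarrow> expands k g T \<Longrightarrow> expands k (\<lambda>x. f x - g x) (S - T)"
  using expands_add[of k f S "\<lambda>x. - g x" "- T"] by (simp add: expands_uminus)

lemma expands_sum:
  "finite A \<Longrightarrow> (\<And>i. i \<in> A \<Longrightarrow> expands k (f i) (S i)) \<Longrightarrow>
    expands k (\<lambda>x. \<Sum>i\<in>A. f i x) (\<Sum>i\<in>A. S i)"
proof (induction A rule: finite_induct)
  case empty
  then show ?case using expands_const[of k 0] by simp
qed (simp add: expands_add)

lemma expands_power: "expands k f S \<Longrightarrow> expands k (\<lambda>x. f x ^ m) (S ^ m)"
proof (induction m)
  case 0
  then show ?case using expands_const[of k 1] by simp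
qed (simp add: expands_mult)

text \<open>With \<open>p = x ^ k * q\<close>, the bound \<open>O(x ^ Suc k)\<close> forces
  \<open>q\<close> to vanish at 0, so each step removes one more coefficient.\<close>

lemma expands_zero_unique:
  assumes "expands k (\<lambda>_. 0) S"
  shows "fps_X ^ k dvd S"
  using assms
proof (induction k arbitrary: S)
  case (Suc k)
  have S: "fps_X ^ k dvd S" using Suc.IH[OF expands_mono[OF Suc.prems]] by simp
  obtain p where p: "fps_X ^ Suc k dvd fps_of_poly p - S" "(\<lambda>x. 0 - poly p x) \<in> O[at 0](\<lambda>x. x ^ Suc k)"
    using Suc.prems unfolding expands_def by blast
  have "fps_X ^ k dvd fps_of_poly p"
    using dvd_add[OF dvd_trans[OF _ p(1)] S] by (simp add: le_imp_power_dvd)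
  then have "monom 1 k dvd p"
    unfolding monom_1_dvd_iff' by (auto simp: fps_X_power_dvd_iff)
  then obtain q where q: "p = monom 1 k * q" by (elim dvdE)
  obtain c where c: "\<forall>\<^sub>F x in at 0. norm (0 - poly p x) \<le> c * norm (x ^ Suc k)"
    using p(2) by (elim landau_o.bigE)
  have "\<forall>\<^sub>F x in at 0. norm (poly q x) \<le> c * \<bar>x\<bar>"
    using c eventually_neq_at_within[of 0]
  proof eventually_elim
    case (elim x)
    then have "\<bar>x\<bar> ^ k * norm (poly q x) \<le> \<bar>x\<bar> ^ k * (c * \<bar>x\<bar>)"
      by (simp add: q poly_monom abs_mult power_abs mult_ac)
    then show ?case using elim by simp
  qed
  moreover have "((\<lambda>x. c * \<bar>x\<bar>) \<longlongrightarrow> 0) (at (0::real))"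
    by (auto intro!: tendsto_eq_intros)
  ultimately have "((\<lambda>x. poly q x) \<longlongrightarrow> 0) (at 0)"
    by (rule Lim_null_comparison)
  moreover have "((\<lambda>x. poly q x) \<longlongrightarrow> poly q 0) (at 0)"
    by (auto intro!: tendsto_eq_intros)
  ultimately have "poly q 0 = 0" using LIM_unique by blast
  then have "fps_X dvd fps_of_poly q" by (simp add: fps_X_dvd_iff poly_0_coeff_0)
  then have "fps_X ^ Suc k dvd fps_of_poly p"
    unfolding q fps_of_poly_mult fps_of_poly_monom' power_Suc2 by (intro mult_dvd_mono) auto
  from dvd_diff[OF this p(1)] show ?case by simp
qed simp

lemma expands_unique:
  assumes "expands k f S" "expands k f T"
  shows "fps_X ^ k dvd S - T"
  using expands_diff[OF assms] by (intro expands_zero_unique) simp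

lemma expands_zero_const:
  assumes "expands k f S" "k \<ge> 1" "expands 1 f 0"
  shows "S $ 0 = 0"
  using expands_unique[OF expands_mono[OF assms(1,2)] assms(3)] by (simp add: fps_X_dvd_iff)

text \<open>A monomial of degree at least two splits into two factors vanishing at the origin, which
  gains one order.\<close>

lemma expands_monomial:
  assumes \<phi>: "expands k \<phi> S" and \<psi>: "expands k \<psi> T" and k: "k \<ge> 1"
    and S: "S $ 0 = 0" and T: "T $ 0 = 0"
  shows "expands k (\<lambda>x. x ^ i * \<phi> x ^ j * \<psi> x ^ l) (fps_X ^ i * S ^ j * T ^ l)"
    and "i + j + l \<ge> 2 \<Longrightarrow> expands (Suc k) (\<lambda>x. x ^ i * \<phi> x ^ j * \<psi> x ^ l) (fps_X ^ i * S ^ j * T ^ l)"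
proof -
  show m: "expands k (\<lambda>x. x ^ i * \<phi> x ^ j * \<psi> x ^ l) (fps_X ^ i * S ^ j * T ^ l)" for i j l
    by (intro expands_mult expands_power \<phi> \<psi> expands_ident)
  have z: "(fps_X ^ i * S ^ j * T ^ l) $ 0 = 0" if "i + j + l \<ge> 1" for i j l
    using that S T by (auto simp: fps_power_zeroth)
  assume "i + j + l \<ge> 2"
  then consider i' where "i = Suc i'" "i' + j + l \<ge> 1" | j' where "j = Suc j'" "i + j' + l \<ge> 1"
    | l' where "l = Suc l'" "i + j + l' \<ge> 1"
    by (cases i; cases j; cases l) auto
  then show "expands (Suc k) (\<lambda>x. x ^ i * \<phi> x ^ j * \<psi> x ^ l) (fps_X ^ i * S ^ j * T ^ l)"
  proof cases
    case 1
    then show ?thesis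
      using expands_mult_Suc[OF expands_ident m k _ z[OF 1(2)]] by (simp add: mult_ac)
  next
    case 2
    then show ?thesis
      using expands_mult_Suc[OF \<phi> m k S z[OF 2(2)]] by (simp add: mult_ac)
  next
    case 3
    then show ?thesis
      using expands_mult_Suc[OF \<psi> m k T z[OF 3(2)]] by (simp add: mult_ac)
  qed
qed

text \<open>For \<open>e = 1\<close> there are no constant and linear terms, so expansions of
  \<open>\<phi>\<close> and \<open>\<psi>\<close> modulo \<open>x ^ k\<close> determine the
  composition modulo \<open>x ^ (k + 1)\<close>.\<close>

lemma expands_subst3_gen:
  assumes G: "has_fps3_expansion G Gs"
    and \<phi>: "expands k \<phi> S" and \<psi>: "expands k \<psi> T" and k: "k \<ge> 1"
    and S: "S $ 0 = 0" and T: "T $ 0 = 0"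
    and e: "e = 0 \<or> e = 1 \<and> jet3 1 Gs = 0"
  shows "expands (k + e) (\<lambda>x. G (x, \<phi> x, \<psi> x)) (subst3 (\<lambda>x. x) S T Gs)"
proof -
  \<comment> \<open>One more than \<open>k\<close>, so that truncation is harmless up to order
    \<open>k + e\<close> in both cases.\<close>
  define D where "D = Suc k"
  let ?s = "\<lambda>w :: real \<times> real \<times> real. case w of (x, y, z) \<Rightarrow>
    (\<Sum>l\<le>D. \<Sum>j\<le>D. \<Sum>i\<le>D. coeff3 Gs i j l * x ^ i * y ^ j * z ^ l)"
  interpret subst3_ring_hom "\<lambda>x. x" S T
    by standard (simp_all add: is_ring_hom_id S T)
  have mon: "expands (k + e) (\<lambda>x. coeff3 Gs i j l * x ^ i * \<phi> x ^ j * \<psi> x ^ l)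
     (fps_const (coeff3 Gs i j l) * fps_X ^ i * S ^ j * T ^ l)" for i j l
  proof -
    consider "e = 0" | "e = 1" "coeff3 Gs i j l = 0" | "e = 1" "i + j + l \<ge> 2"
      using e jet3_1_zeroD[of Gs i j l] by linarith
    then show ?thesis
    proof cases
      case 1
      then show ?thesis
        using expands_cmult[OF expands_monomial(1)[OF \<phi> \<psi> k S T]] by (simp add: mult.assoc)
    next
      case 2
      then show ?thesis using expands_const[of _ 0] by simp
    next
      case 3
      then show ?thesis
        using expands_cmult[OF expands_monomial(2)[OF \<phi> \<psi> k S T]] by (simp add: mult.assoc)
    qed
  qed
  have "expands (k + e) (\<lambda>x. ?s (x, \<phi> x, \<psi> x))
     (\<Sum>l\<le>D. \<Sum>j\<le>D. \<Sum>i\<le>D. fps_const (coeff3 Gs i j l) * fps_X ^ i * S ^ j * T ^ l)"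
    unfolding prod.case by (intro expands_sum mon) auto
  moreover have "fps_X ^ (k + e) dvd
     (\<Sum>l\<le>D. \<Sum>j\<le>D. \<Sum>i\<le>D. fps_const (coeff3 Gs i j l) * fps_X ^ i * S ^ j * T ^ l)
       - subst3 (\<lambda>x. x) S T Gs"
    unfolding fps_X_power_dvd_iff using nth_expand[of _ D Gs] e by (auto simp: D_def)
  ultimately have main: "expands (k + e) (\<lambda>x. ?s (x, \<phi> x, \<psi> x)) (subst3 (\<lambda>x. x) S T Gs)"
    by (rule expands_cong_fps)
  obtain \<rho> C where \<rho>: "\<rho> > 0" and C: "\<And>t x y z. t < \<rho> \<Longrightarrow> \<bar>x\<bar> \<le> t \<Longrightarrow> \<bar>y\<bar> \<le> t \<Longrightarrow> \<bar>z\<bar> \<le> t \<Longrightarrow>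
      \<bar>G (x, y, z) - (\<Sum>l\<le>D. \<Sum>j\<le>D. \<Sum>i\<le>D. coeff3 Gs i j l * x ^ i * y ^ j * z ^ l)\<bar> \<le> C * t ^ Suc D"
    using fps3_remainder[OF G, of D] by blast
  have "\<phi> \<in> O[at 0](\<lambda>x. x ^ 1)" "\<psi> \<in> O[at 0](\<lambda>x. x ^ 1)"
    using expands_cong_fps[OF expands_mono[OF \<phi> k], of 0] expands_cong_fps[OF expands_mono[OF \<psi> k], of 0] S T
    unfolding expands_0_iff[symmetric] by (simp_all add: fps_X_dvd_iff)
  then obtain c d where c: "\<forall>\<^sub>F x in at 0. norm (\<phi> x) \<le> c * norm (x ^ 1)"
    and d: "\<forall>\<^sub>F x in at 0. norm (\<psi> x) \<le> d * norm (x ^ 1)"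
    by (elim landau_o.bigE) blast
  \<comment> \<open>Encloses the curve in the box of half-width \<open>L * \<bar>x\<bar>\<close>,
    the value of \<open>t\<close> in the remainder estimate; the 1 accounts for \<open>x\<close>
    itself.\<close>
  define L where "L = max 1 (max c d)"
  have "((\<lambda>x. L * \<bar>x\<bar>) \<longlongrightarrow> 0) (at (0::real))" by (auto intro!: tendsto_eq_intros)
  then have "\<forall>\<^sub>F x in at (0::real). L * \<bar>x\<bar> < \<rho>" using \<rho> by (rule order_tendstoD)
  with c d have "\<forall>\<^sub>F x in at 0. norm (G (x, \<phi> x, \<psi> x) - ?s (x, \<phi> x, \<psi> x)) \<le> (C * L ^ Suc D) * norm (x ^ Suc D)"
  proof eventually_elim
    case (elim x)
    have "c * \<bar>x\<bar> \<le> L * \<bar>x\<bar>" "d * \<bar>x\<bar> \<le> L * \<bar>x\<bar>" "1 * \<bar>x\<bar> \<le> L * \<bar>x\<bar>"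
      by (intro mult_right_mono; simp add: L_def)+
    with elim have "\<bar>x\<bar> \<le> L * \<bar>x\<bar>" "\<bar>\<phi> x\<bar> \<le> L * \<bar>x\<bar>" "\<bar>\<psi> x\<bar> \<le> L * \<bar>x\<bar>" by auto
    from C[OF elim(3) this] show ?case
      by (simp add: power_mult_distrib power_abs abs_mult mult_ac)
  qed
  then have "(\<lambda>x. G (x, \<phi> x, \<psi> x) - ?s (x, \<phi> x, \<psi> x)) \<in> O[at 0](\<lambda>x. x ^ Suc D)"
    by (rule bigoI)
  then have "expands (k + e) (\<lambda>x. G (x, \<phi> x, \<psi> x) - ?s (x, \<phi> x, \<psi> x)) 0"
    unfolding expands_0_iff
    by (rule landau_o.big_trans) (use e in \<open>auto intro!: power_bigo_at_0 simp: D_def simp del: power_Suc\<close>)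
  from expands_add[OF this main] show ?thesis by simp
qed

lemma
  assumes "has_fps3_expansion G Gs" "expands k \<phi> S" "expands k \<psi> T" "k \<ge> 1" "S $ 0 = 0" "T $ 0 = 0"
  shows expands_subst3: "expands k (\<lambda>x. G (x, \<phi> x, \<psi> x)) (subst3 (\<lambda>x. x) S T Gs)"
    and expands_subst3_Suc: "jet3 1 Gs = 0 \<Longrightarrow>
      expands (Suc k) (\<lambda>x. G (x, \<phi> x, \<psi> x)) (subst3 (\<lambda>x. x) S T Gs)"
  using expands_subst3_gen[OF assms, of 0] expands_subst3_gen[OF assms, of 1] by simp_all

section \<open>The nullcline on a center manifold\<close>

lemma class_C_continuous_on:
  assumes "class_C r U g"
  shows "continuous_on U g"
proof (cases r)
  case (Suc m)
  then have "g differentiable (at w)" if "w \<in> U" for w using assms that by simp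
  then show ?thesis
    by (intro continuous_at_imp_continuous_on ballI differentiable_imp_continuous_within)
qed (use assms in simp)

lemma frechet_derivative_prod:
  fixes g :: "real \<times> real \<Rightarrow> real"
  assumes "g differentiable (at w)"
  shows "frechet_derivative g (at w) (a, b)
    = a * frechet_derivative g (at w) (1, 0) + b * frechet_derivative g (at w) (0, 1)"
proof -
  interpret linear "frechet_derivative g (at w)"
    by (rule linear_frechet_derivative[OF assms])
  have "(a, b) = a *\<^sub>R (1, 0) + b *\<^sub>R (0, 1)" by simp
  then show ?thesis by (simp only: add scale real_scaleR_def)
qed

text \<open>The orbit satisfies \<open>z(t) = h(x(t), y(t))\<close>; both sides are differentiated
  at the interior time \<open>t = 0\<close>.\<close>

lemma invariant_graph_equation:
  fixes h :: "real \<times> real \<Rightarrow> real"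
  assumes h: "h differentiable (at w)" and \<epsilon>: "\<epsilon> > 0" and u0: "u 0 = graph_pt h w"
    and ode: "solves_ode_on X u {-\<epsilon><..<\<epsilon>}"
    and inv: "\<And>t. t \<in> {-\<epsilon><..<\<epsilon>} \<Longrightarrow> u t \<in> graph_pt h ` U"
  shows "snd (snd (X (graph_pt h w))) =
    frechet_derivative h (at w) (fst (X (graph_pt h w)), fst (snd (X (graph_pt h w))))"
proof -
  let ?D = "frechet_derivative h (at w)"
  let ?v = "X (graph_pt h w)"
  have 0: "0 \<in> {-\<epsilon><..<\<epsilon>}" using \<epsilon> by simp
  then have "(u has_vector_derivative ?v) (at 0 within {-\<epsilon><..<\<epsilon>})"
    using ode u0 unfolding solves_ode_on_def by force
  then have u: "(u has_derivative (\<lambda>t. t *\<^sub>R ?v)) (at 0)"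
    using at_within_open[OF 0] by (simp add: has_vector_derivative_def)
  define \<pi> where "\<pi> = (\<lambda>t. (fst (u t), fst (snd (u t))))"
  have \<pi>: "(\<pi> has_derivative (\<lambda>t. (fst (t *\<^sub>R ?v), fst (snd (t *\<^sub>R ?v))))) (at 0)"
    unfolding \<pi>_def by (intro has_derivative_Pair has_derivative_fst has_derivative_snd u)
  have \<pi>0: "\<pi> 0 = w" by (cases w) (simp add: \<pi>_def u0 graph_pt_def)
  have z: "snd (snd (u t)) = h (\<pi> t)" if "t \<in> {-\<epsilon><..<\<epsilon>}" for t
    using inv[OF that] by (auto simp: graph_pt_def \<pi>_def)
  have "(h has_derivative ?D) (at (\<pi> 0))"
    unfolding \<pi>0 using h by (simp add: frechet_derivative_works)
  from has_derivative_compose[OF \<pi> this]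
  have "((\<lambda>t. h (\<pi> t)) has_derivative (\<lambda>t. ?D (fst (t *\<^sub>R ?v), fst (snd (t *\<^sub>R ?v))))) (at 0)" .
  moreover have "((\<lambda>t. h (\<pi> t)) has_derivative (\<lambda>t. snd (snd (t *\<^sub>R ?v)))) (at 0)"
    by (rule has_derivative_transform_within_open[OF has_derivative_snd[OF has_derivative_snd[OF u]] _ 0])
      (use z in auto)
  ultimately have "(\<lambda>t. ?D (fst (t *\<^sub>R ?v), fst (snd (t *\<^sub>R ?v)))) = (\<lambda>t. snd (snd (t *\<^sub>R ?v)))"
    by (rule has_derivative_unique)
  from fun_cong[OF this, of 1] show ?thesis by simp
qed

text \<open>Bootstrap from \<open>F = - P\<close> and from \<open>\<eta> = R / lam\<close> up to a
  known error: \<open>P\<close> and \<open>R\<close> have no linear part, so each round gains one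
  order. The jet of \<open>F\<close> thus comes from the equations, not from smoothness.\<close>

lemma expands_nullcline:
  fixes F \<eta> :: "real \<Rightarrow> real" and P R :: "real \<times> real \<times> real \<Rightarrow> real"
  assumes P: "has_fps3_expansion P Ps" "jet3 1 Ps = 0" and R: "has_fps3_expansion R Rs" "jet3 1 Rs = 0"
    and lam: "lam \<noteq> 0" and F1: "expands 1 F 0" and \<eta>1: "expands 1 \<eta> 0"
    and eq1: "\<forall>\<^sub>F x in at 0. F x + P (x, F x, \<eta> x) = 0"
    and eq2: "expands m (\<lambda>x. - lam * \<eta> x + R (x, F x, \<eta> x)) 0"
    and k: "1 \<le> k" "k \<le> m"
  shows "\<exists>S T. expands k F S \<and> expands k \<eta> T"
  using k
proof (induction k rule: dec_induct)
  case base
  then show ?case using F1 \<eta>1 by blast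
next
  case (step k)
  then obtain S T where S: "expands k F S" and T: "expands k \<eta> T" by auto
  have S0: "S $ 0 = 0" and T0: "T $ 0 = 0"
    using expands_zero_const[OF S step(1) F1] expands_zero_const[OF T step(1) \<eta>1] .
  note sub = expands_subst3_Suc[OF _ S T step(1) S0 T0]
  have "expands (Suc k) (\<lambda>x. - P (x, F x, \<eta> x)) (- subst3 (\<lambda>x. x) S T Ps)"
    by (rule expands_uminus[OF sub[OF P]])
  then have 1: "expands (Suc k) F (- subst3 (\<lambda>x. x) S T Ps)"
    by (rule expands_cong) (use eq1 in \<open>eventually_elim; simp\<close>)
  have "expands (Suc k) (\<lambda>x. (1 / lam) * (R (x, F x, \<eta> x) - (- lam * \<eta> x + R (x, F x, \<eta> x))))
      (fps_const (1 / lam) * (subst3 (\<lambda>x. x) S T Rs - 0))"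
    using step.prems by (intro expands_cmult expands_diff sub[OF R] expands_mono[OF eq2]) auto
  then have "expands (Suc k) \<eta> (fps_const (1 / lam) * (subst3 (\<lambda>x. x) S T Rs - 0))"
    using lam by simp
  with 1 show ?case by blast
qed

text \<open>\<open>\<sigma>\<close> and \<open>\<tau>\<close> stand for \<open>h_y\<close> and
  \<open>h_x\<close> on the curve. Solved for \<open>lam * \<sigma>\<close> and
  \<open>lam * \<tau>\<close>, the equations contain the unknowns only multiplied by functions
  vanishing at the origin, except for one bare \<open>\<tau>\<close> in the first.\<close>

lemma expands_gradient:
  fixes \<sigma> \<tau> px py pz qx qy qz rx ry rz :: "real \<Rightarrow> real"
  assumes lam: "lam \<noteq> 0" and \<sigma>1: "expands 1 \<sigma> 0" and \<tau>1: "expands 1 \<tau> 0"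
    and px: "expands m px PX" "PX $ 0 = 0" and py: "expands m py PY" "PY $ 0 = 0"
    and pz: "expands m pz PZ" "PZ $ 0 = 0" and qx: "expands m qx QX" "QX $ 0 = 0"
    and qy: "expands m qy QY" "QY $ 0 = 0" and qz: "expands m qz QZ" "QZ $ 0 = 0"
    and rx: "expands m rx RX" and ry: "expands m ry RY" and rz: "expands m rz RZ" "RZ $ 0 = 0"
    and eq1: "expands m (\<lambda>x. - lam * \<sigma> x + ry x + rz x * \<sigma> x
       - \<tau> x * (1 + py x + pz x * \<sigma> x) - \<sigma> x * (qy x + qz x * \<sigma> x)) 0"
    and eq2: "expands m (\<lambda>x. - lam * \<tau> x + rx x + rz x * \<tau> x
       - \<tau> x * (px x + pz x * \<tau> x) - \<sigma> x * (qx x + qz x * \<tau> x)) 0"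
    and k: "1 \<le> k" "k \<le> m"
  shows "\<exists>S U. expands k \<sigma> S \<and> expands k \<tau> U"
  using k
proof (induction k rule: dec_induct)
  case base
  then show ?case using \<sigma>1 \<tau>1 by blast
next
  case (step k)
  then obtain S U where S: "expands k \<sigma> S" and U: "expands k \<tau> U" by auto
  have S0: "S $ 0 = 0" and U0: "U $ 0 = 0"
    using expands_zero_const[OF S step(1) \<sigma>1] expands_zero_const[OF U step(1) \<tau>1] .
  have km: "k \<le> m" "Suc k \<le> m" using step.prems by auto
  note mul = expands_mult_Suc[OF _ _ step(1)]
  note mo = expands_mono[OF _ km(1)] and mo' = expands_mono[OF _ km(2)]
  have inner: "expands k (\<lambda>x. f x + g x * w x) (A + B * W)"
    if "expands m f A" "expands m g B" "expands k w W" for f g w A B W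
    by (intro expands_add expands_mult mo that)
  have 1: "expands (Suc k) (\<lambda>x. w x * (f x + g x * w' x)) (W * (A + B * W'))"
    if "expands m f A" "A $ 0 = 0" "expands m g B" "B $ 0 = 0" "expands k w W" "W $ 0 = 0"
      "expands k w' W'" for f g w w' A B W W'
    by (rule mul[OF that(5) inner[OF that(1,3,7)] that(6)]) (use that in simp)
  have "expands (Suc k) (\<lambda>x. (1 / lam) * (rx x + rz x * \<tau> x
       - \<tau> x * (px x + pz x * \<tau> x) - \<sigma> x * (qx x + qz x * \<tau> x)
       - (- lam * \<tau> x + rx x + rz x * \<tau> x - \<tau> x * (px x + pz x * \<tau> x) - \<sigma> x * (qx x + qz x * \<tau> x))))
     (fps_const (1 / lam) * (RX + RZ * U - U * (PX + PZ * U) - S * (QX + QZ * U) - 0))"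
    by (rule expands_cmult expands_diff)+
      (rule expands_add[OF mo'[OF rx] mul[OF mo[OF rz(1)] U rz(2) U0]]
        1[OF px pz U U0 U] 1[OF qx qz S S0 U] mo'[OF eq2])+
  moreover have "(1 / lam) * (rx x + rz x * \<tau> x
       - \<tau> x * (px x + pz x * \<tau> x) - \<sigma> x * (qx x + qz x * \<tau> x)
       - (- lam * \<tau> x + rx x + rz x * \<tau> x - \<tau> x * (px x + pz x * \<tau> x) - \<sigma> x * (qx x + qz x * \<tau> x))) = \<tau> x" for x
    using lam by (simp add: field_simps)
  ultimately obtain U' where U': "expands (Suc k) \<tau> U'" by (simp only:)
  \<comment> \<open>The bare \<open>\<tau>\<close> requires the improved expansion
    \<open>U'\<close>, which is why \<open>\<tau>\<close> is improved before
    \<open>\<sigma>\<close>.\<close>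
  have "expands (Suc k) (\<lambda>x. (1 / lam) * (ry x + rz x * \<sigma> x
       - (\<tau> x + \<tau> x * (py x + pz x * \<sigma> x)) - \<sigma> x * (qy x + qz x * \<sigma> x)
       - (- lam * \<sigma> x + ry x + rz x * \<sigma> x - \<tau> x * (1 + py x + pz x * \<sigma> x) - \<sigma> x * (qy x + qz x * \<sigma> x))))
     (fps_const (1 / lam) * (RY + RZ * S - (U' + U * (PY + PZ * S)) - S * (QY + QZ * S) - 0))"
    by (rule expands_cmult expands_diff)+
      (rule expands_add[OF mo'[OF ry] mul[OF mo[OF rz(1)] S rz(2) S0]]
        expands_add[OF U' 1[OF py pz U U0 S]] 1[OF qy qz S S0 S] mo'[OF eq1])+
  moreover have "(1 / lam) * (ry x + rz x * \<sigma> x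
       - (\<tau> x + \<tau> x * (py x + pz x * \<sigma> x)) - \<sigma> x * (qy x + qz x * \<sigma> x)
       - (- lam * \<sigma> x + ry x + rz x * \<sigma> x - \<tau> x * (1 + py x + pz x * \<sigma> x) - \<sigma> x * (qy x + qz x * \<sigma> x))) = \<sigma> x" for x
    using lam by (simp add: field_simps)
  ultimately obtain S' where "expands (Suc k) \<sigma> S'" by (simp only:)
  with U' show ?case by blast
qed

section \<open>First-order bounds that start the bootstrap\<close>

lemma differentiable_bound_at_0:
  fixes g :: "'a::real_normed_vector \<Rightarrow> real"
  assumes "g differentiable (at 0)" "g 0 = 0"
  shows "\<exists>C. \<forall>\<^sub>F w in nhds 0. \<bar>g w\<bar> \<le> C * norm w"
proof -
  obtain g' where g': "(g has_derivative g') (at 0)" using assms(1) by (auto simp: differentiable_def)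
  then obtain d where d: "d > 0" "\<And>y. norm y < d \<Longrightarrow> \<bar>g y - g' y\<bar> \<le> norm y"
    using assms(2) unfolding has_derivative_at_alt by (auto dest: spec[of _ 1])
  interpret bounded_linear g' using g' by (rule has_derivative_bounded_linear)
  obtain K where K: "\<And>y. \<bar>g' y\<bar> \<le> norm y * K" using bounded by auto
  have "\<forall>\<^sub>F w in nhds (0::'a). norm w < d"
    using d(1) by (auto simp: eventually_nhds_metric dist_norm)
  then have "\<forall>\<^sub>F w in nhds 0. \<bar>g w\<bar> \<le> (1 + K) * norm w"
  proof eventually_elim
    case (elim w)
    then show ?case using d(2)[OF elim] K[of w] by (simp add: algebra_simps)
  qed
  then show ?thesis by blast
qed

lemma jet3_1_quadratic:
  assumes G: "has_fps3_expansion G S" and S: "jet3 1 S = 0"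
  obtains \<rho> C where "\<rho> > 0"
    "\<And>t x y z. t < \<rho> \<Longrightarrow> \<bar>x\<bar> \<le> t \<Longrightarrow> \<bar>y\<bar> \<le> t \<Longrightarrow> \<bar>z\<bar> \<le> t \<Longrightarrow> \<bar>G (x, y, z)\<bar> \<le> C * t ^ 2"
proof -
  have 2: "2 \<le> i + j + k" if "coeff3 S i j k \<noteq> 0" for i j k
    using jet3_1_zeroD[OF S, of i j k] that by linarith
  show ?thesis
    by (rule fps3_remainder_gen[OF G finite.emptyI, of 2], erule 2, rule that, assumption)
      (simp only: sum.empty diff_zero)
qed

text \<open>By \<open>expands_subst3_Suc\<close> the curve may be replaced by the
  \<open>x\<close>-axis modulo \<open>x ^ 2\<close>. This serves to exclude
  \<open>n = 1\<close>.\<close>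

lemma expands_jet3_1:
  assumes G: "has_fps3_expansion G S" "jet3 1 S = 0" and \<phi>: "expands 1 \<phi> 0" and \<psi>: "expands 1 \<psi> 0"
  shows "expands 2 (\<lambda>x. G (x, \<phi> x, \<psi> x)) 0"
proof -
  interpret subst3_ring_hom "\<lambda>x. x" 0 0
    by standard (simp_all add: is_ring_hom_id)
  have "fps_deriv (subst3 (\<lambda>x. x) 0 0 S) $ 0 = 0"
    using derivation[OF fps_derivation_deriv, of 1 S] jet3_1_zeroD[OF G(2), of 1 0 0]
    by (simp add: nth_0 coeff3_dx3)
  then have "\<forall>i<2. subst3 (\<lambda>x. x) 0 0 S $ i = 0"
    using jet3_1_zeroD[OF G(2), of 0 0 0] by (auto simp: nth_0 less_2_cases_iff)
  then have "fps_X ^ 2 dvd subst3 (\<lambda>x. x) 0 0 S - 0"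
    by (simp add: fps_X_power_dvd_iff)
  with expands_subst3_Suc[OF G(1) \<phi> \<psi> _ _ _ G(2)] show ?thesis
    by (simp add: expands_cong_fps numeral_2_eq_2)
qed

text \<open>For \<open>s = |x| + |F x|\<close> the quadratic bound gives
  \<open>|F x| \<le> C * s ^ 2\<close>, and continuity makes
  \<open>(|C| + 1) * s \<le> 1 / 2\<close>; then \<open>|F x| \<le> s / 2\<close>, that is
  \<open>|F x| \<le> |x|\<close>.\<close>

lemma expands_nullcline_1:
  fixes h :: "real \<times> real \<Rightarrow> real" and F :: "real \<Rightarrow> real"
  assumes P: "has_fps3_expansion P Ps" "jet3 1 Ps = 0"
    and h: "h 0 = 0" "(h has_derivative (\<lambda>_. 0)) (at 0)"
    and F: "F 0 = 0" "isCont F 0"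
    and eq: "\<forall>\<^sub>F x in at 0. F x + P (x, F x, h (x, F x)) = 0"
  shows "expands 1 F 0" and "expands 1 (\<lambda>x. h (x, F x)) 0"
proof -
  obtain \<rho> C where \<rho>: "\<rho> > 0" and C: "\<And>t x y z. t < \<rho> \<Longrightarrow> \<bar>x\<bar> \<le> t \<Longrightarrow> \<bar>y\<bar> \<le> t \<Longrightarrow> \<bar>z\<bar> \<le> t \<Longrightarrow>
      \<bar>P (x, y, z)\<bar> \<le> C * t ^ 2"
    using jet3_1_quadratic[OF P] by blast
  obtain d where d: "d > 0" "\<And>w. norm w < d \<Longrightarrow> \<bar>h w\<bar> \<le> norm w"
    using h unfolding has_derivative_at_alt by (auto dest: spec[of _ 1])
  define s where "s = (\<lambda>x. \<bar>x\<bar> + \<bar>F x\<bar>)"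
  have "(s \<longlongrightarrow> 0) (at 0)"
    unfolding s_def using F by (auto intro!: tendsto_eq_intros simp: isCont_def)
  then have "\<forall>\<^sub>F x in at 0. s x < min \<rho> (min d (1 / (2 * (\<bar>C\<bar> + 1))))"
    using \<rho> d(1) by (intro order_tendstoD) auto
  with eq have *: "\<forall>\<^sub>F x in at 0. \<bar>F x\<bar> \<le> 1 * \<bar>x\<bar> \<and> \<bar>h (x, F x)\<bar> \<le> 2 * \<bar>x\<bar>"
  proof eventually_elim
    case (elim x)
    have n: "norm (x, F x) \<le> s x"
      using norm_Pair_le[of x "F x"] by (simp add: s_def)
    have hs: "\<bar>h (x, F x)\<bar> \<le> s x" using d(2)[of "(x, F x)"] n elim(2) by simp
    have s0: "0 \<le> s x" by (simp add: s_def)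
    have "\<bar>F x\<bar> = \<bar>P (x, F x, h (x, F x))\<bar>" using elim(1) by linarith
    also have "\<dots> \<le> C * s x ^ 2"
      using elim(2) hs by (intro C) (auto simp: s_def)
    also have "\<dots> \<le> (\<bar>C\<bar> + 1) * s x ^ 2" by (intro mult_right_mono) auto
    also have "\<dots> = ((\<bar>C\<bar> + 1) * s x) * s x" by (simp add: power2_eq_square)
    also have "(\<bar>C\<bar> + 1) * s x \<le> 1 / 2" using elim(2) by (simp add: field_simps)
    then have "((\<bar>C\<bar> + 1) * s x) * s x \<le> 1 / 2 * s x" using s0 by (rule mult_right_mono)
    finally have "\<bar>F x\<bar> \<le> \<bar>x\<bar>" by (simp add: s_def)
    with hs show ?case by (simp add: s_def)
  qed
  show "expands 1 F 0" unfolding expands_0_iff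
    by (rule bigoI[of _ 1]) (use * in \<open>eventually_elim; simp\<close>)
  show "expands 1 (\<lambda>x. h (x, F x)) 0" unfolding expands_0_iff
    by (rule bigoI[of _ 2]) (use * in \<open>eventually_elim; simp\<close>)
qed

lemma leading_term_expands:
  assumes "leading_term g c m"
  shows "expands (m + 1) g (fps_const c * fps_X ^ m)"
  unfolding expands_def
  by (rule exI[of _ "monom c m"])
    (use assms in \<open>simp add: leading_term_def fps_of_poly_monom poly_monom\<close>)

section \<open>Jets of the given center manifold along the curve\<close>

theorem theorem34:
  fixes lam a b :: real
    and P Q R :: "real \<times> real \<times> real \<Rightarrow> real"
    and Ps Qs Rs :: fps3
    and h p q :: "real \<times> real \<Rightarrow> real"
    and F :: "real \<Rightarrow> real"
    and r n \<alpha> \<beta> :: nat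
  assumes "lam \<noteq> 0"
    and "has_fps3_expansion P Ps" and "has_fps3_expansion Q Qs" and "has_fps3_expansion R Rs"
    and "jet3 1 Ps = 0" and "jet3 1 Qs = 0" and "jet3 1 Rs = 0"
    and "center_manifold r (system_field lam P Q R) h"
    and "p = restricted P h" and "q = restricted Q h"
    and "monodromic (planar_field p q)"
    and "solves_nullcline p F"
    and "leading_term (f_fun q F) a \<alpha>" and "\<alpha> < r"
    and "leading_term (Phi_fun p q F) b \<beta>"
    and "n \<ge> 1" and "a < 0" and "\<alpha> = 2 * n - 1"
    and "\<beta> = n - 1" and "b\<^sup>2 + 4 * a * real n < 0"
  shows "\<not> (\<exists>H. formal_first_integral lam Ps Qs Rs H)"
proof -
  note lam = assms(1) and P = assms(2,5) and Q = assms(3,6) and R = assms(4,7)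
  define \<eta> where "\<eta> = (\<lambda>x. h (x, F x))"
  define \<kappa> where "\<kappa> = (\<lambda>x. (x, F x))"
  define \<gamma> where "\<gamma> = (\<lambda>x. (x, F x, \<eta> x))"
  have gp: "graph_pt h (\<kappa> x) = \<gamma> x" for x
    by (simp add: graph_pt_def \<kappa>_def \<gamma>_def \<eta>_def)
  obtain U where h0: "h 0 = 0" "(h has_derivative (\<lambda>_. 0)) (at 0)"
    and U: "open U" "0 \<in> U" "class_C r U h"
    and inv: "\<And>w. w \<in> U \<Longrightarrow> \<exists>\<epsilon>>0. \<exists>u. u 0 = graph_pt h w \<and>
        solves_ode_on (system_field lam P Q R) u {-\<epsilon><..<\<epsilon>} \<and> (\<forall>t\<in>{-\<epsilon><..<\<epsilon>}. u t \<in> graph_pt h ` U)"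
    using assms(8) unfolding center_manifold_def by blast
  have F0: "F 0 = 0" and evF: "\<forall>\<^sub>F x in nhds 0. isCont F x \<and> F x + p (x, F x) = 0"
    using assms(12) by (auto simp: solves_nullcline_def)
  have Fc: "isCont F 0" using eventually_nhds_x_imp_x[OF evF] by simp
  have evF0: "\<forall>\<^sub>F x in at 0. F x + P (\<gamma> x) = 0"
    using evF unfolding eventually_nhds_conv_at
    by (auto elim!: eventually_mono simp: assms(9) restricted_def gp[unfolded \<kappa>_def])
  have F1: "expands 1 F 0" and \<eta>1: "expands 1 \<eta> 0"
    using expands_nullcline_1[OF P h0 F0 Fc] evF0 by (simp_all add: \<gamma>_def \<eta>_def)

  have ff: "f_fun q F = (\<lambda>x. Q (\<gamma> x))"
    by (simp add: f_fun_def fun_eq_iff assms(10) restricted_def gp[unfolded \<kappa>_def])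
  \<comment> \<open>For \<open>n = 1\<close> the exponent \<open>\<alpha>\<close> would be 1,
    whereas \<open>Q\<close> is \<open>O(x ^ 2)\<close> on the curve.\<close>
  have n2: "n \<ge> 2"
  proof (rule ccontr)
    assume "\<not> n \<ge> 2"
    with assms(16,18) have \<alpha>: "\<alpha> = 1" by simp
    have "expands 2 (\<lambda>x. Q (\<gamma> x)) (fps_const a * fps_X)"
      using leading_term_expands[OF assms(13)] by (simp add: \<alpha> ff numeral_2_eq_2)
    moreover have "expands 2 (\<lambda>x. Q (\<gamma> x)) 0"
      using expands_jet3_1[OF Q F1 \<eta>1] by (simp add: \<gamma>_def)
    ultimately have "fps_X ^ 2 dvd fps_const a * fps_X - 0" by (rule expands_unique)
    then have "a = 0"
      by (auto simp: fps_X_power_dvd_iff dest: spec[of _ 1])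
    with assms(17) show False by simp
  qed
  have f: "expands (2 * n) (\<lambda>x. Q (\<gamma> x)) (fps_const a * fps_X ^ (2 * n - 1))"
    using leading_term_expands[OF assms(13)] n2 by (simp add: assms(18) ff)
  have "expands (2 * n - 1) (\<lambda>x. Q (\<gamma> x)) 0"
    by (rule expands_cong_fps[OF expands_mono[OF f]]) simp_all
  then have fO: "(\<lambda>x. Q (\<gamma> x)) \<in> O[at 0](\<lambda>x. x ^ (2 * n - 1))"
    by (simp add: expands_0_iff)

  \<comment> \<open>Two derivatives of \<open>h\<close> are split off: the second ones appear when
    the invariance equation is differentiated, and continuity bounds them near the origin.\<close>
  obtain r' where r: "r = Suc (Suc r')"
    using assms(14,18) n2 by (intro that[of "r - 2"]) linarith
  define hx hy where "hx = (\<lambda>w. frechet_derivative h (at w) (1, 0))"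
    and "hy = (\<lambda>w. frechet_derivative h (at w) (0, 1))"
  have bs: "(1, 0) \<in> (Basis :: (real \<times> real) set)" "(0, 1) \<in> (Basis :: (real \<times> real) set)"
    by (auto simp: Basis_prod_def)
  have hd: "h differentiable (at w)" if "w \<in> U" for w
    using U(3) that by (simp add: r)
  have hCr: "class_C (Suc r') U hx" "class_C (Suc r') U hy"
    using U(3) bs unfolding r hx_def hy_def by (simp_all only: class_C.simps(2)[of "Suc r'"]) 
  have hxd: "hx differentiable (at w)" and hyd: "hy differentiable (at w)" if "w \<in> U" for w
    using hCr that by simp_all
  have fr: "frechet_derivative h (at w) (c, d) = c * hx w + d * hy w" if "w \<in> U" for w c d
    unfolding hx_def hy_def by (rule frechet_derivative_prod[OF hd[OF that]])
  have hD: "(h has_derivative (\<lambda>v. fst v * hx w + snd v * hy w)) (at w)" if "w \<in> U" for w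
  proof -
    have "frechet_derivative h (at w) = (\<lambda>v. fst v * hx w + snd v * hy w)"
      using fr[OF that] by auto
    with hd[OF that, unfolded frechet_derivative_works] show ?thesis by (simp only:)
  qed
  have inv_eq: "- lam * h w + R (graph_pt h w) = hx w * (snd w + P (graph_pt h w)) + hy w * Q (graph_pt h w)"
    if w: "w \<in> U" for w
  proof -
    obtain \<epsilon> u where "\<epsilon> > 0" "u 0 = graph_pt h w" "solves_ode_on (system_field lam P Q R) u {-\<epsilon><..<\<epsilon>}"
       "\<And>t. t \<in> {-\<epsilon><..<\<epsilon>} \<Longrightarrow> u t \<in> graph_pt h ` U"
      using inv[OF w] by blast
    from invariant_graph_equation[OF hd[OF w] this, unfolded fr[OF w]]
    show ?thesis
      by (cases w) (simp add: system_field_def graph_pt_def mult.commute)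
  qed

  have F_lim: "(F \<longlongrightarrow> 0) (at 0)" using Fc F0 by (simp add: isCont_def)
  have \<kappa>_lim: "(\<kappa> \<longlongrightarrow> 0) (at 0)"
    unfolding \<kappa>_def zero_prod_def by (intro tendsto_Pair F_lim tendsto_ident_at)
  have "isCont h 0" using hd[OF U(2)] by (rule differentiable_imp_continuous_within)
  then have \<eta>_lim: "(\<eta> \<longlongrightarrow> 0) (at 0)"
    using isCont_tendsto_compose[OF _ \<kappa>_lim, of h] h0 by (simp add: \<eta>_def \<kappa>_def)
  have \<gamma>_lim: "(\<gamma> \<longlongrightarrow> 0) (at 0)"
    unfolding \<gamma>_def zero_prod_def by (intro tendsto_Pair F_lim \<eta>_lim tendsto_ident_at)
  have \<kappa>U: "\<forall>\<^sub>F x in at 0. \<kappa> x \<in> U"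
    using \<kappa>_lim U by (auto simp: tendsto_def)

  define \<sigma> \<tau> where "\<sigma> = (\<lambda>x. hy (\<kappa> x))" and "\<tau> = (\<lambda>x. hx (\<kappa> x))"
  have fd0: "frechet_derivative h (at 0) = (\<lambda>_. 0)"
    using frechet_derivative_at[OF h0(2)] by simp
  have curve_bound: "expands 1 (\<lambda>x. g (\<kappa> x)) 0" if gd: "g differentiable (at 0)" "g 0 = 0" for g
  proof -
    obtain C where C: "\<forall>\<^sub>F w in nhds 0. \<bar>g w\<bar> \<le> C * norm w"
      using differentiable_bound_at_0[OF gd] by blast
    have "(\<lambda>x. g (\<kappa> x)) \<in> O[at 0](\<lambda>x. norm (\<kappa> x))"
      by (rule bigoI[of _ C]) (use filterlim_iff[THEN iffD1, OF \<kappa>_lim, rule_format, OF C] in \<open>simp\<close>)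
    moreover have "(\<lambda>x. norm (\<kappa> x)) \<in> O[at 0](\<lambda>x. x ^ 1)"
    proof -
      obtain c where c: "\<forall>\<^sub>F x in at 0. norm (F x) \<le> c * norm (x ^ 1)"
        using F1 unfolding expands_0_iff by (elim landau_o.bigE)
      have "\<forall>\<^sub>F x in at 0. norm (norm (\<kappa> x)) \<le> (1 + c) * norm (x ^ 1)"
        using c
      proof eventually_elim
        case (elim x)
        then show ?case using norm_Pair_le[of x "F x"] by (simp add: \<kappa>_def algebra_simps)
      qed
      then show ?thesis by (rule bigoI)
    qed
    ultimately show ?thesis unfolding expands_0_iff by (rule landau_o.big_trans)
  qed
  have \<sigma>1: "expands 1 \<sigma> 0" and \<tau>1: "expands 1 \<tau> 0"
    unfolding \<sigma>_def \<tau>_def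
    by (rule curve_bound; use hxd hyd U(2) in \<open>simp add: hx_def hy_def fd0\<close>)+

  \<comment> \<open>On the curve \<open>y + P\<close> vanishes, so the invariance equation reduces
    to \<open>- lam * \<eta> + R = \<sigma> * Q\<close>, of order
    \<open>1 + (2 * n - 1)\<close>.\<close>
  have "expands (1 + (2 * n - 1)) (\<lambda>x. \<sigma> x * Q (\<gamma> x)) 0"
    unfolding expands_0_iff power_add
    by (rule landau_o.big_mult[OF \<sigma>1[unfolded expands_0_iff] fO])
  moreover have "1 + (2 * n - 1) = 2 * n" using n2 by simp
  ultimately have "expands (2 * n) (\<lambda>x. \<sigma> x * Q (\<gamma> x)) 0" by (simp only:)
  moreover have "\<forall>\<^sub>F x in at 0. \<sigma> x * Q (\<gamma> x) = - lam * \<eta> x + R (\<gamma> x)"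
    using \<kappa>U evF0
  proof eventually_elim
    case (elim x)
    then show ?case using inv_eq[OF elim(1)]
      unfolding gp by (simp add: \<sigma>_def \<eta>_def \<kappa>_def)
  qed
  ultimately have eR: "expands (2 * n) (\<lambda>x. - lam * \<eta> x + R (\<gamma> x)) 0"
    by (rule expands_cong)

  obtain Fs Ts where Fs: "expands (2 * n) F Fs" and Ts: "expands (2 * n) \<eta> Ts"
    using expands_nullcline[OF P R lam F1 \<eta>1 evF0[unfolded \<gamma>_def] eR[unfolded \<gamma>_def], of "2 * n"] n2 by auto
  have n1: "1 \<le> 2 * n" using n2 by simp
  have Fs0: "Fs $ 0 = 0" and Ts0: "Ts $ 0 = 0"
    using expands_zero_const[OF Fs n1 F1] expands_zero_const[OF Ts n1 \<eta>1] .
  define s where "s = subst3 (\<lambda>x. x) Fs Ts"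
  have sub: "expands (2 * n) (\<lambda>x. G (\<gamma> x)) (s Gs)" if "has_fps3_expansion G Gs" for G Gs
    unfolding s_def \<gamma>_def by (rule expands_subst3[OF that Fs Ts n1 Fs0 Ts0])
  interpret s: subst3_ring_hom "\<lambda>x. x" Fs Ts
    by standard (simp_all add: is_ring_hom_id Fs0 Ts0)

  obtain Px Py Pz where P': "has_fps3_expansion Px (dx3 Ps)" "has_fps3_expansion Py (dy3 Ps)"
      "has_fps3_expansion Pz (dz3 Ps)"
    and dP: "\<forall>\<^sub>F w in nhds 0. (P has_derivative (\<lambda>v. Px w * fst v + Py w * fst (snd v) + Pz w * snd (snd v))) (at w)"
    using has_fps3_expansion_derivative[OF P(1)] by blast
  obtain Qx Qy Qz where Q': "has_fps3_expansion Qx (dx3 Qs)" "has_fps3_expansion Qy (dy3 Qs)"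
      "has_fps3_expansion Qz (dz3 Qs)"
    and dQ: "\<forall>\<^sub>F w in nhds 0. (Q has_derivative (\<lambda>v. Qx w * fst v + Qy w * fst (snd v) + Qz w * snd (snd v))) (at w)"
    using has_fps3_expansion_derivative[OF Q(1)] by blast
  obtain Rx Ry Rz where R': "has_fps3_expansion Rx (dx3 Rs)" "has_fps3_expansion Ry (dy3 Rs)"
      "has_fps3_expansion Rz (dz3 Rs)"
    and dR: "\<forall>\<^sub>F w in nhds 0. (R has_derivative (\<lambda>v. Rx w * fst v + Ry w * fst (snd v) + Rz w * snd (snd v))) (at w)"
    using has_fps3_expansion_derivative[OF R(1)] by blast
  have ev\<gamma>: "\<forall>\<^sub>F x in at 0. Pr (\<gamma> x)" if "\<forall>\<^sub>F w in nhds 0. Pr w" for Pr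
    using filterlim_iff[THEN iffD1, OF \<gamma>_lim, rule_format, OF that] .
  have graph_D: "((\<lambda>w. G (graph_pt h w)) has_derivative
      (\<lambda>v. gx * fst v + gy * snd v + gz * (fst v * \<tau> x + snd v * \<sigma> x))) (at (\<kappa> x))"
    if G: "(G has_derivative (\<lambda>v. gx * fst v + gy * fst (snd v) + gz * snd (snd v))) (at (\<gamma> x))"
      and x: "\<kappa> x \<in> U" for G :: "real \<times> real \<times> real \<Rightarrow> real" and gx gy gz x
  proof -
    have "(graph_pt h has_derivative (\<lambda>v. (fst v, snd v, fst v * \<tau> x + snd v * \<sigma> x))) (at (\<kappa> x))"
    proof -
      have "((\<lambda>w. (fst w, snd w, h w)) has_derivative
          (\<lambda>v. (fst v, snd v, fst v * \<tau> x + snd v * \<sigma> x))) (at (\<kappa> x))"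
        using hD[OF x] unfolding \<tau>_def \<sigma>_def by (intro has_derivative_Pair has_derivative_fst has_derivative_snd has_derivative_ident)
      then show ?thesis by (simp add: graph_pt_def case_prod_unfold)
    qed
    from has_derivative_compose[OF this, of G, unfolded gp, OF G] show ?thesis by simp
  qed

  define hxx hxy hyx hyy where "hxx = (\<lambda>x. frechet_derivative hx (at (\<kappa> x)) (1, 0))"
    and "hxy = (\<lambda>x. frechet_derivative hx (at (\<kappa> x)) (0, 1))"
    and "hyx = (\<lambda>x. frechet_derivative hy (at (\<kappa> x)) (1, 0))"
    and "hyy = (\<lambda>x. frechet_derivative hy (at (\<kappa> x)) (0, 1))"
  have second_bound: "(\<lambda>x. frechet_derivative hy (at (\<kappa> x)) v) \<in> O[at 0](\<lambda>_. 1)"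
    if "v \<in> Basis" for v
  proof -
    have "class_C r' U (\<lambda>w. frechet_derivative hy (at w) v)"
      using hCr(2) that by simp
    then have "continuous_on U (\<lambda>w. frechet_derivative hy (at w) v)" by (rule class_C_continuous_on)
    then have "isCont (\<lambda>w. frechet_derivative hy (at w) v) 0"
      using U by (simp add: continuous_on_eq_continuous_at)
    from isCont_tendsto_compose[OF this \<kappa>_lim] show ?thesis
      by (intro bigoI_tendsto) auto
  qed
  \<comment> \<open>Bounded second derivatives times \<open>Q\<close> have order
    \<open>2 * n - 1 \<ge> n\<close> and do not disturb the gradient equations modulo
    \<open>x ^ n\<close>.\<close>
  have err: "expands (2 * n - 1) (\<lambda>x. g x * Q (\<gamma> x)) 0" if "g \<in> O[at 0](\<lambda>_. 1)" for g
    using landau_o.big_mult[OF that fO] by (simp add: expands_0_iff)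

  \<comment> \<open>The invariance equation differentiated in both directions; on the curve the factor
    \<open>y + P\<close> of the second derivatives of \<open>h\<close> vanishes.\<close>
  have inv_D: "\<forall>\<^sub>F x in at 0.
      - lam * \<sigma> x + Ry (\<gamma> x) + Rz (\<gamma> x) * \<sigma> x - \<tau> x * (1 + Py (\<gamma> x) + Pz (\<gamma> x) * \<sigma> x)
        - \<sigma> x * (Qy (\<gamma> x) + Qz (\<gamma> x) * \<sigma> x) = hyy x * Q (\<gamma> x)
    \<and> - lam * \<tau> x + Rx (\<gamma> x) + Rz (\<gamma> x) * \<tau> x - \<tau> x * (Px (\<gamma> x) + Pz (\<gamma> x) * \<tau> x)
        - \<sigma> x * (Qx (\<gamma> x) + Qz (\<gamma> x) * \<tau> x) = hyx x * Q (\<gamma> x)"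
    using \<kappa>U evF0 ev\<gamma>[OF dP] ev\<gamma>[OF dQ] ev\<gamma>[OF dR]
  proof eventually_elim
    case (elim x)
    let ?P = "\<lambda>w. P (graph_pt h w)" and ?Q = "\<lambda>w. Q (graph_pt h w)" and ?R = "\<lambda>w. R (graph_pt h w)"
    note gD = graph_D[OF elim(3,1)] graph_D[OF elim(4,1)] graph_D[OF elim(5,1)]
    have hx': "(hx has_derivative (\<lambda>v. fst v * hxx x + snd v * hxy x)) (at (\<kappa> x))"
      and hy': "(hy has_derivative (\<lambda>v. fst v * hyx x + snd v * hyy x)) (at (\<kappa> x))"
    proof -
      have "frechet_derivative hx (at (\<kappa> x)) (c, d) = c * hxx x + d * hxy x"
        "frechet_derivative hy (at (\<kappa> x)) (c, d) = c * hyx x + d * hyy x" for c d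
        unfolding hxx_def hxy_def hyx_def hyy_def
        by (rule frechet_derivative_prod[OF hxd[OF elim(1)]], rule frechet_derivative_prod[OF hyd[OF elim(1)]])
      then have "frechet_derivative hx (at (\<kappa> x)) = (\<lambda>v. fst v * hxx x + snd v * hxy x)"
        "frechet_derivative hy (at (\<kappa> x)) = (\<lambda>v. fst v * hyx x + snd v * hyy x)"
        by auto
      then show "(hx has_derivative (\<lambda>v. fst v * hxx x + snd v * hxy x)) (at (\<kappa> x))"
        "(hy has_derivative (\<lambda>v. fst v * hyx x + snd v * hyy x)) (at (\<kappa> x))"
        using hxd[OF elim(1), unfolded frechet_derivative_works] hyd[OF elim(1), unfolded frechet_derivative_works]
        by (simp_all only:)
    qed
    let ?L' = "\<lambda>v. - lam * (fst v * \<tau> x + snd v * \<sigma> x)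
          + (Rx (\<gamma> x) * fst v + Ry (\<gamma> x) * snd v + Rz (\<gamma> x) * (fst v * \<tau> x + snd v * \<sigma> x))"
    let ?M' = "\<lambda>v. (\<tau> x * (snd v + (Px (\<gamma> x) * fst v + Py (\<gamma> x) * snd v + Pz (\<gamma> x) * (fst v * \<tau> x + snd v * \<sigma> x)))
           + (fst v * hxx x + snd v * hxy x) * (F x + P (\<gamma> x)))
          + (\<sigma> x * (Qx (\<gamma> x) * fst v + Qy (\<gamma> x) * snd v + Qz (\<gamma> x) * (fst v * \<tau> x + snd v * \<sigma> x))
           + (fst v * hyx x + snd v * hyy x) * Q (\<gamma> x))"
    have L: "((\<lambda>w. - lam * h w + ?R w) has_derivative ?L') (at (\<kappa> x))"
      using hD[OF elim(1)] unfolding \<tau>_def[symmetric] \<sigma>_def[symmetric]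
      by (intro has_derivative_add has_derivative_mult_right gD) (simp add: \<tau>_def \<sigma>_def)
    have M: "((\<lambda>w. hx w * (snd w + ?P w) + hy w * ?Q w) has_derivative ?M') (at (\<kappa> x))"
    proof -
      have s: "snd (\<kappa> x) = F x" "hx (\<kappa> x) = \<tau> x" "hy (\<kappa> x) = \<sigma> x" by (simp_all add: \<kappa>_def \<tau>_def \<sigma>_def)
      have "((\<lambda>w. snd w + ?P w) has_derivative (\<lambda>v. snd v
          + (Px (\<gamma> x) * fst v + Py (\<gamma> x) * snd v + Pz (\<gamma> x) * (fst v * \<tau> x + snd v * \<sigma> x)))) (at (\<kappa> x))"
        by (intro has_derivative_add has_derivative_snd has_derivative_ident gD)
      from has_derivative_add[OF has_derivative_mult[OF hx' this] has_derivative_mult[OF hy' gD(2)]]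
      show ?thesis unfolding s gp .
    qed
    have "((\<lambda>w. hx w * (snd w + ?P w) + hy w * ?Q w) has_derivative ?L') (at (\<kappa> x))"
      by (rule has_derivative_transform_within_open[OF L U(1) elim(1)]) (rule inv_eq)
    then have "?L' = ?M'" using M by (rule has_derivative_unique)
    from fun_cong[OF this, of "(0, 1)"] fun_cong[OF this, of "(1, 0)"] elim(2)
    show ?case by (simp add: algebra_simps)
  qed
  have m: "n \<le> 2 * n - 1" "n \<le> 2 * n" using n2 by auto
  have err': "expands n (\<lambda>x. hyy x * Q (\<gamma> x)) 0" "expands n (\<lambda>x. hyx x * Q (\<gamma> x)) 0"
    unfolding hyy_def hyx_def by (rule expands_mono[OF err[OF second_bound[OF bs(2)]] m(1)],
        rule expands_mono[OF err[OF second_bound[OF bs(1)]] m(1)])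
  have eS: "expands n (\<lambda>x. - lam * \<sigma> x + Ry (\<gamma> x) + Rz (\<gamma> x) * \<sigma> x - \<tau> x * (1 + Py (\<gamma> x) + Pz (\<gamma> x) * \<sigma> x)
        - \<sigma> x * (Qy (\<gamma> x) + Qz (\<gamma> x) * \<sigma> x)) 0"
    by (rule expands_cong[OF err'(1)]) (use inv_D in \<open>eventually_elim; simp\<close>)
  have eU: "expands n (\<lambda>x. - lam * \<tau> x + Rx (\<gamma> x) + Rz (\<gamma> x) * \<tau> x - \<tau> x * (Px (\<gamma> x) + Pz (\<gamma> x) * \<tau> x)
        - \<sigma> x * (Qx (\<gamma> x) + Qz (\<gamma> x) * \<tau> x)) 0"
    by (rule expands_cong[OF err'(2)]) (use inv_D in \<open>eventually_elim; simp\<close>)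
  have low: "s (dx3 G) $ 0 = 0" "s (dy3 G) $ 0 = 0" "s (dz3 G) $ 0 = 0" if "jet3 1 G = 0" for G
    using that by (simp_all add: s_def s.nth_0 coeff3_dx3 coeff3_dy3 coeff3_dz3 jet3_1_zeroD)
  note sub_n = expands_mono[OF sub m(2)]
  obtain Ss Us where Ss: "expands n \<sigma> Ss" and Us: "expands n \<tau> Us"
    using expands_gradient[OF lam \<sigma>1 \<tau>1 sub_n[OF P'(1)] low(1)[OF P(2)] sub_n[OF P'(2)] low(2)[OF P(2)]
        sub_n[OF P'(3)] low(3)[OF P(2)] sub_n[OF Q'(1)] low(1)[OF Q(2)] sub_n[OF Q'(2)] low(2)[OF Q(2)]
        sub_n[OF Q'(3)] low(3)[OF Q(2)] sub_n[OF R'(1)] sub_n[OF R'(2)] sub_n[OF R'(3)] low(3)[OF R(2)]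
        eS eU assms(16) order_refl] by blast
  have Ss0: "Ss $ 0 = 0" using expands_zero_const[OF Ss assms(16) \<sigma>1] .

  \<comment> \<open>\<open>p\<close> and \<open>q\<close> depend on \<open>x\<close> and
    \<open>y\<close> also through \<open>h\<close>, which contributes \<open>Pz * \<tau>\<close> and
    \<open>Qz * \<sigma>\<close>.\<close>
  have Phi: "\<forall>\<^sub>F x in at 0. Phi_fun p q F x = Px (\<gamma> x) + Pz (\<gamma> x) * \<tau> x + Qy (\<gamma> x) + Qz (\<gamma> x) * \<sigma> x"
    using \<kappa>U ev\<gamma>[OF dP] ev\<gamma>[OF dQ]
  proof eventually_elim
    case (elim x)
    have lin: "((\<lambda>s. (s, F x)) has_derivative (\<lambda>s. (s, 0))) (at x)"
       "((\<lambda>t. (x, t)) has_derivative (\<lambda>t. (0, t))) (at (F x))"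
      by (auto intro!: derivative_eq_intros)
    have "((\<lambda>s. p (s, F x)) has_derivative (\<lambda>s. s * (Px (\<gamma> x) + Pz (\<gamma> x) * \<tau> x))) (at x)"
      using has_derivative_compose[OF lin(1), OF graph_D[OF elim(2,1), unfolded \<kappa>_def]]
      by (simp add: assms(9) restricted_def algebra_simps)
    moreover have "((\<lambda>t. q (x, t)) has_derivative (\<lambda>t. t * (Qy (\<gamma> x) + Qz (\<gamma> x) * \<sigma> x))) (at (F x))"
      using has_derivative_compose[OF lin(2), OF graph_D[OF elim(3,1), unfolded \<kappa>_def]]
      by (simp add: assms(10) restricted_def algebra_simps)
    ultimately show ?case
      unfolding Phi_fun_def
      by (simp add: has_field_derivative_def mult.commute[of _ "_ + _"] DERIV_imp_deriv)
  qed
  have "expands n (Phi_fun p q F) (fps_const b * fps_X ^ (n - 1))"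
    using leading_term_expands[OF assms(15)] assms(16) by (simp add: assms(19))
  from expands_cong[OF this Phi]
  have ePhi: "expands n (\<lambda>x. Px (\<gamma> x) + Pz (\<gamma> x) * \<tau> x + Qy (\<gamma> x) + Qz (\<gamma> x) * \<sigma> x)
      (fps_const b * fps_X ^ (n - 1))" .

  note ex = expands_add expands_diff expands_mult expands_const[of n 1, simplified]
  have b: "b \<noteq> 0" using assms(15) by (simp add: leading_term_def)
  have "\<not> formal_first_integral lam Ps Qs Rs H" for H
  proof (rule no_formal_first_integral[OF n2 lam b assms(20) P(2) Q(2) R(2) Fs0 Ts0 Ss0])
    \<comment> \<open>Each congruence compares two expansions of one function: the one computed by
      substituting jets and the one known from the system.\<close>
    have "expands (2 * n) (\<lambda>_. 0) (Fs + s Ps)"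
      by (rule expands_cong[OF expands_add[OF Fs sub[OF P(1)]] evF0])
    then show "fps_X ^ (2 * n) dvd Fs + subst3 (\<lambda>x. x) Fs Ts Ps"
      unfolding s_def by (rule expands_zero_unique)
    show "fps_X ^ (2 * n) dvd - fps_const lam * Ts + subst3 (\<lambda>x. x) Fs Ts Rs"
      using expands_unique[OF expands_add[OF expands_cmult[OF Ts, of "- lam"] sub[OF R(1)]] eR]
      by (simp add: s_def)
    show "fps_X ^ (2 * n) dvd subst3 (\<lambda>x. x) Fs Ts Qs - fps_const a * fps_X ^ (2 * n - 1)"
      using expands_unique[OF sub[OF Q(1)] f] by (simp add: s_def)
    have "expands n (\<lambda>x. - lam * \<sigma> x + Ry (\<gamma> x) + Rz (\<gamma> x) * \<sigma> x - \<tau> x * (1 + Py (\<gamma> x) + Pz (\<gamma> x) * \<sigma> x)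
        - \<sigma> x * (Qy (\<gamma> x) + Qz (\<gamma> x) * \<sigma> x))
      (fps_const (- lam) * Ss + s (dy3 Rs) + s (dz3 Rs) * Ss
        - Us * (1 + s (dy3 Ps) + s (dz3 Ps) * Ss) - Ss * (s (dy3 Qs) + s (dz3 Qs) * Ss))"
      by (intro ex expands_cmult Ss Us sub_n P' Q' R')
    from expands_unique[OF this eS]
    show "fps_X ^ n dvd - fps_const lam * Ss + subst3 (\<lambda>x. x) Fs Ts (dy3 Rs) + subst3 (\<lambda>x. x) Fs Ts (dz3 Rs) * Ss
      - Us * (1 + subst3 (\<lambda>x. x) Fs Ts (dy3 Ps) + subst3 (\<lambda>x. x) Fs Ts (dz3 Ps) * Ss)
      - Ss * (subst3 (\<lambda>x. x) Fs Ts (dy3 Qs) + subst3 (\<lambda>x. x) Fs Ts (dz3 Qs) * Ss)"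
      by (simp add: s_def)
    have "expands n (\<lambda>x. - lam * \<tau> x + Rx (\<gamma> x) + Rz (\<gamma> x) * \<tau> x - \<tau> x * (Px (\<gamma> x) + Pz (\<gamma> x) * \<tau> x)
        - \<sigma> x * (Qx (\<gamma> x) + Qz (\<gamma> x) * \<tau> x))
      (fps_const (- lam) * Us + s (dx3 Rs) + s (dz3 Rs) * Us
        - Us * (s (dx3 Ps) + s (dz3 Ps) * Us) - Ss * (s (dx3 Qs) + s (dz3 Qs) * Us))"
      by (intro ex expands_cmult Ss Us sub_n P' Q' R')
    from expands_unique[OF this eU]
    show "fps_X ^ n dvd - fps_const lam * Us + subst3 (\<lambda>x. x) Fs Ts (dx3 Rs) + subst3 (\<lambda>x. x) Fs Ts (dz3 Rs) * Us
      - Us * (subst3 (\<lambda>x. x) Fs Ts (dx3 Ps) + subst3 (\<lambda>x. x) Fs Ts (dz3 Ps) * Us)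
      - Ss * (subst3 (\<lambda>x. x) Fs Ts (dx3 Qs) + subst3 (\<lambda>x. x) Fs Ts (dz3 Qs) * Us)"
      by (simp add: s_def)
    have "expands n (\<lambda>x. Px (\<gamma> x) + Pz (\<gamma> x) * \<tau> x + Qy (\<gamma> x) + Qz (\<gamma> x) * \<sigma> x)
      (s (dx3 Ps) + s (dz3 Ps) * Us + s (dy3 Qs) + s (dz3 Qs) * Ss)"
      by (intro ex Ss Us sub_n P' Q')
    from expands_unique[OF this ePhi]
    show "fps_X ^ n dvd subst3 (\<lambda>x. x) Fs Ts (dx3 Ps) + subst3 (\<lambda>x. x) Fs Ts (dz3 Ps) * Us
      + subst3 (\<lambda>x. x) Fs Ts (dy3 Qs) + subst3 (\<lambda>x. x) Fs Ts (dz3 Qs) * Ss - fps_const b * fps_X ^ (n - 1)"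
      by (simp add: s_def)
  qed
  then show ?thesis by blast
qed

end
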